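(* Let $T[1,n]$ be a text over an alphabet of size $\sigma$ polynomial in $n$ and let $\epsilon>0$ be any constant. For the cost of a partition of $T$ into contiguous substrings $T=T_1T_2\cdots T_k$ defined as $\sum_i \mathrm{cost}(T_i)$, where $\mathrm{cost}$ is either the $0$-th order (non-adaptive) estimate or the $0$-th order adaptive estimate defined in the context, one can compute in $O(n\log_{1+\epsilon}n)$ time and $O(n)$ space a partition of $T$ whose cost is at most $(1+\epsilon)$ times the minimum cost over all partitions of $T$.
   Context: For a string $S$ of length $m$ in which symbol $c$ occurs $m_c$ times: $H_0(S)=\frac1m\sum_c m_c\log\frac{m}{m_c}$ (0-th order empirical entropy) and $H_0^a(S)=\frac1m\sum_c\log\frac{m!}{m_c!}$... more precisely $mH_0^a(S)=\log(m!)-\sum_c\log(m_c!)$ (0-th order adaptive empirical entropy). The non-adaptive estimate is $\mathrm{cost}(S)=|S|H_0(S)+f_0(|S|,|\Sigma_S|)$, where $|\Sigma_S|$ is the number of distinct symbols in $S$ and $f_0$ is a function (the cost of the source model and other compressor inefficiencies) computable in constant time; the adaptive estimate is $\mathrm{cost}(S)=|S|H_0^a(S)$. The paper assumes the cost of a substring is positive and is at most the cost of any substring of $T$ containing it. Computation is in the word-RAM model with constant-time arithmetic (including logarithms) on $O(\log n)$-bit values. *)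

theory Defs
  imports Complex_Main "HOL-Library.Sublist"
begin

section \<open>Empirical entropies and partition costs\<close>

definition H0 :: "'a list \<Rightarrow> real" where
  "H0 S = (\<Sum>c\<in>set S. real (count_list S c) * log 2 (real (length S) / real (count_list S c)))
            / real (length S)"

definition H0a :: "'a list \<Rightarrow> real" where
  "H0a S = (log 2 (fact (length S)) - (\<Sum>c\<in>set S. log 2 (fact (count_list S c))))
            / real (length S)"

definition cost_nonadaptive :: "(nat \<Rightarrow> nat \<Rightarrow> real) \<Rightarrow> 'a list \<Rightarrow> real" where
  "cost_nonadaptive f S = real (length S) * H0 S + f (length S) (card (set S))"

definition cost_adaptive :: "'a list \<Rightarrow> real" where
  "cost_adaptive S = real (length S) * H0a S"

definition partitions :: "'a list \<Rightarrow> 'a list list set" where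
  "partitions T = {Ps. concat Ps = T \<and> [] \<notin> set Ps}"

definition partition_cost :: "('a list \<Rightarrow> real) \<Rightarrow> 'a list list \<Rightarrow> real" where
  "partition_cost cost Ps = (\<Sum>S\<leftarrow>Ps. cost S)"

lemma finite_partitions: "finite (partitions T)"
proof (rule finite_subset)
  have len: "length Ps \<le> length (concat Ps)" if "[] \<notin> set Ps" for Ps :: "'a list list"
    using that
  proof (induction Ps)
    case (Cons P Ps)
    then show ?case by (cases P) auto
  qed simp
  show "partitions T \<subseteq> {Ps. set Ps \<subseteq> {S. set S \<subseteq> set T \<and> length S \<le> length T} \<and> length Ps \<le> length T}"
  proof
    fix Ps assume "Ps \<in> partitions T"
    then have T: "T = concat Ps" and ne: "[] \<notin> set Ps"
      by (auto simp: partitions_def)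
    have "length S \<le> length T" if "S \<in> set Ps" for S
      using that by (simp add: T length_concat member_le_sum_list)
    then show "Ps \<in> {Ps. set Ps \<subseteq> {S. set S \<subseteq> set T \<and> length S \<le> length T} \<and> length Ps \<le> length T}"
      using len[OF ne] by (auto simp: T)
  qed
  show "finite {Ps. set Ps \<subseteq> {S. set S \<subseteq> set T \<and> length S \<le> length T} \<and> length Ps \<le> length T}"
    by (intro finite_lists_length_le) auto
qed

lemma partitions_nonempty: "partitions T \<noteq> {}"
proof -
  have "map (\<lambda>x. [x]) T \<in> partitions T"
    by (auto simp: partitions_def)
  then show ?thesis by blast
qed

definition optimal_cost :: "('a list \<Rightarrow> real) \<Rightarrow> 'a list \<Rightarrow> real" where
  "optimal_cost cost T = Min (partition_cost cost ` partitions T)"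

text \<open>
  The following is an assumption on the non-adaptive cost only.  No nonempty text satisfies it
  for \<open>cost_adaptive\<close>, which is monotone but vanishes on strings with one distinct symbol.
\<close>

definition positive_monotone_on :: "('a list \<Rightarrow> real) \<Rightarrow> 'a list \<Rightarrow> bool" where
  "positive_monotone_on cost T \<longleftrightarrow>
     (\<forall>S. S \<noteq> [] \<and> sublist S T \<longrightarrow> 0 < cost S) \<and>
     (\<forall>S S'. S \<noteq> [] \<and> sublist S S' \<and> sublist S' T \<longrightarrow> cost S \<le> cost S')"


lemma cost_adaptive_singleton: "cost_adaptive [x] = 0"
  by (simp add: cost_adaptive_def H0a_def)


section \<open>Word RAM\<close>

text \<open>
  Programs work on registers and on a memory of integer words.  Since a logarithm is in general
  irrational, it is delivered in fixed point: \<open>Log r x s\<close> puts \<open>\<lfloor>s * log 2 x\<rfloor>\<close> into register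
  \<open>r\<close>, the scale \<open>s\<close> being chosen by the program.  Likewise \<open>Fun r x y s\<close> puts
  \<open>\<lfloor>s * f x y\<rfloor>\<close> into \<open>r\<close>, where \<open>f\<close> is the function that the machine is assumed to
  evaluate in constant time.
\<close>

datatype operand = Imm int | Reg nat

datatype binop = Add | Sub | Mul | Div | Mod

datatype prog =
    Skip
  | Bin nat binop operand operand
  | Log nat operand operand
  | Fun nat operand operand operand
  | Load nat operand
  | Store operand operand
  | Seq prog prog
  | IfLess operand operand prog prog
  | WhileLess operand operand prog

type_synonym state = "(nat \<Rightarrow> int) \<times> (nat \<Rightarrow> int)" \<comment> \<open>registers, memory\<close>

fun val :: "(nat \<Rightarrow> int) \<Rightarrow> operand \<Rightarrow> int" where
  "val R (Imm k) = k"
| "val R (Reg i) = R i"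

fun binop_val :: "binop \<Rightarrow> int \<Rightarrow> int \<Rightarrow> int option" where
  "binop_val Add x y = Some (x + y)"
| "binop_val Sub x y = Some (x - y)"
| "binop_val Mul x y = Some (x * y)"
| "binop_val Div x y = (if y = 0 then None else Some (x div y))"
| "binop_val Mod x y = (if y = 0 then None else Some (x mod y))"

text \<open>
  \<open>exec f W m P st t st'\<close>: on a machine whose words are the integers of absolute value below
  \<open>W\<close> and whose memory consists of the cells \<open>0, \<dots>, m - 1\<close>, program \<open>P\<close> started in \<open>st\<close> halts
  in \<open>st'\<close> after \<open>t\<close> steps.  Overflow, division by zero, the logarithm of a nonpositive number
  and access to a cell outside the memory block execution: no rule applies.  Hence a run
  with parameter \<open>m\<close> uses space at most \<open>m\<close>, besides the fixed number of registers of \<open>P\<close>.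
\<close>

inductive exec :: "(nat \<Rightarrow> nat \<Rightarrow> real) \<Rightarrow> int \<Rightarrow> nat \<Rightarrow> prog \<Rightarrow> state \<Rightarrow> nat \<Rightarrow> state \<Rightarrow> bool"
  for f :: "nat \<Rightarrow> nat \<Rightarrow> real" and W :: int and m :: nat where
  Skip: "exec f W m Skip st 1 st"
| Bin: "binop_val b (val R x) (val R y) = Some v \<Longrightarrow> \<bar>v\<bar> < W \<Longrightarrow>
    exec f W m (Bin r b x y) (R, M) 1 (R(r := v), M)"
| Log: "val R x > 0 \<Longrightarrow> v = \<lfloor>real_of_int (val R s) * log 2 (real_of_int (val R x))\<rfloor> \<Longrightarrow> \<bar>v\<bar> < W \<Longrightarrow>
    exec f W m (Log r x s) (R, M) 1 (R(r := v), M)"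
| Fun: "val R x \<ge> 0 \<Longrightarrow> val R y \<ge> 0 \<Longrightarrow>
    v = \<lfloor>real_of_int (val R s) * f (nat (val R x)) (nat (val R y))\<rfloor> \<Longrightarrow> \<bar>v\<bar> < W \<Longrightarrow>
    exec f W m (Fun r x y s) (R, M) 1 (R(r := v), M)"
| Load: "0 \<le> val R x \<Longrightarrow> val R x < int m \<Longrightarrow> \<bar>val R x\<bar> < W \<Longrightarrow>
    \<bar>M (nat (val R x))\<bar> < W \<Longrightarrow>
    exec f W m (Load r x) (R, M) 1 (R(r := M (nat (val R x))), M)"
| Store: "0 \<le> val R x \<Longrightarrow> val R x < int m \<Longrightarrow> \<bar>val R x\<bar> < W \<Longrightarrow> \<bar>val R y\<bar> < W \<Longrightarrow>
    exec f W m (Store x y) (R, M) 1 (R, M(nat (val R x) := val R y))"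
| Seq: "exec f W m P st t st' \<Longrightarrow> exec f W m Q st' t' st'' \<Longrightarrow>
    exec f W m (Seq P Q) st (t + t') st''"
| IfTrue: "val R x < val R y \<Longrightarrow> exec f W m P (R, M) t st' \<Longrightarrow>
    exec f W m (IfLess x y P Q) (R, M) (t + 1) st'"
| IfFalse: "\<not> val R x < val R y \<Longrightarrow> exec f W m Q (R, M) t st' \<Longrightarrow>
    exec f W m (IfLess x y P Q) (R, M) (t + 1) st'"
| WhileTrue: "val R x < val R y \<Longrightarrow> exec f W m P (R, M) t st' \<Longrightarrow>
    exec f W m (WhileLess x y P) st' t' st'' \<Longrightarrow>
    exec f W m (WhileLess x y P) (R, M) (t + t' + 1) st''"
| WhileFalse: "\<not> val R x < val R y \<Longrightarrow>
    exec f W m (WhileLess x y P) (R, M) 1 (R, M)"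


section \<open>Approximation algorithms for partitioning\<close>

definition input :: "nat list \<Rightarrow> state" where
  "input T = ((\<lambda>_. 0)(0 := int (length T)), \<lambda>i. if i < length T then int (T ! i) else 0)"

text \<open>A partition is output as the number of its parts in register \<open>0\<close> and the sequence of
  their lengths at the beginning of the memory.\<close>

definition outputs :: "state \<Rightarrow> 'a list list \<Rightarrow> bool" where
  "outputs st Ps \<longleftrightarrow> fst st 0 = int (length Ps) \<and> (\<forall>i<length Ps. snd st i = int (length (Ps ! i)))"

text \<open>
  Words have \<open>c * log 2 (n + 1)\<close> bits.  The program must be correct on every text of \<open>\<T>\<close>;
  the bounds on time and space are asymptotic.
\<close>

definition approx_partition_algorithm ::
  "(nat \<Rightarrow> nat \<Rightarrow> real) \<Rightarrow> (nat list \<Rightarrow> real) \<Rightarrow> nat list set \<Rightarrow> real \<Rightarrow> prog \<Rightarrow>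
    (nat \<Rightarrow> real) \<Rightarrow> (nat \<Rightarrow> real) \<Rightarrow> bool" where
  "approx_partition_algorithm f cost \<T> \<epsilon> P time space \<longleftrightarrow>
     (\<exists>c N. \<forall>T\<in>\<T>. \<exists>m t st Ps.
        exec f ((int (length T) + 1) ^ c) m P (input T) t st \<and>
        outputs st Ps \<and> Ps \<in> partitions T \<and>
        partition_cost cost Ps \<le> (1 + \<epsilon>) * optimal_cost cost T \<and>
        (N \<le> length T \<longrightarrow> real t \<le> time (length T) \<and> real m \<le> space (length T)))"

text \<open>Texts over the alphabet \<open>{0, \<dots>, a * n ^ d - 1}\<close>.\<close>

definition texts :: "nat \<Rightarrow> nat \<Rightarrow> nat list set" where
  "texts a d = {T. T \<noteq> [] \<and> set T \<subseteq> {..<a * length T ^ d}}"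

text \<open>A function that can be evaluated in constant time on \<open>O(log n)\<close>-bit words has values of
  \<open>O(log n)\<close> bits, i.e. polynomially bounded ones.\<close>

definition polynomially_bounded :: "(nat \<Rightarrow> nat \<Rightarrow> real) \<Rightarrow> bool" where
  "polynomially_bounded f \<longleftrightarrow>
     (\<exists>A B. \<forall>m k. 1 \<le> k \<and> k \<le> m \<longrightarrow> \<bar>f m k\<bar> \<le> A * real m ^ B)"

end

(* Cover the costs by a geometric sequence of thresholds of ratio below 1 + epsilon.  Costs lie between
   f0 1 1, the cost of a single symbol, and a polynomial in n, so O(log n / log (1 + epsilon)) thresholds
   suffice.  For each threshold, the longest affordable window at every position is found by sliding two
   pointers from right to left; monotonicity of the cost ensures that no affordable window is missed.
   A dynamic program over the suffixes that considers only these windows, each charged its threshold,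
   loses a factor of at most 1 + epsilon.  Costs are evaluated in fixed point with scale K (n + 1); the
   rounding errors add up to at most n + 2, which is negligible against K (n + 1) f0 1 1 for large K.

   Linear space: a window needs a table of symbol counts, so the thresholds are treated one after the
   other.  The two-pointer run of one threshold passes through at most 2n states (i, r) with distinct
   sums i + r, so it is recorded by 2n bits, and the bits of all thresholds for the same sum fit into one
   word.  The dynamic program then replays all runs in parallel without any counts.

   Symbols are first renamed to numbers below n by treating their digits to base n + 1 one at a time, the
   pairs (old name, digit) being bucketed by old name.

   The adaptive cost vanishes on single symbols, so the partition into singletons is optimal for it. *)
theory Submission
  imports Defs
begin

section \<open>Program logic with time credits\<close>

text \<open>The factor \<open>C\<close> is chosen before \<open>\<epsilon>\<close>, so
  \<open>\<epsilon>\<close> may only influence the immediates of the program, the exponent of the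
  word size and the length from which the bounds hold. This dictates the ratio \<open>p / q\<close>
  of the thresholds: it is rational because immediates are integers, below
  \<open>1 + \<epsilon>\<close> to leave slack for rounding, and above
  \<open>sqrt (1 + \<epsilon>)\<close> so that logarithms to base \<open>p / q\<close> are at most
  twice those to base \<open>1 + \<epsilon>\<close>.

  The obstacle is that rounded estimates need not be monotone although the costs are. The two
  directions of the analysis therefore use different sides of the estimate: the output is bounded
  because an estimate never falls below the scaled cost, whereas windows are shown to reach far
  enough by bounding all their suffixes through the true cost plus the full rounding allowance
  \<open>n + 2\<close>.

  The program knows no bound on the number of thresholds. It stops at the first one for which the
  window at position \<open>0\<close> is the whole text; polynomial bounds occur only in the
  analysis, where they show that one bit per threshold fits into a word.\<close>

definition bounded :: "int \<Rightarrow> state \<Rightarrow> bool" where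
  "bounded W st \<longleftrightarrow> (\<forall>x. \<bar>fst st x\<bar> < W) \<and> (\<forall>a. \<bar>snd st a\<bar> < W)"

lemma bounded_upd:
  assumes "bounded W (R, M)" "\<bar>v\<bar> < W"
  shows "bounded W (R(r := v), M)" "bounded W (R, M(a := v))"
  using assms by (auto simp: bounded_def)

abbreviation seq_prog (infixr ";;" 55) where "P ;; Q \<equiv> Seq P Q"

text \<open>\<open>m_le_W\<close> makes every cell address a machine word, so loads and stores need
  only the check against \<open>m\<close>.\<close>

locale ram =
  fixes f :: "nat \<Rightarrow> nat \<Rightarrow> real" and W :: int and m :: nat
  assumes m_le_W: "int m \<le> W"
begin

text \<open>The postcondition \<open>Q\<close> is applied to the time left over from \<open>t\<close>.  Boundedness of the state is
  carried along, so that only newly computed values need to be checked for overflow.\<close>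

definition wp :: "prog \<Rightarrow> (state \<Rightarrow> nat \<Rightarrow> bool) \<Rightarrow> state \<Rightarrow> nat \<Rightarrow> bool" where
  "wp P Q st t \<longleftrightarrow> (bounded W st \<longrightarrow>
     (\<exists>t' st' u. exec f W m P st t' st' \<and> t = t' + u \<and> bounded W st' \<and> Q st' u))"

lemma wp_step:
  assumes "bounded W st \<Longrightarrow> exec f W m P st 1 st' \<and> bounded W st'" "0 < t" "Q st' (t - 1)"
  shows "wp P Q st t"
  unfolding wp_def
proof
  assume "bounded W st"
  then show "\<exists>t' st' u. exec f W m P st t' st' \<and> t = t' + u \<and> bounded W st' \<and> Q st' u"
    using assms by (intro exI[of _ 1] exI[of _ st'] exI[of _ "t - 1"]) simp
qed

lemma wp_Skip: "0 < t \<Longrightarrow> Q st (t - 1) \<Longrightarrow> wp Skip Q st t"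
  by (rule wp_step[where st' = st]) (simp_all only: exec.Skip simp_thms)

lemma wp_Bin:
  assumes "binop_val b (val R x) (val R y) = Some v" "\<bar>v\<bar> < W" "0 < t"
    "Q (R(r := v), M) (t - 1)"
  shows "wp (Bin r b x y) Q (R, M) t"
  by (rule wp_step[where Q = Q, OF _ assms(3,4)]) (use assms in \<open>blast intro: exec.Bin bounded_upd\<close>)

lemma wp_Add:
  assumes "\<bar>val R x + val R y\<bar> < W" "0 < t" "Q (R(r := val R x + val R y), M) (t - 1)"
  shows "wp (Bin r Add x y) Q (R, M) t"
  using assms by (intro wp_Bin) auto

lemma wp_Sub:
  assumes "\<bar>val R x - val R y\<bar> < W" "0 < t" "Q (R(r := val R x - val R y), M) (t - 1)"
  shows "wp (Bin r Sub x y) Q (R, M) t"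
  using assms by (intro wp_Bin) auto

lemma wp_Mul:
  assumes "\<bar>val R x * val R y\<bar> < W" "0 < t" "Q (R(r := val R x * val R y), M) (t - 1)"
  shows "wp (Bin r Mul x y) Q (R, M) t"
  using assms by (intro wp_Bin) auto

lemma wp_Div:
  assumes "val R y \<noteq> 0" "\<bar>val R x div val R y\<bar> < W" "0 < t" "Q (R(r := val R x div val R y), M) (t - 1)"
  shows "wp (Bin r Div x y) Q (R, M) t"
  using assms by (intro wp_Bin) auto

lemma wp_Mod:
  assumes "val R y \<noteq> 0" "\<bar>val R x mod val R y\<bar> < W" "0 < t" "Q (R(r := val R x mod val R y), M) (t - 1)"
  shows "wp (Bin r Mod x y) Q (R, M) t"
  using assms by (intro wp_Bin) auto

lemma wp_Log:
  assumes "val R x > 0" "\<bar>\<lfloor>real_of_int (val R s) * log 2 (real_of_int (val R x))\<rfloor>\<bar> < W" "0 < t"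
    "Q (R(r := \<lfloor>real_of_int (val R s) * log 2 (real_of_int (val R x))\<rfloor>), M) (t - 1)"
  shows "wp (Log r x s) Q (R, M) t"
  by (rule wp_step[where Q = Q, OF _ assms(3,4)]) (use assms in \<open>blast intro: exec.Log bounded_upd\<close>)

lemma wp_Fun:
  assumes "val R x \<ge> 0" "val R y \<ge> 0"
    "\<bar>\<lfloor>real_of_int (val R s) * f (nat (val R x)) (nat (val R y))\<rfloor>\<bar> < W" "0 < t"
    "Q (R(r := \<lfloor>real_of_int (val R s) * f (nat (val R x)) (nat (val R y))\<rfloor>), M) (t - 1)"
  shows "wp (Fun r x y s) Q (R, M) t"
  by (rule wp_step[where Q = Q, OF _ assms(4,5)]) (use assms in \<open>blast intro: exec.Fun bounded_upd\<close>)

lemma wp_Load: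
  assumes "val R x = int a" "a < m" "0 < t" "Q (R(r := M a), M) (t - 1)"
  shows "wp (Load r x) Q (R, M) t"
proof (rule wp_step[where Q = Q, OF _ assms(3,4)])
  assume b: "bounded W (R, M)"
  then have M: "\<bar>M a\<bar> < W" by (simp add: bounded_def)
  have "exec f W m (Load r x) (R, M) 1 (R(r := M (nat (val R x))), M)"
    using assms M m_le_W by (intro exec.Load) simp_all
  then show "exec f W m (Load r x) (R, M) 1 (R(r := M a), M) \<and> bounded W (R(r := M a), M)"
    using assms M b bounded_upd by simp
qed

text \<open>A register operand is a word because the state is bounded; only an immediate one has to
  be checked.\<close>

lemma wp_Store:
  assumes "val R x = int a" "a < m" "\<bar>val R y\<bar> < W \<or> y \<in> range Reg" "0 < t"
    "Q (R, M(a := val R y)) (t - 1)"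
  shows "wp (Store x y) Q (R, M) t"
proof (rule wp_step[where Q = Q, OF _ assms(4,5)])
  assume b: "bounded W (R, M)"
  then have y: "\<bar>val R y\<bar> < W" using assms(3) by (auto simp: bounded_def)
  have "exec f W m (Store x y) (R, M) 1 (R, M(nat (val R x) := val R y))"
    using assms y m_le_W by (intro exec.Store) simp_all
  then show "exec f W m (Store x y) (R, M) 1 (R, M(a := val R y)) \<and> bounded W (R, M(a := val R y))"
    using assms y b bounded_upd by simp
qed

lemma wp_Seq:
  assumes "wp P (wp Q X) st t"
  shows "wp (Seq P Q) X st t"
  using assms unfolding wp_def by (metis (no_types, lifting) exec.Seq add.assoc)

lemma wp_If:
  assumes "0 < t"
    "val R x < val R y \<Longrightarrow> wp P X (R, M) (t - 1)"
    "\<not> val R x < val R y \<Longrightarrow> wp Q X (R, M) (t - 1)"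
  shows "wp (IfLess x y P Q) X (R, M) t"
  unfolding wp_def
proof
  assume b: "bounded W (R, M)"
  show "\<exists>t' st' u. exec f W m (IfLess x y P Q) (R, M) t' st' \<and> t = t' + u \<and> bounded W st' \<and> X st' u"
  proof (cases "val R x < val R y")
    case True
    then obtain t' st' u where "exec f W m P (R, M) t' st'" "t - 1 = t' + u" "bounded W st'" "X st' u"
      using assms(2) b unfolding wp_def by blast
    with exec.IfTrue[of R x y f W m P M t' st' Q] True assms(1) show ?thesis
      by (intro exI[of _ "t' + 1"] exI[of _ st'] exI[of _ u]) simp
  next
    case False
    then obtain t' st' u where "exec f W m Q (R, M) t' st'" "t - 1 = t' + u" "bounded W st'" "X st' u"
      using assms(3) b unfolding wp_def by blast
    with exec.IfFalse[of R x y f W m Q M t' st' P] False assms(1) show ?thesis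
      by (intro exI[of _ "t' + 1"] exI[of _ st'] exI[of _ u]) simp
  qed
qed

text \<open>Every iteration consumes a unit of time, so the remaining time is a termination measure.\<close>

lemma wp_While:
  assumes "I (R, M) t"
    and step: "\<And>R M t. I (R, M) t \<Longrightarrow> val R x < val R y \<Longrightarrow> 0 < t \<and> wp P I (R, M) (t - 1)"
    and exit: "\<And>R M t. I (R, M) t \<Longrightarrow> \<not> val R x < val R y \<Longrightarrow> 0 < t \<and> X (R, M) (t - 1)"
  shows "wp (WhileLess x y P) X (R, M) t"
  using assms(1)
proof (induction t arbitrary: R M rule: less_induct)
  case (less t)
  show ?case
    unfolding wp_def
  proof
    assume b: "bounded W (R, M)"
    show "\<exists>t' st' u. exec f W m (WhileLess x y P) (R, M) t' st' \<and> t = t' + u \<and> bounded W st' \<and> X st' u"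
    proof (cases "val R x < val R y")
      case True
      from step[OF less.prems True] have "0 < t" and w: "wp P I (R, M) (t - 1)" by auto
      then obtain t1 R1 M1 u1 where 1: "exec f W m P (R, M) t1 (R1, M1)" "t - 1 = t1 + u1"
          "bounded W (R1, M1)" "I (R1, M1) u1"
        using b unfolding wp_def by (metis surj_pair)
      have "wp (WhileLess x y P) X (R1, M1) u1"
        using 1 \<open>0 < t\<close> by (intro less.IH) auto
      then obtain t2 st2 u2 where 2: "exec f W m (WhileLess x y P) (R1, M1) t2 st2" "u1 = t2 + u2"
          "bounded W st2" "X st2 u2"
        using 1 unfolding wp_def by blast
      show ?thesis
        using exec.WhileTrue[OF True 1(1) 2(1)] 1 2 \<open>0 < t\<close>
        by (intro exI[of _ "t1 + t2 + 1"] exI[of _ st2] exI[of _ u2]) auto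
    next
      case False
      with exit[OF less.prems] b exec.WhileFalse[OF False, of f W m P M] show ?thesis
        by (intro exI[of _ 1] exI[of _ "(R, M)"] exI[of _ "t - 1"]) simp
    qed
  qed
qed

end

section \<open>Arrays in memory\<close>

definition adr :: "nat \<Rightarrow> nat \<Rightarrow> nat \<Rightarrow> nat" where
  "adr n k i = k * (2 * n) + i"

text \<open>Array \<open>k\<close> occupies the cells \<open>adr n k i\<close>.  Arrays \<open>0, \<dots>, 9\<close> have length \<open>2 * n\<close>; array \<open>10\<close>
  comes last and is as long as the memory permits.\<close>

lemma adr_eq_iff:
  assumes "k < 10 \<longrightarrow> i < 2 * n" "l < 10 \<longrightarrow> j < 2 * n" "k \<le> 10" "l \<le> 10"
  shows "adr n k i = adr n l j \<longleftrightarrow> k = l \<and> i = j"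
proof (cases k l rule: linorder_cases)
  case less
  then have "Suc k * (2 * n) \<le> l * (2 * n)" by (intro mult_le_mono) auto
  with less assms show ?thesis by (auto simp: adr_def)
next
  case greater
  then have "Suc l * (2 * n) \<le> k * (2 * n)" by (intro mult_le_mono) auto
  with greater assms show ?thesis by (auto simp: adr_def)
qed (auto simp: adr_def)

definition cell :: "nat \<Rightarrow> (nat \<Rightarrow> int) \<Rightarrow> nat \<Rightarrow> nat \<Rightarrow> int" where
  "cell n M k i = M (adr n k i)"

lemma cell_upd:
  assumes "k < 10 \<longrightarrow> i < 2 * n" "l < 10 \<longrightarrow> j < 2 * n" "k \<le> 10" "l \<le> 10"
  shows "cell n (M(adr n k i := v)) l j = (if k = l \<and> j = i then v else cell n M l j)"
  using adr_eq_iff[OF assms] by (auto simp: cell_def)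

lemma nat_int_Suc [simp]: "nat (int i + 1) = Suc i" "nat (1 + int i) = Suc i"
  by simp_all

definition ld :: "nat \<Rightarrow> nat \<Rightarrow> nat \<Rightarrow> prog" where
  "ld r k x = Bin 1 Mul (Imm (int k)) (Reg 2) ;; Bin 1 Add (Reg 1) (Reg x) ;; Load r (Reg 1)"

definition stv :: "nat \<Rightarrow> nat \<Rightarrow> operand \<Rightarrow> prog" where
  "stv k x y = Bin 1 Mul (Imm (int k)) (Reg 2) ;; Bin 1 Add (Reg 1) (Reg x) ;; Store (Reg 1) y"

context ram
begin

lemma wp_ld:
  assumes "R 2 = 2 * int n" "x \<noteq> 1" "0 \<le> R x" "adr n k (nat (R x)) < m" "3 \<le> t"
    "Q (R(1 := int (adr n k (nat (R x))), r := cell n M k (nat (R x))), M) (t - 3)"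
  shows "wp (ld r k x) Q (R, M) t"
proof -
  define i where "i = nat (R x)"
  have i: "R x = int i" using assms(3) by (simp add: i_def)
  have "adr n k i < m" using assms(4) by (simp add: i_def)
  then have "int (adr n k i) < W" using m_le_W by linarith
  moreover have "int (adr n k i) = int k * (2 * int n) + int i" by (simp add: adr_def)
  moreover have "0 \<le> int k * (2 * int n)" by simp
  ultimately show ?thesis
    unfolding ld_def using assms i
    by (intro wp_Seq wp_Mul wp_Add wp_Load[where a = "adr n k i"])
      (auto simp: numeral_3_eq_3 cell_def simp del: mult_nonneg_nonneg)
qed

text \<open>The address is computed in register \<open>1\<close> before the value is read, which
  excludes that register as a source.\<close>

lemma wp_stv:
  assumes "R 2 = 2 * int n" "x \<noteq> 1" "0 \<le> R x" "adr n k (nat (R x)) < m" "3 \<le> t"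
    "\<bar>val R y\<bar> < W \<or> y \<in> range Reg" "y \<noteq> Reg 1"
    "Q (R(1 := int (adr n k (nat (R x)))), M(adr n k (nat (R x)) := val R y)) (t - 3)"
  shows "wp (stv k x y) Q (R, M) t"
proof -
  define i where "i = nat (R x)"
  have i: "R x = int i" using assms(3) by (simp add: i_def)
  have "adr n k i < m" using assms(4) by (simp add: i_def)
  then have "int (adr n k i) < W" using m_le_W by linarith
  moreover have "int (adr n k i) = int k * (2 * int n) + int i" by (simp add: adr_def)
  moreover have "0 \<le> int k * (2 * int n)" by simp
  moreover have "val (R(1 := v)) y = val R y" for v using assms(7) by (cases y) auto
  ultimately show ?thesis
    unfolding stv_def using assms i
    by (intro wp_Seq wp_Mul wp_Add wp_Store[where a = "adr n k i"])
      (auto simp: numeral_3_eq_3 simp del: mult_nonneg_nonneg)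
qed


end

locale machine = ram +
  fixes n :: nat
  assumes n_pos: "0 < n" and mem: "20 * n \<le> m"
begin

lemma adr_less: "k < 10 \<Longrightarrow> i < 2 * n \<Longrightarrow> adr n k i < m"
proof -
  assume "k < 10" "i < 2 * n"
  then have "k * (2 * n) + i < Suc k * (2 * n)" by simp
  also have "\<dots> \<le> 10 * (2 * n)" using \<open>k < 10\<close> by (intro mult_le_mono) auto
  finally show ?thesis using mem by (simp add: adr_def)
qed

lemmas wp_basic = wp_Skip wp_Add wp_Sub wp_Mul wp_Div wp_Mod wp_Log wp_Fun
  wp_ld[where n = n] wp_stv[where n = n]

lemmas wp_intros = wp_Seq wp_If wp_basic

lemma W_ge: "20 * int n \<le> W"
  using mem m_le_W by linarith

end


section \<open>Renaming the symbols\<close>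

text \<open>
  Registers: \<open>0\<close> holds \<open>n\<close>, \<open>1\<close> addresses, \<open>2\<close> the array length \<open>2 * n\<close>, \<open>10\<close> the base \<open>n + 1\<close>, \<open>11\<close> the
  scale \<open>s\<close>, \<open>12\<close>, \<open>13\<close>, \<open>14\<close> the current threshold, its index \<open>k\<close> and \<open>2 ^ k\<close>, \<open>19\<close> the first threshold,
  \<open>20\<close> the number of thresholds; \<open>3\<close> and \<open>15\<close> are the ends of the current window, \<open>16\<close>, \<open>17\<close>, \<open>18\<close> its tally,
  number of distinct symbols and estimated cost; \<open>21\<close> and \<open>22\<close> are the best value and choice found so far.

  Arrays: \<open>0\<close> the text, finally the output; \<open>1\<close> the new names; \<open>2\<close>, \<open>3\<close> the heads and links of the buckets;
  \<open>4\<close>, \<open>5\<close> for each digit the last bucket in which it was met and its name there; \<open>6\<close> the symbol counts;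
  \<open>7\<close> the recorded bits; \<open>8\<close>, \<open>9\<close> the values and choices of the dynamic program; \<open>10\<close> the right ends of the
  windows of all thresholds.
\<close>

definition clear_prog :: prog where
  "clear_prog = Bin 3 Add (Reg 10) (Imm 0) ;;
     WhileLess (Imm 0) (Reg 3) (Bin 3 Sub (Reg 3) (Imm 1) ;; stv 2 3 (Imm 0) ;; stv 4 3 (Imm 0))"

definition build_prog :: prog where
  "build_prog = Bin 3 Add (Imm 0) (Imm 0) ;;
     WhileLess (Reg 3) (Reg 0) (ld 4 1 3 ;; ld 6 2 4 ;; stv 3 3 (Reg 6) ;;
       Bin 3 Add (Reg 3) (Imm 1) ;; stv 2 4 (Reg 3))"

definition refine_step :: prog where
  "refine_step = Bin 3 Sub (Reg 5) (Imm 1) ;; ld 6 0 3 ;; Bin 7 Mod (Reg 6) (Reg 10) ;;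
     Bin 6 Div (Reg 6) (Reg 10) ;; stv 0 3 (Reg 6) ;; ld 8 4 7 ;; Bin 9 Add (Reg 4) (Imm 1) ;;
     IfLess (Reg 8) (Reg 9) (stv 4 7 (Reg 9) ;; stv 5 7 (Reg 3)) Skip ;;
     ld 8 5 7 ;; stv 1 3 (Reg 8) ;; ld 5 3 3"

definition refine_prog :: prog where
  "refine_prog = Bin 4 Add (Imm 0) (Imm 0) ;; ld 5 2 4 ;;
     WhileLess (Reg 4) (Reg 0)
       (IfLess (Reg 5) (Imm 1) (Bin 4 Add (Reg 4) (Imm 1) ;; ld 5 2 4) refine_step)"

definition round_prog :: prog where
  "round_prog = clear_prog ;; build_prog ;; refine_prog"

text \<open>Positions are stored shifted by one, so that \<open>0\<close> can stand for ``none''.\<close>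

definition last_occ :: "(nat \<Rightarrow> nat) \<Rightarrow> nat \<Rightarrow> nat \<Rightarrow> int \<Rightarrow> bool" where
  "last_occ ids g B x \<longleftrightarrow>
     0 \<le> x \<and> x \<le> int B \<and> (0 < x \<longrightarrow> ids (nat (x - 1)) = g) \<and> (\<forall>j. x \<le> int j \<longrightarrow> j < B \<longrightarrow> ids j \<noteq> g)"

lemma last_occ_0 [simp]: "last_occ ids g 0 0"
  by (simp add: last_occ_def)

lemma last_occ_Suc:
  "last_occ ids (ids i) (Suc i) (int i + 1)"
  "ids i \<noteq> g \<Longrightarrow> last_occ ids g i x \<Longrightarrow> last_occ ids g (Suc i) x"
  by (auto simp: last_occ_def less_Suc_eq)

context machine
begin

abbreviation base :: "(nat \<Rightarrow> int) \<Rightarrow> bool" where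
  "base R \<equiv> R 0 = int n \<and> R 2 = 2 * int n \<and> R 10 = int n + 1"

text \<open>Renaming writes only to arrays below \<open>6\<close>. The later phases rely on zeros of
  the initial memory: the recorded bits in array \<open>7\<close> and the value of the empty suffix
  in array \<open>8\<close>.\<close>

definition fresh :: "(nat \<Rightarrow> int) \<Rightarrow> bool" where
  "fresh M \<longleftrightarrow> (\<forall>k i. 6 \<le> k \<longrightarrow> k \<le> 10 \<longrightarrow> (k < 10 \<longrightarrow> i < 2 * n) \<longrightarrow> cell n M k i = 0)"

definition holds :: "(nat \<Rightarrow> int) \<Rightarrow> nat \<Rightarrow> (nat \<Rightarrow> nat) \<Rightarrow> bool" where
  "holds M k a \<longleftrightarrow> (\<forall>i<n. cell n M k i = int (a i))"

lemma fresh_upd [simp]: "k < 6 \<Longrightarrow> i < 2 * n \<Longrightarrow> fresh (M(adr n k i := x)) = fresh M"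
  by (auto simp: fresh_def cell_upd)

lemma holds_upd [simp]:
  "k \<noteq> l \<Longrightarrow> k < 10 \<Longrightarrow> l < 10 \<Longrightarrow> i < 2 * n \<Longrightarrow> holds (M(adr n k i := x)) l a = holds M l a"
  by (auto simp: holds_def cell_upd)

text \<open>Digits range over \<open>0, ..., n\<close>, and \<open>refine_prog\<close> also reads
  the head of the empty bucket \<open>n\<close> before it stops; hence \<open>n + 1\<close> cells
  are cleared.\<close>

lemma wp_clear:
  assumes pre: "base R" "fresh M" "holds M 0 v" "holds M 1 ids" "T + 8 * n + 10 \<le> t"
    and post: "\<And>R M t. base R \<Longrightarrow> fresh M \<Longrightarrow> holds M 0 v \<Longrightarrow> holds M 1 ids \<Longrightarrow>
      (\<forall>i\<le>n. cell n M 2 i = 0 \<and> cell n M 4 i = 0) \<Longrightarrow> T \<le> t \<Longrightarrow> X (R, M) t"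
  shows "wp clear_prog X (R, M) t"
  unfolding clear_prog_def
proof (intro wp_intros)
  let ?I = "\<lambda>(R, M) t. \<exists>i\<le>n + 1. R 3 = int i \<and> base R \<and> fresh M \<and> holds M 0 v \<and> holds M 1 ids \<and>
      (\<forall>j. i \<le> j \<longrightarrow> j \<le> n \<longrightarrow> cell n M 2 j = 0 \<and> cell n M 4 j = 0) \<and> T + 8 * i + 1 \<le> t"
  show "wp (WhileLess (Imm 0) (Reg 3) (Bin 3 Sub (Reg 3) (Imm 1) ;; stv 2 3 (Imm 0) ;; stv 4 3 (Imm 0))) X
     (R(3 := val R (Reg 10) + val R (Imm 0)), M) (t - 1)"
  proof (rule wp_While[where I = ?I], goal_cases)
    case 1
    show ?case using pre by (auto intro!: exI[of _ "n + 1"])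
  next
    case (2 R M t)
    then obtain i0 where i0: "i0 \<le> n + 1" "R 3 = int i0" "base R" "fresh M" "holds M 0 v" "holds M 1 ids"
       "\<forall>j. i0 \<le> j \<longrightarrow> j \<le> n \<longrightarrow> cell n M 2 j = 0 \<and> cell n M 4 j = 0" "T + 8 * i0 + 1 \<le> t"
      by auto
    with 2(2) obtain i where "i0 = Suc i" by (cases i0) auto
    note i = i0[unfolded this]
    show ?case
      by (intro conjI wp_intros; use i W_ge n_pos in \<open>simp add: adr_less cell_upd\<close>)
  next
    case (3 R M t)
    then show ?case by (auto intro!: post)
  qed
qed (use pre W_ge n_pos in auto)


text \<open>Pushing the positions from left to right makes heads and links instances of one notion:
  the last member of a bucket before \<open>n\<close>, respectively before the position itself. The
  lists thus run from right to left.\<close>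

lemma wp_build:
  assumes pre: "base R" "fresh M" "holds M 0 v" "holds M 1 ids" "\<forall>i<n. ids i < n" "T + 14 * n + 2 \<le> t"
      "\<forall>i\<le>n. cell n M 2 i = 0 \<and> cell n M 4 i = 0"
    and post: "\<And>R M t. base R \<Longrightarrow> fresh M \<Longrightarrow> holds M 0 v \<Longrightarrow> holds M 1 ids \<Longrightarrow>
      \<forall>i\<le>n. cell n M 4 i = 0 \<Longrightarrow> \<forall>g\<le>n. last_occ ids g n (cell n M 2 g) \<Longrightarrow>
      \<forall>i<n. last_occ ids (ids i) i (cell n M 3 i) \<Longrightarrow> T \<le> t \<Longrightarrow> X (R, M) t"
  shows "wp build_prog X (R, M) t"
  unfolding build_prog_def
proof (intro wp_intros)
  let ?I = "\<lambda>(R, M) t. \<exists>i\<le>n. R 3 = int i \<and> base R \<and> fresh M \<and> holds M 0 v \<and> holds M 1 ids \<and>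
      (\<forall>j\<le>n. cell n M 4 j = 0) \<and> (\<forall>g\<le>n. last_occ ids g i (cell n M 2 g)) \<and>
      (\<forall>j<i. last_occ ids (ids j) j (cell n M 3 j)) \<and> T + 14 * (n - i) + 1 \<le> t"
  show "wp (WhileLess (Reg 3) (Reg 0) (ld 4 1 3 ;; ld 6 2 4 ;; stv 3 3 (Reg 6) ;;
       Bin 3 Add (Reg 3) (Imm 1) ;; stv 2 4 (Reg 3))) X
     (R(3 := val R (Imm 0) + val R (Imm 0)), M) (t - 1)"
  proof (rule wp_While[where I = ?I], goal_cases)
    case 1
    show ?case using pre by auto
  next
    case (2 R M t)
    then obtain i where i: "i < n" "R 3 = int i" "base R" "fresh M" "holds M 0 v" "holds M 1 ids"
      "\<forall>j\<le>n. cell n M 4 j = 0" "\<forall>g\<le>n. last_occ ids g i (cell n M 2 g)"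
      "\<forall>j<i. last_occ ids (ids j) j (cell n M 3 j)" "T + 14 * (n - i) + 1 \<le> t"
      by auto
    have g: "cell n M 1 i = int (ids i)" "ids i < n" "last_occ ids (ids i) i (cell n M 2 (ids i))"
      using i pre(5) by (auto simp: holds_def)
    show ?case
      by (intro conjI wp_intros; use i g W_ge n_pos in \<open>simp add: adr_less cell_upd\<close>)
        (use i g n_pos in \<open>auto intro!: exI[of _ "Suc i"] simp: cell_upd Suc_le_eq last_occ_Suc less_Suc_eq\<close>)
  next
    case (3 R M t)
    then show ?case by (auto intro!: post)
  qed
qed (use pre W_ge n_pos in auto)

text \<open>A pair of old name and digit is named by the position at which it is first met, which
  keeps names below \<open>n\<close>. The stamp in array \<open>4\<close> is the bucket number plus
  one, so it expires by itself when the next bucket is opened. Array \<open>1\<close> can be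
  overwritten on the fly because the lists already encode the old names.\<close>

lemma wp_refine:
  assumes pre: "base R" "fresh M" "holds M 0 v" "holds M 1 ids" "\<forall>i<n. ids i < n" "T + 60 * n + 5 \<le> t"
      "\<forall>i\<le>n. cell n M 4 i = 0" "\<forall>g\<le>n. last_occ ids g n (cell n M 2 g)"
      "\<forall>i<n. last_occ ids (ids i) i (cell n M 3 i)" "\<forall>i<n. int (v i) < W"
    and post: "\<And>R M t ids'. base R \<Longrightarrow> fresh M \<Longrightarrow> holds M 0 (\<lambda>i. v i div (n + 1)) \<Longrightarrow> holds M 1 ids' \<Longrightarrow>
      \<forall>i<n. ids' i < n \<Longrightarrow>
      \<forall>i<n. \<forall>j<n. ids' i = ids' j \<longleftrightarrow> ids i = ids j \<and> v i mod (n + 1) = v j mod (n + 1) \<Longrightarrow>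
      T \<le> t \<Longrightarrow> X (R, M) t"
  shows "wp refine_prog X (R, M) t"
  unfolding refine_prog_def
proof (intro wp_intros)
  define key where "key i = (ids i, v i mod (n + 1))" for i
  \<comment> \<open>The positions already handled when \<open>x\<close>, shifted by one, is the
    pending member of bucket \<open>g\<close>: lists run from right to left, so these are the ones
    at or beyond \<open>x\<close>.\<close>
  define proc where "proc g x = {i. i < n \<and> (ids i < g \<or> ids i = g \<and> x \<le> int i)}" for g and x :: int
  have proc_sub: "proc g x \<subseteq> {..<n}" for g x by (auto simp: proc_def)
  \<comment> \<open>A name is a position that carries the key it names, so distinct keys have
    distinct names automatically; that equal keys share a name is a separate clause. The last line
    is the credit: \<open>6\<close> per bucket still to be opened and \<open>40\<close> per position
    still to be handled.\<close>
  define J where "J = (\<lambda>g x M t. 0 \<le> x \<and> x \<le> int n \<and> (0 < x \<longrightarrow> g < n \<and> ids (nat (x - 1)) = g) \<and> fresh M \<and>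
      (\<forall>i<n. cell n M 0 i = int (if i \<in> proc g x then v i div (n + 1) else v i)) \<and>
      (\<forall>g\<le>n. last_occ ids g n (cell n M 2 g)) \<and>
      (\<forall>i<n. last_occ ids (ids i) i (cell n M 3 i)) \<and>
      (\<forall>i\<in>proc g x. \<exists>r<n. cell n M 1 i = int r \<and> key r = key i) \<and>
      (\<forall>i\<in>proc g x. \<forall>j\<in>proc g x. key i = key j \<longrightarrow> cell n M 1 i = cell n M 1 j) \<and>
      (\<forall>d\<le>n. cell n M 4 d \<le> int g + 1 \<and> (cell n M 4 d = int g + 1 \<longrightarrow>
          (\<exists>r<n. cell n M 5 d = int r \<and> key r = (g, d)) \<and>
          (\<exists>i\<in>proc g x. key i = (g, d) \<and> cell n M 1 i = cell n M 5 d))) \<and>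
      (\<forall>i\<in>proc g x. ids i = g \<longrightarrow> cell n M 4 (v i mod (n + 1)) = int g + 1) \<and>
      T + 6 * (n - g) + 40 * (n - card (proc g x)) + 1 \<le> (t :: nat))"
  let ?I = "\<lambda>(R, M) t. \<exists>g\<le>n. R 4 = int g \<and> base R \<and> J g (R 5) M t"
  show "wp (WhileLess (Reg 4) (Reg 0)
       (IfLess (Reg 5) (Imm 1) (Bin 4 Add (Reg 4) (Imm 1) ;; ld 5 2 4) refine_step)) X
     ((R(4 := val R (Imm 0) + val R (Imm 0)))(1 := int (adr n 2 (nat ((R(4 := val R (Imm 0) + val R (Imm 0))) 4))),
      5 := cell n M 2 (nat ((R(4 := val R (Imm 0) + val R (Imm 0))) 4))), M) (t - 1 - 3)"
  proof (rule wp_While[where I = ?I], goal_cases)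
    case 1
    have "last_occ ids 0 n (cell n M 2 0)" using pre by auto
    then have "proc 0 (cell n M 2 0) = {}" "0 \<le> cell n M 2 0" "cell n M 2 0 \<le> int n"
       "0 < cell n M 2 0 \<longrightarrow> ids (nat (cell n M 2 0 - 1)) = 0"
      by (auto simp: proc_def last_occ_def) 
    then have "J 0 (cell n M 2 0) M (t - 4)"
      using pre n_pos by (auto simp: J_def holds_def)
    then show ?case using pre by auto
  next
    case (2 R M t)
    then obtain g where g: "g < n" "R 4 = int g" "base R" and J: "J g (R 5) M t" by auto
    show ?case
    proof (intro conjI wp_If)
      show "0 < t" using J by (simp add: J_def)
      have tt: "T + 6 * (n - g) + 40 * (n - card (proc g (R 5))) + 1 \<le> t" using J by (simp add: J_def)
      then show "0 < t - 1" using g by linarith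
      assume "val R (Reg 5) < val R (Imm 1)"
      then have R5: "R 5 = 0" using J by (auto simp: J_def)
      let ?x = "cell n M 2 (Suc g)"
      have l: "last_occ ids (Suc g) n ?x" using J g by (auto simp: J_def)
      \<comment> \<open>An exhausted list means that bucket \<open>g\<close> is done, and nothing of
        the next bucket lies beyond its head.\<close>
      have d: "proc (Suc g) ?x = proc g 0"
        using l by (auto simp: proc_def last_occ_def)
      have x: "0 \<le> ?x" "?x \<le> int n" "0 < ?x \<Longrightarrow> ids (nat (?x - 1)) = Suc g"
        using l by (auto simp: last_occ_def)
      have x': "Suc g < n" if "0 < ?x"
        using x that pre(5)[rule_format, of "nat (?x - 1)"] by auto
      have "\<forall>d\<le>n. cell n M 4 d \<le> int g + 1" using J unfolding J_def by blast
      then have nz: "\<forall>d\<le>n. cell n M 4 d \<le> int (Suc g) + 1 \<and> cell n M 4 d \<noteq> int (Suc g) + 1" by force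
      have neq: "ids i \<noteq> Suc g" if "i \<in> proc g 0" for i using that by (auto simp: proc_def)
      have "J (Suc g) ?x M (t - 6)"
        unfolding J_def d
      proof (intro conjI)
        show "\<forall>e\<le>n. cell n M 4 e \<le> int (Suc g) + 1 \<and> (cell n M 4 e = int (Suc g) + 1 \<longrightarrow>
          (\<exists>r<n. cell n M 5 e = int r \<and> key r = (Suc g, e)) \<and>
          (\<exists>i\<in>proc g 0. key i = (Suc g, e) \<and> cell n M 1 i = cell n M 5 e))" using nz by blast
        show "\<forall>i\<in>proc g 0. ids i = Suc g \<longrightarrow> cell n M 4 (v i mod (n + 1)) = int (Suc g) + 1"
          using neq by blast
        show "T + 6 * (n - Suc g) + 40 * (n - card (proc g 0)) + 1 \<le> t - 6" using tt g R5 by simp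
      qed (use J[unfolded J_def R5] x x' in blast)+
      then show "wp (Bin 4 Add (Reg 4) (Imm 1) ;; ld 5 2 4) ?I (R, M) (t - 1 - 1)"
        using g tt W_ge n_pos
        by (intro wp_intros; simp add: adr_less)
          (auto intro!: exI[of _ "Suc g"] simp: ac_simps)
    next
      assume "\<not> val R (Reg 5) < val R (Imm 1)"
      moreover have "R 5 \<le> int n" "0 < R 5 \<longrightarrow> ids (nat (R 5 - 1)) = g" using J by (auto simp: J_def)
      ultimately have "R 5 = int (nat (R 5 - 1)) + 1 \<and> nat (R 5 - 1) < n \<and> ids (nat (R 5 - 1)) = g" by auto
      then obtain i where R5: "R 5 = int i + 1" and i: "i < n" "ids i = g" by blast
      define d where "d = v i mod (n + 1)"
      define x where "x = R 5"
      define y where "y = cell n M 3 i"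
      have Jx: "J g x M t" using J by (simp add: x_def)
      have j0: "\<forall>i<n. cell n M 0 i = int (if i \<in> proc g x then v i div (n + 1) else v i)"
        and j1: "\<forall>i\<in>proc g x. \<exists>r<n. cell n M 1 i = int r \<and> key r = key i"
        and j2: "\<forall>i\<in>proc g x. \<forall>j\<in>proc g x. key i = key j \<longrightarrow> cell n M 1 i = cell n M 1 j"
        and j3: "\<forall>d\<le>n. cell n M 4 d \<le> int g + 1 \<and> (cell n M 4 d = int g + 1 \<longrightarrow>
          (\<exists>r<n. cell n M 5 d = int r \<and> key r = (g, d)) \<and>
          (\<exists>i\<in>proc g x. key i = (g, d) \<and> cell n M 1 i = cell n M 5 d))"
        and j4: "\<forall>i\<in>proc g x. ids i = g \<longrightarrow> cell n M 4 (v i mod (n + 1)) = int g + 1"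
        and j5: "fresh M" "T + 6 * (n - g) + 40 * (n - card (proc g x)) + 1 \<le> t"
        and j6: "\<forall>g\<le>n. last_occ ids g n (cell n M 2 g)" "\<forall>i<n. last_occ ids (ids i) i (cell n M 3 i)"
        using Jx unfolding J_def by blast+
      have d: "d \<le> n" using less_Suc_eq_le d_def by auto
      have lo: "last_occ ids g i y" using j6(2) i by (auto simp: y_def)
      have ni: "i \<notin> proc g x" using i by (simp add: proc_def x_def R5)
      have proc: "proc g y = insert i (proc g x)"
        using lo i by (auto simp: proc_def last_occ_def x_def R5)
      have fin: "finite (proc g x)" by (rule finite_subset[OF proc_sub]) simp
      have card: "card (proc g y) = Suc (card (proc g x))" "card (proc g y) \<le> n"
        using card_mono[OF _ proc_sub[of g y]] ni fin by (auto simp: proc)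
      define r where "r = (if cell n M 4 d < int g + 1 then int i else cell n M 5 d)"
      have keyi: "key i = (g, d)" by (simp add: key_def i d_def)
      have J4: "cell n M 4 d \<le> int g + 1" using j3 d by blast
      have r1: "\<exists>r0<n. r = int r0 \<and> key r0 = (g, d)"
      proof (cases "cell n M 4 d < int g + 1")
        case True
        then show ?thesis using i keyi by (auto simp: r_def)
      next
        case False
        then have "cell n M 4 d = int g + 1" using J4 by simp
        then show ?thesis using j3 d by (simp add: r_def)
      qed
      have r2: "cell n M 1 j = r" if j: "j \<in> proc g x" "key j = (g, d)" for j
      proof -
        have s: "cell n M 4 d = int g + 1" using j4 j by (auto simp: key_def)
        then obtain i' where "i' \<in> proc g x" "key i' = (g, d)" "cell n M 1 i' = cell n M 5 d"
          using j3 d by metis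
        moreover have "cell n M 1 i' = cell n M 1 j" using j2 j calculation by metis
        ultimately show ?thesis using s by (simp add: r_def)
      qed
      have J': "J g y M' t'"
        if "fresh M'" "\<And>j. j < n \<Longrightarrow> cell n M' 0 j = (if j = i then int (v i div (n + 1)) else cell n M 0 j)"
          "\<And>j. j < n \<Longrightarrow> cell n M' 1 j = (if j = i then r else cell n M 1 j)"
          "\<And>j. j \<le> n \<Longrightarrow> cell n M' 2 j = cell n M 2 j" "\<And>j. j < n \<Longrightarrow> cell n M' 3 j = cell n M 3 j"
          "\<And>e. e \<le> n \<Longrightarrow> cell n M' 4 e = (if e = d then int g + 1 else cell n M 4 e)"
          "\<And>e. e \<le> n \<Longrightarrow> cell n M' 5 e = (if e = d then r else cell n M 5 e)" "t \<le> t' + 40" for M' t'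
      proof -
        have [simp]: "j < n" if "j \<in> proc g x" for j using that proc_sub by auto
        have y: "0 \<le> y" "y \<le> int n" "0 < y \<longrightarrow> g < n \<and> ids (nat (y - 1)) = g"
          using lo i g by (auto simp: last_occ_def)
        have A: "\<forall>i<n. cell n M' 0 i = int (if i \<in> proc g y then v i div (n + 1) else v i)"
          using j0 that(2) by (auto simp: proc)
        have B: "\<forall>j\<in>proc g y. \<exists>r<n. cell n M' 1 j = int r \<and> key r = key j"
          using j1 that(3) r1 ni i keyi by (auto simp: proc)
        have C: "\<forall>k\<in>proc g y. \<forall>j\<in>proc g y. key k = key j \<longrightarrow> cell n M' 1 k = cell n M' 1 j"
        proof (intro ballI impI)
          fix k j assume *: "k \<in> proc g y" "j \<in> proc g y" "key k = key j"
          have "k < n" "j < n" using * proc_sub by auto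
          note eqs = that(3)[OF this(1)] that(3)[OF this(2)]
          show "cell n M' 1 k = cell n M' 1 j"
          proof (cases "key k = (g, d)")
            case True
            then have "cell n M' 1 k = r" "cell n M' 1 j = r"
              using eqs * r2[of k] r2[of j] unfolding proc by auto
            then show ?thesis by simp
          next
            case False
            then have "k \<noteq> i" "j \<noteq> i" using * keyi by auto
            then have "k \<in> proc g x" "j \<in> proc g x" using * proc by auto
            then have "cell n M 1 k = cell n M 1 j" using j2 * by blast
            then show ?thesis using eqs \<open>k \<noteq> i\<close> \<open>j \<noteq> i\<close> by simp
          qed
        qed 
        have D: "\<forall>e\<le>n. cell n M' 4 e \<le> int g + 1 \<and> (cell n M' 4 e = int g + 1 \<longrightarrow>
          (\<exists>r<n. cell n M' 5 e = int r \<and> key r = (g, e)) \<and>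
          (\<exists>i\<in>proc g y. key i = (g, e) \<and> cell n M' 1 i = cell n M' 5 e))"
        proof (intro allI impI)
          fix e assume e: "e \<le> n"
          show "cell n M' 4 e \<le> int g + 1 \<and> (cell n M' 4 e = int g + 1 \<longrightarrow>
            (\<exists>r<n. cell n M' 5 e = int r \<and> key r = (g, e)) \<and>
            (\<exists>i\<in>proc g y. key i = (g, e) \<and> cell n M' 1 i = cell n M' 5 e))"
          proof (cases "e = d")
            case True
            then show ?thesis using r1 i keyi that(3)[of i] e by (auto simp: that(6,7) proc)
          next
            case False
            then have "cell n M' 4 e = cell n M 4 e" "cell n M' 5 e = cell n M 5 e"
              using e that(6,7) by auto
            moreover have "cell n M 4 e \<le> int g + 1" "cell n M 4 e = int g + 1 \<longrightarrow>
              (\<exists>r<n. cell n M 5 e = int r \<and> key r = (g, e)) \<and>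
              (\<exists>i\<in>proc g x. key i = (g, e) \<and> cell n M 1 i = cell n M 5 e)"
              using j3 e by blast+
            moreover have "cell n M' 1 j = cell n M 1 j" if "j \<in> proc g x" for j
              using \<open>\<And>j. j < n \<Longrightarrow> cell n M' 1 j = _\<close>[of j] that ni by auto
            ultimately show ?thesis unfolding proc by auto
          qed
        qed
        have E: "\<forall>j\<in>proc g y. ids j = g \<longrightarrow> cell n M' 4 (v j mod (n + 1)) = int g + 1"
        proof (intro ballI impI)
          fix j assume j: "j \<in> proc g y" "ids j = g"
          have "v j mod (n + 1) \<le> n" by (metis less_Suc_eq_le Suc_eq_plus1 mod_less_divisor zero_less_Suc)
          moreover have "cell n M 4 (v j mod (n + 1)) = int g + 1" if "j \<noteq> i"
            using j4 j that by (auto simp: proc)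
          ultimately show "cell n M' 4 (v j mod (n + 1)) = int g + 1"
            using that(6)[of "v j mod (n + 1)"] by (auto simp: d_def)
        qed
        have F: "T + 6 * (n - g) + 40 * (n - card (proc g y)) + 1 \<le> t'"
          using j5 card that(8) by linarith
        show ?thesis
          unfolding J_def
        proof (intro conjI)
          show "\<forall>g\<le>n. last_occ ids g n (cell n M' 2 g)" "\<forall>i<n. last_occ ids (ids i) i (cell n M' 3 i)"
            using j6 that(4,5) by simp_all
        qed (use y A B C D E F that(1) in blast)+
      qed
      have vi: "cell n M 0 i = int (v i)" "int (v i) < W" using j0 i ni pre(10) by auto
      have dm: "int (v i) mod (int n + 1) = int d" "int (v i) div (int n + 1) = int (v i div (n + 1))"
        by (simp_all add: d_def zmod_int zdiv_int add.commute)
      have "int (v i div Suc n) \<le> int (v i)" by (intro zle_int[THEN iffD2] div_le_dividend)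
      with vi have vb: "int (v i div Suc n) < W" by linarith
      have t: "45 \<le> t" using j5 card g by linarith
      have fr: "fresh M" using j5 by blast
      have lt: "i < 2 * n" "d < 2 * n" "int i < W" "int g + 1 < W" "int d < W" 
        using i g d W_ge n_pos by linarith+
      show "wp refine_step ?I (R, M) (t - 1 - 1)"
        unfolding refine_step_def
        \<comment> \<open>Symbolic execution splits at the stamp test: the first pass is a digit new
          to this bucket, the second a digit met before.\<close>
        apply (insert t)
        apply (rule wp_Seq | (rule wp_basic wp_If; (simp add: g i R5 vi dm vb lt adr_less cell_upd y_def[symmetric])?))+
        subgoal using J4 fr lt g(1) by (auto intro!: exI[of _ g] J' simp: g(2,3) cell_upd r_def)
        apply (rule wp_Seq | (rule wp_basic wp_If; (simp add: g i R5 vi dm vb lt adr_less cell_upd y_def[symmetric])?))+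
        subgoal using J4 fr lt g(1) by (auto intro!: exI[of _ g] J' simp: g(2,3) cell_upd r_def)
        done
    qed
  next
    case (3 R M t)
    then obtain x where J: "J n x M t" and R: "base R" by auto
    have d: "i \<in> proc n x" if "i < n" for i using that pre(5) by (auto simp: proc_def)
    define ids' where "ids' i = nat (cell n M 1 i)" for i
    have r: "\<exists>r<n. cell n M 1 i = int r \<and> key r = key i" if "i < n" for i
      using J d[OF that] unfolding J_def by blast
    have eq: "cell n M 1 i = cell n M 1 j" if "i < n" "j < n" "key i = key j" for i j
      using J d that unfolding J_def by blast
    have "holds M 1 ids'" "\<forall>i<n. ids' i < n" using r by (fastforce simp: holds_def ids'_def)+
    moreover have "ids' i = ids' j \<longleftrightarrow> key i = key j" if "i < n" "j < n" for i j
      using r[OF that(1)] r[OF that(2)] eq[OF that] by (auto simp: ids'_def)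
    moreover have "\<forall>i<n. cell n M 0 i = int (if i \<in> proc n x then v i div (n + 1) else v i)"
      "fresh M" "T + 6 * (n - n) + 40 * (n - card (proc n x)) + 1 \<le> t" using J unfolding J_def by blast+
    then have "holds M 0 (\<lambda>i. v i div (n + 1))" "fresh M" "T \<le> t - 1" "0 < t"
      using d by (auto simp: holds_def)
    ultimately show ?case using post[of R M ids' "t - 1"] R by (simp add: key_def)
  qed
qed (use pre W_ge n_pos adr_less in auto)

lemma wp_round:
  assumes pre: "base R" "fresh M" "holds M 0 v" "holds M 1 ids" "\<forall>i<n. ids i < n" "T + 100 * n \<le> t"
      "\<forall>i<n. int (v i) < W"
    and post: "\<And>R M t ids'. base R \<Longrightarrow> fresh M \<Longrightarrow> holds M 0 (\<lambda>i. v i div (n + 1)) \<Longrightarrow> holds M 1 ids' \<Longrightarrow>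
      \<forall>i<n. ids' i < n \<Longrightarrow>
      \<forall>i<n. \<forall>j<n. ids' i = ids' j \<longleftrightarrow> ids i = ids j \<and> v i mod (n + 1) = v j mod (n + 1) \<Longrightarrow>
      T \<le> t \<Longrightarrow> X (R, M) t"
  shows "wp round_prog X (R, M) t"
  unfolding round_prog_def
  \<comment> \<open>Credits are computed backwards: \<open>60 * n + 5\<close> for refining and
    \<open>14 * n + 2\<close> for building make \<open>74 * n + 7\<close>.\<close>
  apply (rule wp_Seq, rule wp_clear[OF pre(1-4), of "T + 74 * n + 7"])
  using pre(6) n_pos apply simp
  apply (rule wp_Seq, rule wp_build[where T = "T + 60 * n + 5", OF _ _ _ _ pre(5)], assumption+)
    apply simp
   apply assumption
  apply (rule wp_refine[where T = T and v = v and ids = ids], assumption+)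
        apply (rule pre(5))
       apply assumption+
   apply (rule pre(7))
  apply (rule post, assumption+)
  done

end

fun rename_prog :: "nat \<Rightarrow> prog" where
  "rename_prog 0 = Skip"
| "rename_prog (Suc k) = round_prog ;; rename_prog k"

text \<open>One round consumes the lowest digit \<open>x mod b\<close> and leaves
  \<open>x div b\<close> in place of the symbol.\<close>

lemma mod_power_Suc_eq_iff:
  fixes x y b :: nat
  assumes "0 < b"
  shows "x mod b ^ Suc k = y mod b ^ Suc k \<longleftrightarrow> x mod b = y mod b \<and> x div b mod b ^ k = y div b mod b ^ k"
proof -
  have "x mod b ^ Suc k = b * (x div b mod b ^ k) + x mod b" for x
    by (simp add: mod_mult2_eq)
  moreover have "b * p + q = b * p' + q' \<longleftrightarrow> p = p' \<and> q = q'" if "q < b" "q' < b" for p q p' q'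
  proof
    assume *: "b * p + q = b * p' + q'"
    then have "(b * p + q) div b = (b * p' + q') div b" "(b * p + q) mod b = (b * p' + q') mod b"
      by simp_all
    then show "p = p' \<and> q = q'" using that by simp
  qed simp
  ultimately show ?thesis using assms by auto
qed

context machine
begin

lemma wp_rename:
  assumes pre: "base R" "fresh M" "holds M 0 v" "holds M 1 ids" "\<forall>i<n. ids i < n" "T + k * (100 * n) + 1 \<le> t"
      "\<forall>i<n. int (v i) < W"
    and post: "\<And>R M t ids'. base R \<Longrightarrow> fresh M \<Longrightarrow> holds M 1 ids' \<Longrightarrow> \<forall>i<n. ids' i < n \<Longrightarrow>
      \<forall>i<n. \<forall>j<n. ids' i = ids' j \<longleftrightarrow> ids i = ids j \<and> v i mod (n + 1) ^ k = v j mod (n + 1) ^ k \<Longrightarrow>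
      T \<le> t \<Longrightarrow> X (R, M) t"
  shows "wp (rename_prog k) X (R, M) t"
  using pre post
proof (induction k arbitrary: R M v ids t)
  case 0
  then show ?case by (auto intro!: wp_Skip)
next
  case (Suc k)
  show ?case
    unfolding rename_prog.simps
  proof (intro wp_Seq wp_round[OF Suc.prems(1-5)])
    show "T + k * (100 * n) + 1 + 100 * n \<le> t" using Suc.prems(6) by simp
    show "\<forall>i<n. int (v i) < W" by fact
    fix R M t ids'
    assume *: "base R" "fresh M" "holds M 0 (\<lambda>i. v i div (n + 1))" "holds M 1 ids'" "\<forall>i<n. ids' i < n"
      "\<forall>i<n. \<forall>j<n. ids' i = ids' j \<longleftrightarrow> ids i = ids j \<and> v i mod (n + 1) = v j mod (n + 1)"
      "T + k * (100 * n) + 1 \<le> t"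
    have "\<forall>i<n. int (v i div (n + 1)) < W"
    proof (intro allI impI)
      fix i assume "i < n"
      have "int (v i div (n + 1)) \<le> int (v i)" by (intro zle_int[THEN iffD2] div_le_dividend)
      then show "int (v i div (n + 1)) < W" using Suc.prems(7)[rule_format, OF \<open>i < n\<close>] by linarith
    qed
    then show "wp (rename_prog k) X (R, M) t"
      using * by (intro Suc.IH[OF *(1-5)] Suc.prems(8)) (auto simp: mod_power_Suc_eq_iff simp del: power_Suc)
  qed
qed

end


section \<open>Estimated costs and sliding windows\<close>

text \<open>The count \<open>x\<close> is multiplied into the scale of the logarithm, so the
  rounding error of \<open>x * log 2 x\<close> stays below one instead of growing with
  \<open>x\<close>.\<close>

definition lg :: "nat \<Rightarrow> nat \<Rightarrow> int" where
  "lg s x = \<lfloor>real (s * x) * log 2 (real x)\<rfloor>"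

text \<open>Absent names contribute \<open>lg s 0 = 0\<close>; summing over all names turns an
  update of the window into the exchange of a single summand.\<close>

definition tally :: "nat \<Rightarrow> nat \<Rightarrow> nat list \<Rightarrow> int" where
  "tally s n w = (\<Sum>x<n. lg s (count_list w x))"

text \<open>The two terms that are added after rounding down lose less than one each, which the
  \<open>2\<close> outweighs; rounding down the subtracted tally only raises the result. Hence it
  exceeds the scaled cost.\<close>

definition est :: "(nat \<Rightarrow> nat \<Rightarrow> real) \<Rightarrow> nat \<Rightarrow> nat \<Rightarrow> nat list \<Rightarrow> int" where
  "est f s n w = lg s (length w) - tally s n w + \<lfloor>real s * f (length w) (card (set w))\<rfloor> + 2"

definition win :: "'a list \<Rightarrow> nat \<Rightarrow> nat \<Rightarrow> 'a list" where
  "win U i r = take (r - i) (drop i U)"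

lemma length_win: "r \<le> length U \<Longrightarrow> length (win U i r) = r - i"
  by (simp add: win_def)

lemma win_Cons: "i < r \<Longrightarrow> r \<le> length U \<Longrightarrow> win U i r = U ! i # win U (Suc i) r"
  by (simp add: win_def Cons_nth_drop_Suc[symmetric] Suc_diff_Suc[symmetric])

lemma win_snoc: "i \<le> r \<Longrightarrow> r < length U \<Longrightarrow> win U i (Suc r) = win U i r @ [U ! r]"
  by (simp add: win_def Suc_diff_le take_Suc_conv_app_nth)

lemma win_empty [simp]: "win U i i = []"
  by (simp add: win_def)

lemma set_win: "set (win U i r) \<subseteq> set U"
  unfolding win_def by (meson order_trans set_drop_subset set_take_subset)

lemma sublist_win: "sublist (win U i r) U"
  unfolding win_def by (meson sublist_drop sublist_order.order_trans sublist_take)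

lemma sublist_win_win:
  assumes "i \<le> i'" "r' \<le> r"
  shows "sublist (win U i' r') (win U i r)"
proof -
  have "win U i' r' = take (r' - i') (drop (i' - i) (win U i r))"
    using assms by (simp add: win_def drop_take min_def)
  then show ?thesis by (metis sublist_drop sublist_order.order_trans sublist_take)
qed

lemma lg_nonneg: "0 \<le> lg s x"
  by (cases "x = 0") (simp_all add: lg_def)

lemma lg_0 [simp]: "lg s 0 = 0"
  by (simp add: lg_def)

lemma lg_le: "x \<le> n \<Longrightarrow> lg s x \<le> int (s * n * n)"
proof (cases "x = 0")
  case False
  assume "x \<le> n"
  have "log 2 (real x) \<le> real x"
    using False log2_of_power_le[of x x] less_exp[of x] by simp
  then have "real (s * x) * log 2 (real x) \<le> real (s * x) * real x"
    by (intro mult_left_mono) auto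
  also have "\<dots> \<le> real (s * n * n)"
    using \<open>x \<le> n\<close> by (simp only: of_nat_mult[symmetric] of_nat_le_iff) (intro mult_le_mono; simp)
  finally show ?thesis unfolding lg_def by linarith
qed simp

lemma tally_upd:
  assumes "x < n" "\<And>y. count_list w' y = count_list w y + (if y = x then 1 else 0)"
  shows "tally s n w' = tally s n w - lg s (count_list w x) + lg s (Suc (count_list w x))"
proof -
  have "tally s n w = lg s (count_list w x) + (\<Sum>y\<in>{..<n} - {x}. lg s (count_list w y))"
    unfolding tally_def using assms(1) by (intro sum.remove) auto
  moreover have "tally s n w' = lg s (count_list w' x) + (\<Sum>y\<in>{..<n} - {x}. lg s (count_list w' y))"
    unfolding tally_def using assms(1) by (intro sum.remove) auto
  moreover have "(\<Sum>y\<in>{..<n} - {x}. lg s (count_list w' y)) = (\<Sum>y\<in>{..<n} - {x}. lg s (count_list w y))"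
    using assms(2) by (intro sum.cong) auto
  ultimately show ?thesis using assms(2)[of x] by simp
qed

lemma tally_Cons:
  "x < n \<Longrightarrow> tally s n (x # w) = tally s n w - lg s (count_list w x) + lg s (Suc (count_list w x))"
  by (rule tally_upd) auto

lemma tally_snoc:
  "x < n \<Longrightarrow> tally s n (w @ [x]) = tally s n w - lg s (count_list w x) + lg s (Suc (count_list w x))"
  by (rule tally_upd) auto

lemma tally_nonneg: "0 \<le> tally s n w"
  unfolding tally_def by (intro sum_nonneg lg_nonneg)

lemma lg_count_le_tally: "x < n \<Longrightarrow> lg s (count_list w x) \<le> tally s n w"
  unfolding tally_def by (intro member_le_sum) (auto intro: lg_nonneg)

lemma tally_le:
  assumes "length w \<le> n"
  shows "tally s n w \<le> int (n * (s * n * n))"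
proof -
  have "tally s n w \<le> (\<Sum>x<n. int (s * n * n))"
    unfolding tally_def by (intro sum_mono lg_le order_trans[OF count_le_length assms])
  then show ?thesis by simp
qed

lemma tally_eq: "set w \<subseteq> {..<n} \<Longrightarrow> tally s n w = (\<Sum>x\<in>set w. lg s (count_list w x))"
  unfolding tally_def by (intro sum.mono_neutral_right) (auto simp: count_list_0_iff)

lemma card_set_upd:
  assumes "set w' = insert x (set w)"
  shows "card (set w') = card (set w) + (if count_list w x = 0 then 1 else 0)"
  using assms by (simp add: count_list_0_iff card_insert_if)

text \<open>Split the logarithm of the quotient and use that the counts add up to the length. In
  this form the entropy can be maintained while symbols come and go.\<close>

lemma length_H0:
  "real (length w) * H0 w = real (length w) * log 2 (real (length w)) -
     (\<Sum>c\<in>set w. real (count_list w c) * log 2 (real (count_list w c)))"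
proof (cases "w = []")
  case False
  have pos: "0 < count_list w c" if "c \<in> set w" for c
    using that by (metis count_list_0_iff neq0_conv)
  have "real (length w) * H0 w = (\<Sum>c\<in>set w. real (count_list w c) * log 2 (real (length w) / real (count_list w c)))"
    using False by (simp add: H0_def)
  also have "\<dots> = (\<Sum>c\<in>set w. real (count_list w c) * log 2 (real (length w)) - real (count_list w c) * log 2 (real (count_list w c)))"
    using False pos by (intro sum.cong) (auto simp: log_divide right_diff_distrib)
  also have "\<dots> = (\<Sum>c\<in>set w. real (count_list w c)) * log 2 (real (length w)) -
      (\<Sum>c\<in>set w. real (count_list w c) * log 2 (real (count_list w c)))"
    by (simp add: sum_subtractf sum_distrib_right)
  also have "(\<Sum>c\<in>set w. real (count_list w c)) = real (length w)"
    using sum_count_set[of w "set w"] by (simp flip: of_nat_sum)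
  finally show ?thesis .
qed (simp add: H0_def)

text \<open>At most \<open>n\<close> distinct symbols occur and each loses at most one in the tally;
  this is the \<open>n\<close> of the upper bound, and the constant of \<open>est\<close> is the
  \<open>2\<close>.\<close>

lemma est_bounds:
  assumes "set w \<subseteq> {..<n}"
  shows "real s * cost_nonadaptive f w < real_of_int (est f s n w)"
    "real_of_int (est f s n w) \<le> real s * cost_nonadaptive f w + real n + 2"
proof -
  let ?g = "\<lambda>x. real (s * x) * log 2 (real x)"
  let ?F = "real s * f (length w) (card (set w))"
  have lg: "real_of_int (lg s x) \<le> ?g x" "?g x - 1 < real_of_int (lg s x)" for x
    unfolding lg_def by linarith+
  have cost: "real s * cost_nonadaptive f w = ?g (length w) - (\<Sum>c\<in>set w. ?g (count_list w c)) + ?F"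
    unfolding cost_nonadaptive_def length_H0 by (simp add: algebra_simps sum_distrib_left)
  have t: "real_of_int (tally s n w) = (\<Sum>c\<in>set w. real_of_int (lg s (count_list w c)))"
    by (simp add: tally_eq[OF assms])
  have 1: "real_of_int (tally s n w) \<le> (\<Sum>c\<in>set w. ?g (count_list w c))"
    unfolding t by (intro sum_mono lg)
  have "(\<Sum>c\<in>set w. ?g (count_list w c) - 1) \<le> real_of_int (tally s n w)"
    unfolding t by (intro sum_mono less_imp_le[OF lg(2)])
  moreover have "card (set w) \<le> n" using card_mono[OF _ assms] by simp
  ultimately have 2: "(\<Sum>c\<in>set w. ?g (count_list w c)) - real n \<le> real_of_int (tally s n w)"
    by (simp add: sum_subtractf)
  have F: "real_of_int \<lfloor>?F\<rfloor> \<le> ?F" "?F - 1 < real_of_int \<lfloor>?F\<rfloor>" by linarith+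
  have e: "real_of_int (est f s n w) = real_of_int (lg s (length w)) - real_of_int (tally s n w) + real_of_int \<lfloor>?F\<rfloor> + 2"
    by (simp add: est_def)
  show "real s * cost_nonadaptive f w < real_of_int (est f s n w)"
    using cost e 1 F lg[of "length w"] by linarith
  show "real_of_int (est f s n w) \<le> real s * cost_nonadaptive f w + real n + 2"
    using cost e 2 F lg[of "length w"] by linarith
qed

lemma count_list_map_inj:
  "inj_on \<phi> A \<Longrightarrow> set w \<subseteq> A \<Longrightarrow> x \<in> A \<Longrightarrow> count_list (map \<phi> w) (\<phi> x) = count_list w x"
  by (induction w) (auto simp: inj_on_def)

text \<open>The cost depends only on the multiplicities, the length and the number of distinct
  symbols.\<close>

lemma cost_map_inj:
  assumes "inj_on \<phi> (set w)"
  shows "cost_nonadaptive f (map \<phi> w) = cost_nonadaptive f w"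
proof -
  have "(\<Sum>c\<in>\<phi> ` set w. real (count_list (map \<phi> w) c) * log 2 (real (count_list (map \<phi> w) c))) =
      (\<Sum>c\<in>set w. real (count_list w c) * log 2 (real (count_list w c)))"
    by (subst sum.reindex[OF assms]) (auto simp: count_list_map_inj[OF assms])
  then show ?thesis
    using card_image[OF assms] length_H0[of "map \<phi> w"] length_H0[of w] by (simp add: cost_nonadaptive_def)
qed

text \<open>\<open>slide E \<theta> n j\<close> is the right end of the window starting at \<open>n - j\<close>: when the left end
  moves down, the right end is lowered just until the cost \<open>E\<close> of the window is at most \<open>\<theta>\<close>.\<close>

primrec slide :: "(nat \<Rightarrow> nat \<Rightarrow> int) \<Rightarrow> int \<Rightarrow> nat \<Rightarrow> nat \<Rightarrow> nat" where
  "slide E \<theta> n 0 = n"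
| "slide E \<theta> n (Suc j) = (GREATEST r. r \<le> slide E \<theta> n j \<and> E (n - Suc j) r \<le> \<theta>)"

section \<open>Thresholds, their windows, and the encoding of the runs by bits\<close>

locale levels =
  fixes E :: "nat \<Rightarrow> nat \<Rightarrow> int" and n :: nat and \<theta> p q :: int
  assumes single: "i < n \<Longrightarrow> E i (Suc i) \<le> \<theta>"
    and \<theta>_pos: "0 < \<theta>" and q_pos: "0 < q" and q_less_p: "q < p"
begin

text \<open>The \<open>+ 1\<close> compensates the rounding of \<open>div\<close>, so that a step
  multiplies by at least \<open>p / q\<close> and exceeds this by at most one.\<close>

primrec th :: "nat \<Rightarrow> int" where
  "th 0 = \<theta>"
| "th (Suc k) = th k * p div q + 1"

definition rk :: "nat \<Rightarrow> nat \<Rightarrow> nat" where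
  "rk k i = slide E (th k) n (n - i)"

lemma th_Suc_bounds:
  "real_of_int (th k) * (p / q) < real_of_int (th (Suc k))"
  "real_of_int (th (Suc k)) \<le> real_of_int (th k) * (p / q) + 1"
proof -
  have "real_of_int (th k) * (p / q) = real_of_int (th k * p) / real_of_int q" by simp
  moreover have "th k * p div q = \<lfloor>real_of_int (th k * p) / real_of_int q\<rfloor>"
    by (rule floor_divide_of_int_eq[symmetric])
  ultimately show "real_of_int (th k) * (p / q) < real_of_int (th (Suc k))"
    "real_of_int (th (Suc k)) \<le> real_of_int (th k) * (p / q) + 1"
    unfolding th.simps by linarith+
qed

lemma ratio: "1 < real_of_int p / real_of_int q"
  using q_pos q_less_p by simp

lemma th_ge_power: "real_of_int \<theta> * (p / q) ^ k \<le> real_of_int (th k)"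
proof (induction k)
  case (Suc k)
  have "real_of_int \<theta> * (p / q) ^ Suc k = (real_of_int \<theta> * (p / q) ^ k) * (p / q)" by simp
  also have "\<dots> \<le> real_of_int (th k) * (p / q)"
    using Suc ratio by (intro mult_right_mono) auto
  finally show ?case using th_Suc_bounds(1)[of k] by linarith
qed simp

lemma th_ge: "\<theta> \<le> th k"
proof -
  have "real_of_int \<theta> * 1 \<le> real_of_int \<theta> * (p / q) ^ k"
    using ratio \<theta>_pos by (intro mult_left_mono one_le_power) auto
  then show ?thesis using th_ge_power[of k] by linarith
qed

lemma th_pos: "0 < th k"
  using th_ge[of k] \<theta>_pos by linarith

lemma rk_n [simp]: "rk k n = n"
  by (simp add: rk_def)

lemma rk_rec: "i < n \<Longrightarrow> rk k i = (GREATEST r. r \<le> rk k (Suc i) \<and> E i r \<le> th k)"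
  by (simp add: rk_def Suc_diff_Suc[symmetric])

text \<open>Induction from the right: the next right end is at least \<open>Suc i\<close>, so by
  \<open>single\<close> the value \<open>Suc i\<close> is admissible and the \<open>GREATEST\<close>
  is well defined.\<close>

lemma rk_props:
  assumes "i < n"
  shows "i < rk k i \<and> rk k i \<le> rk k (Suc i) \<and> E i (rk k i) \<le> th k \<and>
    (\<forall>r. rk k i < r \<longrightarrow> r \<le> rk k (Suc i) \<longrightarrow> th k < E i r)"
  using less_imp_le[OF assms] assms
proof (induction rule: inc_induct)
  case (step i)
  let ?P = "\<lambda>r. r \<le> rk k (Suc i) \<and> E i r \<le> th k"
  have "Suc i \<le> rk k (Suc i)" using step by (cases "Suc i = n") auto
  then have P: "?P (Suc i)" using single[OF step.hyps(2)] th_ge[of k] by simp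
  note G = GreatestI_nat[of ?P, OF P, of "rk k (Suc i)"] Greatest_le_nat[of ?P _ "rk k (Suc i)"]
  note G' = G[folded rk_rec[OF step.hyps(2)]]
  show ?case
    using G'(1) G'(2)[OF P] G'(2) by (auto simp: Suc_le_eq) (meson linorder_not_le)
qed simp

lemma rk_gt: "i < n \<Longrightarrow> i < rk k i"
  and rk_le_Suc: "i < n \<Longrightarrow> rk k i \<le> rk k (Suc i)"
  and E_rk_le: "i < n \<Longrightarrow> E i (rk k i) \<le> th k"
  and E_gt: "i < n \<Longrightarrow> rk k i < r \<Longrightarrow> r \<le> rk k (Suc i) \<Longrightarrow> th k < E i r"
  using rk_props by blast+

lemma rk_mono: "i \<le> j \<Longrightarrow> j \<le> n \<Longrightarrow> rk k i \<le> rk k j"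
proof (induction rule: inc_induct)
  case (step i)
  then show ?case using rk_le_Suc[of i k] by simp
qed simp

lemma rk_le: "i \<le> n \<Longrightarrow> rk k i \<le> n"
  using rk_mono[of i n k] by simp

text \<open>The right end is lowered only past ends that are not affordable, so it cannot pass
  \<open>r\<close> as long as every suffix of the window ending at \<open>r\<close> is affordable.
  No monotonicity of \<open>E\<close> enters.\<close>

lemma rk_cover:
  assumes "i < r" "r \<le> n" "\<And>i'. i \<le> i' \<Longrightarrow> i' < r \<Longrightarrow> E i' r \<le> th k"
  shows "r \<le> rk k i"
proof -
  have "i \<le> r" using assms by simp
  then show ?thesis using assms(3)
  proof (induction rule: inc_induct)
    case base
    then show ?case using rk_gt[of r k] assms(2) by (cases "r = n") auto
  next
    case (step i)
    then have "r \<le> rk k (Suc i)" by simp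
    moreover have "E i r \<le> th k" using step by simp
    ultimately show ?case using E_gt[of i k r] step assms(2) by (meson leD le_less_linear less_le_trans)
  qed
qed

definition adv :: "nat \<Rightarrow> nat \<Rightarrow> bool" where
  "adv k x \<longleftrightarrow> (\<exists>i r. i < n \<and> i + r = x \<and> rk k i < r \<and> r \<le> rk k (Suc i))"

text \<open>Right ends increase with left ends, so the sums visited for different left ends form
  disjoint intervals and the witness in \<open>adv\<close> can only be \<open>i\<close>
  itself.\<close>

lemma adv_iff:
  assumes "i < n" "rk k i \<le> r" "r \<le> rk k (Suc i)"
  shows "adv k (i + r) \<longleftrightarrow> rk k i < r"
proof
  assume "adv k (i + r)"
  then obtain i' r' where *: "i' < n" "i' + r' = i + r" "rk k i' < r'" "r' \<le> rk k (Suc i')"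
    by (auto simp: adv_def)
  show "rk k i < r"
  proof (cases i i' rule: linorder_cases)
    case less
    then have "rk k (Suc i) \<le> rk k i'" using * by (intro rk_mono) auto
    then show ?thesis using * assms less by linarith
  next
    case greater
    then have "rk k (Suc i') \<le> rk k i" using assms(1) by (intro rk_mono) auto
    then show ?thesis using * assms greater by linarith
  qed (use * in auto)
qed (use assms in \<open>auto simp: adv_def\<close>)

lemma not_adv: "x \<le> rk k 0 \<Longrightarrow> \<not> adv k x"
proof
  assume "x \<le> rk k 0" "adv k x"
  then obtain i r where *: "i < n" "i + r = x" "rk k i < r" by (auto simp: adv_def)
  have "rk k 0 \<le> rk k i" using * by (intro rk_mono) auto
  then show False using * \<open>x \<le> rk k 0\<close> by linarith
qed

primrec word :: "nat \<Rightarrow> nat \<Rightarrow> int" where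
  "word 0 x = 0"
| "word (Suc k) x = word k x + (if adv k x then 2 ^ k else 0)"

lemma word_bounds: "0 \<le> word k x \<and> word k x < 2 ^ k"
  by (induction k) auto

lemma word_split: "k \<le> l \<Longrightarrow> \<exists>z. word l x = word k x + 2 ^ k * z"
proof (induction rule: dec_induct)
  case base
  show ?case by (rule exI[of _ 0]) simp
next
  case (step l)
  then obtain z where z: "word l x = word k x + 2 ^ k * z" by blast
  have "(2::int) ^ l = 2 ^ k * 2 ^ (l - k)" using step by (simp flip: power_add)
  then have "word (Suc l) x = word k x + 2 ^ k * (z + (if adv l x then 2 ^ (l - k) else 0))"
    by (simp add: z distrib_left)
  then show ?case ..
qed

lemma word_bit: "k < l \<Longrightarrow> word l x div 2 ^ k mod 2 = (if adv k x then 1 else 0)"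
proof -
  assume "k < l"
  then obtain z where "word l x = word (Suc k) x + 2 ^ Suc k * z"
    using word_split[of "Suc k" l x] by auto
  then have "word l x = word k x + 2 ^ k * ((if adv k x then 1 else 0) + 2 * z)"
    by (simp add: distrib_left)
  moreover have "(word k x + 2 ^ k * y) div 2 ^ k = y" for y
    using word_bounds[of k x] by simp
  ultimately show ?thesis by simp
qed

end


section \<open>Recording the windows\<close>

definition lg_prog :: prog where
  "lg_prog = Bin 7 Mul (Reg 11) (Reg 9) ;; Log 7 (Reg 9) (Reg 7)"

text \<open>\<open>Log\<close> is undefined at \<open>0\<close>, so a zero count is treated
  separately; the same test reveals a change in the number of distinct symbols. The same holds for
  removal.\<close>

definition add_prog :: "nat \<Rightarrow> prog" where
  "add_prog x = ld 8 1 x ;; ld 9 6 8 ;;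
     IfLess (Reg 9) (Imm 1) (Bin 17 Add (Reg 17) (Imm 1)) (lg_prog ;; Bin 16 Sub (Reg 16) (Reg 7)) ;;
     Bin 9 Add (Reg 9) (Imm 1) ;; stv 6 8 (Reg 9) ;; lg_prog ;; Bin 16 Add (Reg 16) (Reg 7)"

definition rem_prog :: "nat \<Rightarrow> prog" where
  "rem_prog x = ld 8 1 x ;; ld 9 6 8 ;; lg_prog ;; Bin 16 Sub (Reg 16) (Reg 7) ;;
     Bin 9 Sub (Reg 9) (Imm 1) ;; stv 6 8 (Reg 9) ;;
     IfLess (Reg 9) (Imm 1) (Bin 17 Sub (Reg 17) (Imm 1)) (lg_prog ;; Bin 16 Add (Reg 16) (Reg 7))"

definition est_prog :: prog where
  "est_prog = Bin 9 Sub (Reg 15) (Reg 3) ;; lg_prog ;; Bin 18 Sub (Reg 7) (Reg 16) ;;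
     Fun 7 (Reg 9) (Reg 17) (Reg 11) ;; Bin 18 Add (Reg 18) (Reg 7) ;; Bin 18 Add (Reg 18) (Imm 2)"

definition drop_prog :: prog where
  "drop_prog = Bin 5 Add (Reg 3) (Reg 15) ;; ld 4 7 5 ;; Bin 4 Add (Reg 4) (Reg 14) ;; stv 7 5 (Reg 4) ;;
     Bin 15 Sub (Reg 15) (Imm 1) ;; rem_prog 15 ;; est_prog"

text \<open>The final store sets the right end of this level to \<open>n\<close>, the starting point
  for the replay. It belongs here because the number of levels is discovered only as they are
  run.\<close>

definition level_prog :: prog where
  "level_prog = Bin 3 Add (Reg 0) (Imm 0) ;;
     WhileLess (Imm 0) (Reg 3) (Bin 3 Sub (Reg 3) (Imm 1) ;; stv 6 3 (Imm 0)) ;;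
     Bin 16 Add (Imm 0) (Imm 0) ;; Bin 17 Add (Imm 0) (Imm 0) ;;
     Bin 15 Add (Reg 0) (Imm 0) ;; Bin 3 Add (Reg 0) (Imm 0) ;;
     WhileLess (Imm 0) (Reg 3) (Bin 3 Sub (Reg 3) (Imm 1) ;; add_prog 3 ;; est_prog ;;
       WhileLess (Reg 12) (Reg 18) drop_prog) ;;
     stv 10 13 (Reg 0)"

definition next_prog :: "int \<Rightarrow> int \<Rightarrow> prog" where
  "next_prog p q = Bin 13 Add (Reg 13) (Imm 1) ;; Bin 14 Mul (Reg 14) (Imm 2) ;;
     Bin 12 Mul (Reg 12) (Imm p) ;; Bin 12 Div (Reg 12) (Imm q) ;; Bin 12 Add (Reg 12) (Imm 1)"

text \<open>\<open>Z\<close> bounds every single rounded term. A tally has at most \<open>n\<close>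
  of them, and \<open>Z_W\<close> leaves room for the few terms combined with it. Values of the
  dynamic program are at most \<open>n * \<theta>\<close>, the charge for cutting into single
  symbols, to which one threshold is added; this is the second part of \<open>th_W\<close>.
  \<open>rk_last\<close> and \<open>rk_before\<close> identify \<open>L\<close> as the number of
  levels after which the program stops.\<close>

locale windows = machine f W m n + levels "\<lambda>i r. est f s n (win U i r)" n \<theta> p q
  for f W m n s U \<theta> p q +
  fixes Z :: int and L :: nat
  assumes len_U: "length U = n" and set_U: "set U \<subseteq> {..<n}"
    and s_pos: "0 < s"
    and Z_lg: "int (s * n * n) \<le> Z"
    and Z_f: "i < r \<Longrightarrow> r \<le> n \<Longrightarrow> \<bar>\<lfloor>real s * f (r - i) (card (set (win U i r)))\<rfloor>\<bar> \<le> Z"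
    and Z_W: "(int n + 3) * Z + 3 < W"
    and L_pos: "0 < L"
    and rk_last: "rk (L - 1) 0 = n"
    and rk_before: "Suc k < L \<Longrightarrow> rk k 0 \<noteq> n"
    and th_W: "k \<le> L \<Longrightarrow> th k * p + 1 < W" "k \<le> L \<Longrightarrow> int n * \<theta> + th k + 1 < W"
    and pow_W: "2 ^ (L + 1) < W"
    and mem_L: "20 * n + L \<le> m"
begin

abbreviation E :: "nat \<Rightarrow> nat \<Rightarrow> int" where
  "E i r \<equiv> est f s n (win U i r)"

lemma W_1: "1 < W"
  using W_ge n_pos by linarith

lemma U_less: "i < n \<Longrightarrow> U ! i < n"
  using set_U len_U nth_mem by fastforce

lemma sn_bounds: "0 < x \<Longrightarrow> x \<le> n \<Longrightarrow> \<bar>int s * int x\<bar> < W" "x \<le> n \<Longrightarrow> 0 \<le> lg s x \<and> lg s x \<le> Z"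
proof -
  have Z0: "0 \<le> Z" using order_trans[OF of_nat_0_le_iff Z_lg] by simp
  then have nZ: "0 \<le> int n * Z" by simp
  show "0 \<le> lg s x \<and> lg s x \<le> Z" if "x \<le> n"
    using lg_le[OF that, of s] lg_nonneg[of s x] Z_lg by linarith
  assume x: "0 < x" "x \<le> n"
  have "s * x * 1 \<le> s * n * n" using x n_pos by (intro mult_le_mono) auto
  then have "int s * int x \<le> Z" using Z_lg by (metis mult.right_neutral of_nat_le_iff of_nat_mult order_trans)
  moreover have "0 \<le> int s * int x" by simp
  ultimately show "\<bar>int s * int x\<bar> < W" using Z_W[unfolded distrib_right] Z0 nZ by linarith
qed

lemma tally_le_Z: "length w \<le> n \<Longrightarrow> 0 \<le> tally s n w \<and> tally s n w \<le> int n * Z"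
proof -
  assume "length w \<le> n"
  then have "tally s n w \<le> int n * int (s * n * n)" using tally_le[of w n s] by (simp add: of_nat_mult)
  also have "\<dots> \<le> int n * Z" using Z_lg by (intro mult_left_mono) auto
  finally show ?thesis using tally_nonneg by blast
qed

lemma Z_nonneg: "0 \<le> Z" "0 \<le> int n * Z" "int n * Z + 3 * Z + 3 < W"
proof -
  show "0 \<le> Z" using order_trans[OF of_nat_0_le_iff Z_lg] by simp
  then show "0 \<le> int n * Z" by simp
  show "int n * Z + 3 * Z + 3 < W" using Z_W by (simp add: distrib_right)
qed

lemma wp_lg:
  assumes "R 11 = int s" "0 < R 9" "R 9 \<le> int n" "2 \<le> t" "X (R(7 := lg s (nat (R 9))), M) (t - 2)"
  shows "wp lg_prog X (R, M) t"
proof -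
  obtain c where c: "R 9 = int c" "0 < c" "c \<le> n"
    using assms(2,3) by (metis nat_0_le of_nat_0_less_iff of_nat_le_iff less_imp_le)
  have "\<lfloor>real_of_int (int s * int c) * log 2 (real_of_int (int c))\<rfloor> = lg s c"
    by (simp add: lg_def)
  moreover have "\<bar>lg s c\<bar> < W" using sn_bounds(2)[OF c(3)] Z_nonneg by linarith
  ultimately show ?thesis
    unfolding lg_prog_def using assms sn_bounds(1)[OF c(2,3)] c
    by (intro wp_Seq wp_Mul wp_Log) (auto simp: numeral_2_eq_2)
qed

definition wstate :: "(nat \<Rightarrow> int) \<Rightarrow> (nat \<Rightarrow> int) \<Rightarrow> nat list \<Rightarrow> bool" where
  "wstate R M w \<longleftrightarrow> R 16 = tally s n w \<and> R 17 = int (card (set w)) \<and>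
     (\<forall>x<n. cell n M 6 x = int (count_list w x))"

lemma wp_add:
  assumes pre: "R 2 = 2 * int n" "R 11 = int s" "R y = int i" "y \<notin> {1, 7, 8, 9, 16, 17}" "i < n"
      "holds M 1 (\<lambda>i. U ! i)" "wstate R M w" "length w < n" "set w \<subseteq> {..<n}" "T + 18 \<le> t"
    and post: "\<And>R' c t. (\<And>x. x \<notin> {1, 7, 8, 9, 16, 17} \<Longrightarrow> R' x = R x) \<Longrightarrow>
      wstate R' (M(adr n 6 (U ! i) := c)) (U ! i # w) \<Longrightarrow> T \<le> t \<Longrightarrow> X (R', M(adr n 6 (U ! i) := c)) t"
  shows "wp (add_prog y) X (R, M) t"
proof -
  let ?c = "count_list w (U ! i)"
  have u: "cell n M (Suc 0) i = int (U ! i)" "cell n M 6 (U ! i) = int ?c" "U ! i < n" "U ! i < 2 * n" "i < 2 * n"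
    using pre U_less[OF pre(5)] by (auto simp: holds_def wstate_def)
  have r: "R 16 = tally s n w" "R 17 = int (card (set w))" using pre by (auto simp: wstate_def)
  have c: "?c < n" using count_le_length[of w "U ! i"] pre by linarith
  have W: "int (card (set w)) + 1 < W" "int ?c + 1 < W" "int ?c + 1 \<le> int n" "0 < n"
    using card_length[of w] pre c W_ge n_pos by linarith+
  have tl: "lg s ?c \<le> tally s n w" "0 \<le> lg s ?c" "tally s n w \<le> int n * Z"
    using lg_count_le_tally[OF u(3)] lg_nonneg tally_le_Z[of w] pre by auto
  have l: "0 \<le> lg s (Suc ?c)" "lg s (Suc ?c) \<le> Z" using sn_bounds(2)[of "Suc ?c"] c by auto
  have W2: "\<bar>tally s n w - lg s ?c\<bar> < W" "\<bar>tally s n w - lg s ?c + lg s (Suc ?c)\<bar> < W"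
     "\<bar>tally s n w + lg s (Suc ?c)\<bar> < W"
    using tl l Z_nonneg by linarith+
  have W3: "\<bar>tally s n w + lg s (Suc 0)\<bar> < W" if "?c = 0"
    using tl sn_bounds(2)[of "Suc 0"] n_pos Z_nonneg by auto
  have y: "y \<noteq> Suc 0" "y \<noteq> 1" "y \<noteq> 7" "y \<noteq> 8" "y \<noteq> 9" "y \<noteq> 16" "y \<noteq> 17" using pre(4) by auto
  have tw: "tally s n (U ! i # w) = tally s n w - lg s ?c + lg s (Suc ?c)"
    by (rule tally_Cons[OF u(3)])
  have "set (U ! i # w) = insert (U ! i) (set w)" by simp
  note cd = card_set_upd[OF this]
  have t: "18 \<le> t" using pre(10) by simp
  show ?thesis
    unfolding add_prog_def
    apply (insert t)
    apply (rule wp_Seq | (rule wp_basic wp_lg wp_If; (simp add: pre(1-3) u r y W W_1 W2 W3 c c[THEN less_imp_le] Suc_le_eq adr_less)?))+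
     subgoal
      apply (rule post)
      using c cd pre(7,10) tw u by (auto simp: wstate_def cell_upd)
    apply (rule wp_Seq | (rule wp_basic wp_lg wp_If; (simp add: pre(1-3) u r y W W_1 W2 W3 c c[THEN less_imp_le] Suc_le_eq adr_less)?))+
    subgoal
      apply (rule post)
      using c cd pre(7,10) tw u by (auto simp: wstate_def cell_upd)
    done
qed

lemma wp_rem:
  assumes pre: "R 2 = 2 * int n" "R 11 = int s" "R y = int i" "y \<notin> {1, 7, 8, 9, 16, 17}" "i < n"
      "holds M 1 (\<lambda>i. U ! i)" "wstate R M (w @ [U ! i])" "length w < n" "set w \<subseteq> {..<n}" "T + 18 \<le> t"
    and post: "\<And>R' c t. (\<And>x. x \<notin> {1, 7, 8, 9, 16, 17} \<Longrightarrow> R' x = R x) \<Longrightarrow>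
      wstate R' (M(adr n 6 (U ! i) := c)) w \<Longrightarrow> T \<le> t \<Longrightarrow> X (R', M(adr n 6 (U ! i) := c)) t"
  shows "wp (rem_prog y) X (R, M) t"
proof -
  let ?c = "count_list w (U ! i)"
  have "set (w @ [U ! i]) = insert (U ! i) (set w)" by simp
  note cd = card_set_upd[OF this]
  have tw: "tally s n (w @ [U ! i]) = tally s n w - lg s ?c + lg s (Suc ?c)"
    using tally_snoc U_less pre(5) by blast
  have u: "cell n M (Suc 0) i = int (U ! i)" "cell n M 6 (U ! i) = int ?c + 1" "U ! i < n" "U ! i < 2 * n" "i < 2 * n"
    using pre U_less[OF pre(5)] by (auto simp: holds_def wstate_def)
  have r: "R 16 = tally s n w - lg s ?c + lg s (Suc ?c)" "R 17 = int (card (set w)) + (if ?c = 0 then 1 else 0)"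
    using pre(7) unfolding wstate_def tw cd by auto
  have c: "?c < n" using count_le_length[of w "U ! i"] pre by linarith
  have W: "int (card (set w)) < W" "int ?c < W" "int ?c + 1 \<le> int n" "0 < n"
    using card_length[of w] pre c W_ge n_pos by linarith+
  have tl: "lg s ?c \<le> tally s n w" "0 \<le> lg s ?c" "tally s n w \<le> int n * Z"
    using lg_count_le_tally[OF u(3)] lg_nonneg tally_le_Z[of w] pre by auto
  have l: "0 \<le> lg s (Suc ?c)" "lg s (Suc ?c) \<le> Z" using sn_bounds(2)[of "Suc ?c"] c by auto
  have W2: "\<bar>tally s n w - lg s ?c\<bar> < W" "\<bar>tally s n w\<bar> < W"
    using tl l Z_nonneg by linarith+
  have y: "y \<noteq> Suc 0" "y \<noteq> 1" "y \<noteq> 7" "y \<noteq> 8" "y \<noteq> 9" "y \<noteq> 16" "y \<noteq> 17" using pre(4) by auto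
  have t: "18 \<le> t" using pre(10) by simp
  have cnt: "cell n M 6 x = int (count_list w x) + (if x = U ! i then 1 else 0)" if "x < n" for x
    using pre(7) that by (auto simp: wstate_def)
  show ?thesis
    unfolding rem_prog_def
    apply (insert t)
    apply (rule wp_Seq | (rule wp_basic wp_lg wp_If; (simp add: pre(1-3) u r y W W_1 W2 c c[THEN less_imp_le] Suc_le_eq adr_less)?))+
     subgoal
      apply (rule post)
      using c pre(10) u cnt r by (auto simp: wstate_def cell_upd)
    apply (rule wp_Seq | (rule wp_basic wp_lg wp_If; (simp add: pre(1-3) u r y W W_1 W2 c c[THEN less_imp_le] Suc_le_eq adr_less)?))+
    subgoal
      apply (rule post)
      using c pre(10) u cnt r by (auto simp: wstate_def cell_upd)
    done
qed

lemma wp_est: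
  assumes pre: "R 11 = int s" "R 3 = int i" "R 15 = int r" "i < r" "r \<le> n" "wstate R M (win U i r)" "T + 7 \<le> t"
    and post: "\<And>R' t. (\<And>x. x \<notin> {7, 9, 18} \<Longrightarrow> R' x = R x) \<Longrightarrow> R' 18 = E i r \<Longrightarrow> T \<le> t \<Longrightarrow> X (R', M) t"
  shows "wp est_prog X (R, M) t"
proof -
  let ?w = "win U i r"
  have len: "length ?w = r - i" using pre len_U by (simp add: length_win)
  have r: "R 16 = tally s n ?w" "R 17 = int (card (set ?w))" using pre by (auto simp: wstate_def)
  have d: "int r - int i = int (r - i)" using pre by simp
  have tl: "0 \<le> tally s n ?w" "tally s n ?w \<le> int n * Z" using tally_le_Z[of ?w] len pre by auto
  have l: "0 \<le> lg s (r - i)" "lg s (r - i) \<le> Z" using sn_bounds(2)[of "r - i"] pre by auto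
  define F where "F = \<lfloor>real s * f (r - i) (card (set ?w))\<rfloor>"
  have F: "\<bar>F\<bar> \<le> Z" using Z_f[OF pre(4,5)] by (simp add: F_def)
  have E: "E i r = lg s (r - i) - tally s n ?w + F + 2" by (simp add: est_def len F_def)
  have W2: "\<bar>lg s (r - i) - tally s n ?w\<bar> < W" "\<bar>F\<bar> < W" "\<bar>lg s (r - i) - tally s n ?w + F\<bar> < W"
     "\<bar>lg s (r - i) - tally s n ?w + F + 2\<bar> < W" "int (r - i) < W" "int (r - i) \<le> int n" "r - i \<le> n"
    using tl l F Z_nonneg W_ge n_pos pre by linarith+
  have t: "7 \<le> t" using pre(7) by simp
  show ?thesis
    unfolding est_prog_def
    apply (insert t)
    apply (rule wp_Seq | (rule wp_basic wp_lg; (simp add: pre(1-4) r d W2 F_def[symmetric] del: of_nat_diff)?))+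
    apply (rule post)
    using pre(7) E by auto
qed

lemma wp_drop:
  assumes pre: "R 2 = 2 * int n" "R 11 = int s" "R 3 = int i" "R 15 = int (Suc r)" "R 14 = 2 ^ k" "k < L"
      "i < r" "r < n" "wstate R M (win U i (Suc r))" "holds M 1 (\<lambda>i. U ! i)"
      "cell n M 7 (i + Suc r) = word k (i + Suc r)" "T + 34 \<le> t"
    and post: "\<And>R' M' t. (\<And>x. x \<notin> {1, 4, 5, 7, 8, 9, 15, 16, 17, 18} \<Longrightarrow> R' x = R x) \<Longrightarrow>
      R' 15 = int r \<Longrightarrow> R' 18 = E i r \<Longrightarrow> wstate R' M' (win U i r) \<Longrightarrow>
      (\<And>l j. l \<noteq> 6 \<Longrightarrow> l \<le> 10 \<Longrightarrow> l < 10 \<longrightarrow> j < 2 * n \<Longrightarrow>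
        cell n M' l j = (if l = 7 \<and> j = i + Suc r then word k j + 2 ^ k else cell n M l j)) \<Longrightarrow>
      T \<le> t \<Longrightarrow> X (R', M') t"
  shows "wp drop_prog X (R, M) t"
proof -
  have w: "win U i (Suc r) = win U i r @ [U ! r]" using pre len_U by (intro win_snoc) auto
  have b: "int i + (1 + int r) < W" "int i + int r + 1 < W" "i + Suc r < 2 * n" "int r < W"
    using pre W_ge by linarith+
  have p2: "0 \<le> word k (i + Suc r)" "word k (i + Suc r) < 2 ^ k" using word_bounds[of k "i + Suc r"] by auto
  have "(2::int) ^ Suc k \<le> 2 ^ (L + 1)" using pre(6) by (intro power_increasing) auto
  then have "(2::int) ^ k * 2 \<le> 2 ^ (L + 1)" by simp
  then have pw: "\<bar>word k (i + Suc r) + 2 ^ k\<bar> < W" using p2 pow_W by linarith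
  have na: "nat (int i + (1 + int r)) = i + Suc r" "nat (int i + int r + 1) = i + Suc r" by linarith+
  have len: "length (win U i r) < n" using pre len_U by (simp add: length_win)
  have sub: "set (win U i r) \<subseteq> {..<n}" by (rule order_trans[OF set_win set_U])
  have t: "34 \<le> t" using pre(12) by simp
  let ?M = "M(adr n 7 (i + Suc r) := word k (i + Suc r) + 2 ^ k)"
  define t1 where "t1 = t - 9"
  have t1: "T + 25 \<le> t1" using pre(12) by (simp add: t1_def)
  have main: "wp (rem_prog 15) (wp est_prog X) (R1, ?M) t1"
    if R1: "\<And>x. x \<notin> {1, 4, 5, 15} \<Longrightarrow> R1 x = R x" "R1 15 = int r" for R1
  proof (rule wp_rem[where T = "T + 7" and i = r and w = "win U i r"])
    show "holds ?M 1 (\<lambda>i. U ! i)" using pre b by simp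
    show "wstate R1 ?M (win U i r @ [U ! r])"
      using pre(9) R1(1) b unfolding w wstate_def by (auto simp: cell_upd)
    fix R2 c t2
    assume R2: "\<And>x. x \<notin> {1, 7, 8, 9, 16, 17} \<Longrightarrow> R2 x = R1 x"
      "wstate R2 (?M(adr n 6 (U ! r) := c)) (win U i r)" "T + 7 \<le> t2"
    show "wp est_prog X (R2, ?M(adr n 6 (U ! r) := c)) t2"
    proof (rule wp_est[where T = T and i = i and r = r])
      fix R3 t3
      assume R3: "\<And>x. x \<notin> {7, 9, 18} \<Longrightarrow> R3 x = R2 x" "R3 18 = E i r" "T \<le> t3"
      have "wstate R3 (?M(adr n 6 (U ! r) := c)) (win U i r)" using R2(2) R3(1) by (simp add: wstate_def)
      moreover have "cell n (?M(adr n 6 (U ! r) := c)) l j =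
          (if l = 7 \<and> j = i + Suc r then word k j + 2 ^ k else cell n M l j)"
        if "l \<noteq> 6" "l \<le> 10" "l < 10 \<longrightarrow> j < 2 * n" for l j
        using that b U_less[OF pre(8)] by (auto simp: cell_upd)
      ultimately show "X (R3, ?M(adr n 6 (U ! r) := c)) t3"
        using R3 R2(1) R1 by (intro post) auto
    qed (use R2 R1 pre in auto)
  qed (use R1 pre len sub t1 in auto)
  show ?thesis
    unfolding drop_prog_def
    apply (insert t)
    apply (rule wp_Seq, (rule wp_basic; (simp add: pre(1-5,11)[simplified] b b[simplified] na pw pw[simplified] adr_less)?))+
    apply (rule wp_Seq, rule main[unfolded t1_def, simplified])
     apply simp_all
    done
qed

definition consts_ok :: "(nat \<Rightarrow> int) \<Rightarrow> nat \<Rightarrow> bool" where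
  "consts_ok R k \<longleftrightarrow> R 0 = int n \<and> R 2 = 2 * int n \<and> R 11 = int s \<and> R 12 = th k \<and> R 13 = int k \<and>
     R 14 = 2 ^ k \<and> R 19 = \<theta>"

definition mem_ok :: "(nat \<Rightarrow> int) \<Rightarrow> nat \<Rightarrow> bool" where
  "mem_ok M k \<longleftrightarrow> holds M 1 (\<lambda>i. U ! i) \<and> (\<forall>j<k. cell n M 10 j = int n) \<and> cell n M 8 n = 0"

lemma wp_level_body:
  assumes pre: "consts_ok R k" "mem_ok M k" "k < L" "R 3 = int (Suc i)" "R 15 = int (rk k (Suc i))" "i < n"
      "wstate R M (win U (Suc i) (rk k (Suc i)))"
      "\<forall>x<2 * n. cell n M 7 x = (if x < Suc i + rk k (Suc i) then word k x else word (Suc k) x)"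
      "T + 40 * rk k (Suc i) + 30 \<le> t"
    and post: "\<And>R M t. consts_ok R k \<Longrightarrow> mem_ok M k \<Longrightarrow> R 3 = int i \<Longrightarrow> R 15 = int (rk k i) \<Longrightarrow>
      wstate R M (win U i (rk k i)) \<Longrightarrow>
      \<forall>x<2 * n. cell n M 7 x = (if x < i + rk k i then word k x else word (Suc k) x) \<Longrightarrow>
      T + 40 * rk k i \<le> t \<Longrightarrow> X (R, M) t"
  shows "wp (Bin 3 Sub (Reg 3) (Imm 1) ;; add_prog 3 ;; est_prog ;; WhileLess (Reg 12) (Reg 18) drop_prog) X (R, M) t"
proof (intro wp_Seq wp_Sub)
  let ?r = "rk k (Suc i)"
  have r: "i < rk k i" "rk k i \<le> ?r" "?r \<le> n" "i < ?r"
    using rk_gt[OF pre(6), of k] rk_le_Suc[OF pre(6), of k] rk_le[of "Suc i" k] pre(6) by linarith+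
  have w: "win U i ?r = U ! i # win U (Suc i) ?r" using r len_U by (intro win_Cons) auto
  show "\<bar>val R (Reg 3) - val R (Imm 1)\<bar> < W" using pre(4,6) W_ge n_pos by simp
  show "0 < t" using pre(9) by simp
  show "wp (add_prog 3) (wp (est_prog ;; WhileLess (Reg 12) (Reg 18) drop_prog) X)
     (R(3 := val R (Reg 3) - val R (Imm 1)), M) (t - 1)"
  proof (rule wp_add[where i = i and T = "T + 40 * ?r + 11" and w = "win U (Suc i) ?r"])
    show "length (win U (Suc i) ?r) < n" using r len_U by (simp add: length_win)
    show "set (win U (Suc i) ?r) \<subseteq> {..<n}" by (rule order_trans[OF set_win set_U])
    fix R1 c t1
    assume R1: "\<And>x. x \<notin> {1, 7, 8, 9, 16, 17} \<Longrightarrow> R1 x = (R(3 := val R (Reg 3) - val R (Imm 1))) x"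
      and w1: "wstate R1 (M(adr n 6 (U ! i) := c)) (U ! i # win U (Suc i) ?r)" and t1: "T + 40 * ?r + 11 \<le> t1"
    define M1 where "M1 = M(adr n 6 (U ! i) := c)"
    have M1: "cell n M1 l j = cell n M l j" if "l \<noteq> 6" "l \<le> 10" "l < 10 \<longrightarrow> j < 2 * n" for l j
      using that U_less[OF pre(6)] by (auto simp: M1_def cell_upd)
    show "wp (est_prog ;; WhileLess (Reg 12) (Reg 18) drop_prog) X (R1, M(adr n 6 (U ! i) := c)) t1"
      unfolding M1_def[symmetric]
    proof (rule wp_Seq, rule wp_est[where i = i and r = ?r and T = "T + 40 * ?r + 4"])
      show "wstate R1 M1 (win U i ?r)" using w1 by (simp add: w M1_def)
      fix R2 t2
      assume R2: "\<And>x. x \<notin> {7, 9, 18} \<Longrightarrow> R2 x = R1 x" "R2 18 = E i ?r" "T + 40 * ?r + 4 \<le> t2"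
      \<comment> \<open>Inside the loop the bit of the sum \<open>i + r\<close> is still undecided,
        so the cells up to and including it hold the old word. On exit it is decided to be
        \<open>0\<close>, which turns \<open>\<le>\<close> into \<open><\<close>.\<close>
      let ?I = "\<lambda>(R, M) t. \<exists>r. rk k i \<le> r \<and> r \<le> ?r \<and> consts_ok R k \<and> mem_ok M k \<and> R 3 = int i \<and> R 15 = int r \<and>
        wstate R M (win U i r) \<and> R 18 = E i r \<and>
        (\<forall>x<2 * n. cell n M 7 x = (if x \<le> i + r then word k x else word (Suc k) x)) \<and> T + 40 * r + 3 \<le> t"
      show "wp (WhileLess (Reg 12) (Reg 18) drop_prog) X (R2, M1) t2"
      proof (rule wp_While[where I = ?I], goal_cases)
        case 1
        have "consts_ok R2 k" using pre(1) R1 R2(1) by (simp add: consts_ok_def)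
        moreover have "mem_ok M1 k" using pre(2,3) M1 n_pos by (auto simp: mem_ok_def holds_def)
        moreover have "wstate R2 M1 (win U i ?r)" using w1 R2(1) by (simp add: wstate_def w M1_def)
        moreover have "\<forall>x<2 * n. cell n M1 7 x = (if x \<le> i + ?r then word k x else word (Suc k) x)"
          using pre(8) M1 by simp
        moreover have "R2 3 = int i" "R2 15 = int ?r" using R1 R2(1) pre(4,5) by simp_all
        ultimately show ?case using R2(2,3) r by auto
      next
        case (2 R M t)
        then obtain r0 where r0: "rk k i \<le> r0" "r0 \<le> ?r" "consts_ok R k" "mem_ok M k" "R 3 = int i" "R 15 = int r0"
            "wstate R M (win U i r0)" "R 18 = E i r0" "T + 40 * r0 + 3 \<le> t"
            and words: "\<forall>x<2 * n. cell n M 7 x = (if x \<le> i + r0 then word k x else word (Suc k) x)"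
          by auto
        have "th k < E i r0" using 2(2) r0 by (simp add: consts_ok_def)
        then have lt: "rk k i < r0" using E_rk_le[OF pre(6), of k] r0(1) by (cases "rk k i = r0") auto
        obtain r' where r': "r0 = Suc r'" using lt by (cases r0) auto
        have adv: "adv k (i + r0)" using adv_iff[OF pre(6) r0(1,2)] lt by simp
        have b: "i + r0 < 2 * n" "i < r'" "r' < n" using r0 r r' lt pre(6) by auto
        show ?case
        proof
          show "0 < t" using r0 by simp
          show "wp drop_prog ?I (R, M) (t - 1)"
          proof (rule wp_drop[where i = i and r = r' and k = k and T = "T + 40 * r' + 5"])
            show "cell n M 7 (i + Suc r') = word k (i + Suc r')" using words b r' by simp
            show "holds M 1 (\<lambda>i. U ! i)" using r0 by (simp add: mem_ok_def)
            fix R' M' t'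
            assume R': "\<And>x. x \<notin> {1, 4, 5, 7, 8, 9, 15, 16, 17, 18} \<Longrightarrow> R' x = R x" "R' 15 = int r'" "R' 18 = E i r'"
              "wstate R' M' (win U i r')" "T + 40 * r' + 5 \<le> t'"
              and M': "\<And>l j. l \<noteq> 6 \<Longrightarrow> l \<le> 10 \<Longrightarrow> l < 10 \<longrightarrow> j < 2 * n \<Longrightarrow>
                cell n M' l j = (if l = 7 \<and> j = i + Suc r' then word k j + 2 ^ k else cell n M l j)"
            have "consts_ok R' k" using r0(3) R'(1) by (simp add: consts_ok_def)
            moreover have "mem_ok M' k" using r0(4) M' n_pos by (auto simp: mem_ok_def holds_def)
            moreover have "R' 3 = int i" using r0 R'(1) by simp
            moreover have "\<forall>x<2 * n. cell n M' 7 x = (if x \<le> i + r' then word k x else word (Suc k) x)"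
              using M' words adv b r' by auto
            ultimately show "?I (R', M') t'" using R' lt r0 r' by auto
          qed (use r0 r' b pre(3) in \<open>auto simp: consts_ok_def\<close>)
        qed
      next
        case (3 R M t)
        then obtain r0 where r0: "rk k i \<le> r0" "r0 \<le> ?r" "consts_ok R k" "mem_ok M k" "R 3 = int i" "R 15 = int r0"
            "wstate R M (win U i r0)" "R 18 = E i r0" "T + 40 * r0 + 3 \<le> t"
            and words: "\<forall>x<2 * n. cell n M 7 x = (if x \<le> i + r0 then word k x else word (Suc k) x)"
          by auto
        have "E i r0 \<le> th k" using 3(2) r0 by (simp add: consts_ok_def)
        then have eq: "r0 = rk k i" using E_gt[OF pre(6), of k r0] r0(1,2) by force
        have "\<not> adv k (i + rk k i)" using adv_iff[OF pre(6) _ r0(2)[unfolded eq]] by simp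
        then have "\<forall>x<2 * n. cell n M 7 x = (if x < i + rk k i then word k x else word (Suc k) x)"
          using words eq by auto
        then show ?case using r0 by (auto simp: eq intro!: post)
      qed
    qed (use R1 pre r t1 in \<open>auto simp: consts_ok_def\<close>)
  qed (use pre w in \<open>auto simp: consts_ok_def mem_ok_def wstate_def\<close>)
qed

lemma mem_L_less: "k < L \<Longrightarrow> adr n 10 k < m"
  using mem_L by (simp add: adr_def)

lemma wp_level:
  assumes pre: "consts_ok R k" "mem_ok M k" "k < L" "\<forall>x<2 * n. cell n M 7 x = word k x" "T + 90 * n \<le> t"
    and post: "\<And>R M t. consts_ok R k \<Longrightarrow> mem_ok M (Suc k) \<Longrightarrow> R 15 = int (rk k 0) \<Longrightarrow>
      \<forall>x<2 * n. cell n M 7 x = word (Suc k) x \<Longrightarrow> T \<le> t \<Longrightarrow> X (R, M) t"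
  shows "wp level_prog X (R, M) t"
proof -
  let ?loop = "WhileLess (Imm 0) (Reg 3) (Bin 3 Sub (Reg 3) (Imm 1) ;; add_prog 3 ;; est_prog ;;
       WhileLess (Reg 12) (Reg 18) drop_prog) ;; stv 10 13 (Reg 0)"
  have loop: "wp ?loop X (R, M) t"
    if "consts_ok R k" "mem_ok M k" "R 3 = int n" "R 15 = int n" "wstate R M []"
      "\<forall>x<2 * n. cell n M 7 x = word k x" "T + 75 * n + 4 \<le> t" for R M t
  proof (rule wp_Seq)
    \<comment> \<open>\<open>35\<close> pays for a move of the left end and \<open>40\<close> for a
      move of the right end; both start at \<open>n\<close>.\<close>
    let ?I = "\<lambda>(R, M) t. \<exists>i\<le>n. consts_ok R k \<and> mem_ok M k \<and> R 3 = int i \<and> R 15 = int (rk k i) \<and>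
      wstate R M (win U i (rk k i)) \<and>
      (\<forall>x<2 * n. cell n M 7 x = (if x < i + rk k i then word k x else word (Suc k) x)) \<and>
      T + 35 * i + 40 * rk k i + 4 \<le> t"
    show "wp (WhileLess (Imm 0) (Reg 3) (Bin 3 Sub (Reg 3) (Imm 1) ;; add_prog 3 ;; est_prog ;;
       WhileLess (Reg 12) (Reg 18) drop_prog)) (wp (stv 10 13 (Reg 0)) X) (R, M) t"
    proof (rule wp_While[where I = ?I], goal_cases)
      case 1
      then show ?case using that by auto
    next
      case (2 R M t)
      then obtain i0 where i0: "i0 \<le> n" "consts_ok R k" "mem_ok M k" "R 3 = int i0" "R 15 = int (rk k i0)"
        "wstate R M (win U i0 (rk k i0))"
        "\<forall>x<2 * n. cell n M 7 x = (if x < i0 + rk k i0 then word k x else word (Suc k) x)"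
        "T + 35 * i0 + 40 * rk k i0 + 4 \<le> t" by auto
      then obtain i where i: "i0 = Suc i" using 2(2) by (cases i0) auto
      have "0 < t" using i0 by simp
      moreover have "wp (Bin 3 Sub (Reg 3) (Imm 1) ;; add_prog 3 ;; est_prog ;; WhileLess (Reg 12) (Reg 18) drop_prog)
          ?I (R, M) (t - 1)"
        by (rule wp_level_body[where i = i and k = k and T = "T + 35 * i + 4"])
          (use i0 i pre(3) in \<open>auto simp del: word.simps intro!: exI[of _ i]\<close>)
      ultimately show ?case ..
    next
      case (3 R M t)
      then have r: "consts_ok R k" "mem_ok M k" "R 15 = int (rk k 0)" "T + 4 \<le> t"
        "\<forall>x<2 * n. cell n M 7 x = (if x < rk k 0 then word k x else word (Suc k) x)" by auto
      \<comment> \<open>The right end is never lowered at a sum up to \<open>rk k 0\<close>, so the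
        cells left untouched there are correct with bit \<open>0\<close>.\<close>
      have w: "\<forall>x<2 * n. cell n M 7 x = word (Suc k) x" using r(5) not_adv[of _ k] by auto
      have "wp (stv 10 13 (Reg 0)) X (R, M) (t - 1)"
      proof (rule wp_stv[where n = n])
        show "X (R(1 := int (adr n 10 (nat (R 13)))), M(adr n 10 (nat (R 13)) := val R (Reg 0))) (t - 1 - 3)"
        proof (rule post)
          show "mem_ok (M(adr n 10 (nat (R 13)) := val R (Reg 0))) (Suc k)"
            using r(1,2) n_pos by (auto simp: mem_ok_def consts_ok_def holds_def cell_upd less_Suc_eq)
        qed (use r w in \<open>auto simp: consts_ok_def cell_upd simp del: word.simps\<close>)
      qed (use r mem_L_less[OF pre(3)] in \<open>auto simp: consts_ok_def\<close>)
      then show ?case using r by simp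
    qed
  qed
  show ?thesis
    unfolding level_prog_def
  proof (intro wp_Seq wp_Add)
    let ?I = "\<lambda>(R, M) t. \<exists>i\<le>n. consts_ok R k \<and> mem_ok M k \<and> R 3 = int i \<and>
      (\<forall>x<2 * n. cell n M 7 x = word k x) \<and> (\<forall>j. i \<le> j \<longrightarrow> j < n \<longrightarrow> cell n M 6 j = 0) \<and>
      T + 75 * n + 8 + 5 * i + 1 \<le> t"
    show "wp (WhileLess (Imm 0) (Reg 3) (Bin 3 Sub (Reg 3) (Imm 1) ;; stv 6 3 (Imm 0)))
       (wp (Bin 16 Add (Imm 0) (Imm 0) ;; Bin 17 Add (Imm 0) (Imm 0) ;;
         Bin 15 Add (Reg 0) (Imm 0) ;; Bin 3 Add (Reg 0) (Imm 0) ;; ?loop) X)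
       (R(3 := val R (Reg 0) + val R (Imm 0)), M) (t - 1)"
    proof (rule wp_While[where I = ?I], goal_cases)
      case 1
      show ?case using pre n_pos by (auto simp: consts_ok_def)
    next
      case (2 R M t)
      then obtain i0 where i0: "i0 \<le> n" "consts_ok R k" "mem_ok M k" "R 3 = int i0"
        "\<forall>x<2 * n. cell n M 7 x = word k x" "\<forall>j. i0 \<le> j \<longrightarrow> j < n \<longrightarrow> cell n M 6 j = 0"
        "T + 75 * n + 8 + 5 * i0 + 1 \<le> t" by auto
      then obtain i where i: "i0 = Suc i" using 2(2) by (cases i0) auto
      have b: "i < 2 * n" "int i < W" "R 2 = 2 * int n" "R 3 = int i + 1"
        using i0 i W_ge n_pos by (auto simp: consts_ok_def)
      have t: "14 \<le> t" using i0 i by simp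
      have c: "consts_ok (R(3 := x, Suc 0 := y)) k" for x y using i0 by (simp add: consts_ok_def)
      have mo: "mem_ok (M(adr n 6 i := 0)) k" using i0 b n_pos by (auto simp: mem_ok_def holds_def cell_upd)
      show ?case
        apply (rule conjI)
        subgoal using t by simp
        apply (insert t)
        apply (rule wp_Seq | (rule wp_basic; (simp add: b W_1[THEN less_trans[OF zero_less_one]] adr_less)?))+
        subgoal using i0 i c mo b by (auto intro!: exI[of _ i] simp: cell_upd Suc_le_eq)
        done
    next
      case (3 R M t)
      then have r: "consts_ok R k" "mem_ok M k" "\<forall>x<2 * n. cell n M 7 x = word k x" "\<forall>j<n. cell n M 6 j = 0"
        "T + 75 * n + 9 \<le> t" by auto
      have t: "9 \<le> t" and R0: "R 0 = int n" and nW: "int n < W"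
        using r W_ge n_pos by (auto simp: consts_ok_def)
      show ?case
        apply (rule conjI)
        subgoal using t by simp
        apply (insert t)
        apply ((rule wp_Seq, rule wp_Add; simp add: R0 nW W_1[THEN less_trans[OF zero_less_one]])+)
        apply (rule loop)
        using r by (auto simp: consts_ok_def wstate_def tally_def)
    qed
  qed (use pre W_ge n_pos in \<open>auto simp: consts_ok_def\<close>)
qed

end


section \<open>Dynamic program\<close>

text \<open>Register \<open>15\<close> starts at \<open>0\<close> to force the first level; after a
  level it is the right end of the window at position \<open>0\<close>, so the guard asks whether
  the whole text is affordable yet.\<close>

definition levels_prog :: "int \<Rightarrow> int \<Rightarrow> prog" where
  "levels_prog p q = Bin 13 Add (Imm 0) (Imm 0) ;; Bin 14 Add (Imm 1) (Imm 0) ;;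
     Bin 12 Add (Reg 19) (Imm 0) ;; Bin 15 Add (Imm 0) (Imm 0) ;;
     WhileLess (Reg 15) (Reg 0) (level_prog ;; next_prog p q)"

definition advance_prog :: prog where
  "advance_prog = Bin 15 Sub (Reg 15) (Imm 1) ;; Bin 5 Sub (Reg 5) (Imm 1) ;; ld 4 7 5 ;;
     Bin 4 Div (Reg 4) (Reg 14) ;; Bin 4 Mod (Reg 4) (Imm 2)"

definition choose_prog :: "int \<Rightarrow> int \<Rightarrow> prog" where
  "choose_prog p q = ld 15 10 13 ;; Bin 5 Add (Reg 3) (Reg 15) ;; ld 4 7 5 ;;
     Bin 4 Div (Reg 4) (Reg 14) ;; Bin 4 Mod (Reg 4) (Imm 2) ;;
     WhileLess (Imm 0) (Reg 4) advance_prog ;;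
     stv 10 13 (Reg 15) ;; ld 6 8 15 ;; Bin 6 Add (Reg 6) (Reg 12) ;;
     IfLess (Reg 6) (Reg 21) (Bin 21 Add (Reg 6) (Imm 0) ;; Bin 22 Add (Reg 15) (Imm 0)) Skip ;;
     next_prog p q"

text \<open>The search starts from a single symbol charged the first threshold. So a choice always
  exists and values grow by at most \<open>\<theta>\<close> per position.\<close>

definition dp_body :: "int \<Rightarrow> int \<Rightarrow> prog" where
  "dp_body p q = ld 21 8 3 ;; Bin 21 Add (Reg 21) (Reg 19) ;; Bin 22 Add (Reg 3) (Imm 0) ;;
     Bin 3 Sub (Reg 3) (Imm 1) ;; Bin 13 Add (Imm 0) (Imm 0) ;; Bin 14 Add (Imm 1) (Imm 0) ;;
     Bin 12 Add (Reg 19) (Imm 0) ;;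
     WhileLess (Reg 13) (Reg 20) (choose_prog p q) ;;
     stv 8 3 (Reg 21) ;; stv 9 3 (Reg 22)"

definition dp_prog :: "int \<Rightarrow> int \<Rightarrow> prog" where
  "dp_prog p q = Bin 20 Add (Reg 13) (Imm 0) ;; Bin 3 Add (Reg 0) (Imm 0) ;;
     WhileLess (Imm 0) (Reg 3) (dp_body p q)"

definition output_prog :: prog where
  "output_prog = Bin 3 Add (Imm 0) (Imm 0) ;; Bin 13 Add (Imm 0) (Imm 0) ;;
     WhileLess (Reg 3) (Reg 0) (ld 15 9 3 ;; Bin 5 Sub (Reg 15) (Reg 3) ;; stv 0 13 (Reg 5) ;;
       Bin 13 Add (Reg 13) (Imm 1) ;; Bin 3 Add (Reg 15) (Imm 0)) ;;
     Bin 0 Add (Reg 13) (Imm 0)"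

lemma length_le_concat: "[] \<notin> set Ps \<Longrightarrow> length Ps \<le> length (concat Ps)"
proof (induction Ps)
  case (Cons P Ps)
  then show ?case by (cases P) auto
qed simp

lemma take_win: "i \<le> r \<Longrightarrow> take i T @ win T i r = take r T"
  using take_add[of i "r - i" T] by (simp add: win_def)

context windows
begin

lemma p_pos: "1 < p"
  using q_pos q_less_p by linarith

lemma wp_next:
  assumes pre: "consts_ok R k" "k < L" "T + 5 \<le> t"
    and post: "\<And>R' t. consts_ok R' (Suc k) \<Longrightarrow> (\<And>x. x \<notin> {12, 13, 14} \<Longrightarrow> R' x = R x) \<Longrightarrow> T \<le> t \<Longrightarrow> X (R', M) t"
  shows "wp (next_prog p q) X (R, M) t"
proof -
  have r: "R 13 = int k" "R 14 = 2 ^ k" "R 12 = th k" using pre by (auto simp: consts_ok_def)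
  have "int L < W" using mem_L m_le_W n_pos by linarith
  then have k: "int k + 1 < W" using pre(2) by linarith
  have "(2::int) ^ Suc k \<le> 2 ^ (L + 1)" using pre(2) by (intro power_increasing) auto
  then have pw: "(2::int) ^ k * 2 < W" using pow_W by (simp only: power_Suc2)
  have th: "0 \<le> th k * p" "th k * p < W" using th_pos[of k] p_pos th_W(1)[of k] pre(2) by auto
  have d: "th k * p div q \<le> th k * p" "0 \<le> th k * p div q"
    using th(1) q_pos zdiv_mono2[of "th k * p" 1 q] by (auto simp: pos_imp_zdiv_nonneg_iff)
  have d': "th k * p div q < W" "th k * p div q + 1 < W" using d th th_W(1)[of k] pre(2) by linarith+
  have t: "5 \<le> t" using pre by simp
  show ?thesis
    unfolding next_prog_def
    apply (insert t)
    apply (rule wp_Seq | (rule wp_basic; (simp add: r k pw th d d' abs_of_nonneg q_pos[THEN less_imp_neq[symmetric]] del: abs_mult)?))+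
    apply (rule post)
    using pre by (auto simp: consts_ok_def)
qed

lemma wp_levels:
  assumes pre: "R 0 = int n" "R 2 = 2 * int n" "R 11 = int s" "R 19 = \<theta>" "mem_ok M 0"
      "\<forall>x<2 * n. cell n M 7 x = 0" "T + 100 * n * L + 5 \<le> t"
    and post: "\<And>R M t. consts_ok R L \<Longrightarrow> mem_ok M L \<Longrightarrow> \<forall>x<2 * n. cell n M 7 x = word L x \<Longrightarrow> T \<le> t \<Longrightarrow> X (R, M) t"
  shows "wp (levels_prog p q) X (R, M) t"
proof -
  let ?I = "\<lambda>(R, M) t. \<exists>k\<le>L. consts_ok R k \<and> mem_ok M k \<and> R 15 = (if k = 0 then 0 else int (rk (k - 1) 0)) \<and>
    (\<forall>x<2 * n. cell n M 7 x = word k x) \<and> T + 100 * n * (L - k) + 1 \<le> t"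
  have loop: "wp (WhileLess (Reg 15) (Reg 0) (level_prog ;; next_prog p q)) X (R, M) t" if "?I (R, M) t" for R M t
  proof (rule wp_While[where I = ?I], goal_cases)
    case 1
    show ?case by fact
  next
    case (2 R M t)
    then obtain k where k: "k \<le> L" "consts_ok R k" "mem_ok M k" "R 15 = (if k = 0 then 0 else int (rk (k - 1) 0))"
      "\<forall>x<2 * n. cell n M 7 x = word k x" "T + 100 * n * (L - k) + 1 \<le> t" by auto
    have kL: "k < L"
    proof (cases "k = 0")
      case False
      then have "rk (k - 1) 0 < n" using 2(2) k(2,4) by (simp add: consts_ok_def)
      then have "k \<noteq> L" using rk_last by auto
      then show ?thesis using k by simp
    qed (use L_pos in simp)
    then have e: "100 * n * (L - k) = 100 * n + 100 * n * (L - Suc k)" by (simp add: Suc_diff_Suc[symmetric])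
    show ?case
    proof (intro conjI wp_Seq)
      show "0 < t" using k by simp
      show "wp level_prog (wp (next_prog p q) ?I) (R, M) (t - 1)"
      proof (rule wp_level[where k = k and T = "T + 100 * n * (L - Suc k) + 1 + 5"])
        show "T + 100 * n * (L - Suc k) + 1 + 5 + 90 * n \<le> t - 1" using k e n_pos by linarith
        fix R1 M1 t1
        assume 1: "consts_ok R1 k" "mem_ok M1 (Suc k)" "R1 15 = int (rk k 0)" "\<forall>x<2 * n. cell n M1 7 x = word (Suc k) x"
          "T + 100 * n * (L - Suc k) + 1 + 5 \<le> t1"
        show "wp (next_prog p q) ?I (R1, M1) t1"
          by (rule wp_next[OF 1(1) kL 1(5)])
            (use 1 kL in \<open>auto simp del: word.simps intro!: exI[of _ "Suc k"]\<close>)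
      qed (use k kL in auto)
    qed
  next
    case (3 R M t)
    then obtain k where k: "k \<le> L" "consts_ok R k" "mem_ok M k" "R 15 = (if k = 0 then 0 else int (rk (k - 1) 0))"
      "\<forall>x<2 * n. cell n M 7 x = word k x" "T + 1 \<le> t" by auto
    have R: "R 15 \<ge> int n" using 3(2) k(2) by (simp add: consts_ok_def)
    then have "k \<noteq> 0" using k(4) n_pos by (cases "k = 0") auto
    moreover have "rk (k - 1) 0 = n" using R k(4) rk_le[of 0 "k - 1"] calculation by simp
    ultimately have "\<not> Suc (k - 1) < L" using rk_before[of "k - 1"] by auto
    then have "k = L" using k \<open>k \<noteq> 0\<close> by simp
    then show ?case using k by (auto intro!: post)
  qed
  have t: "5 \<le> t" using pre by simp
  have "0 \<le> int n * \<theta>" using \<theta>_pos by simp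
  moreover have "int n * \<theta> + \<theta> + 1 < W" using th_W(2)[of 0] by simp
  ultimately have "\<bar>\<theta>\<bar> < W" using \<theta>_pos by linarith
  then show ?thesis
    unfolding levels_prog_def
    apply -
    apply (insert t)
    apply ((rule wp_Seq, rule wp_Add; simp add: pre(1-4) W_1 W_1[THEN less_trans[OF zero_less_one]])+)
    apply (rule loop)
    using pre by (auto simp: consts_ok_def)
qed

text \<open>Inequalities suffice in place of the exact recurrence. The choice is bounded by its
  estimate, which bounds the output; the last clause says that no level offers less, which bounds
  the optimum; antitonicity permits exchanging a window for a longer one of the same level.\<close>

definition dp_ok :: "(nat \<Rightarrow> int) \<Rightarrow> (nat \<Rightarrow> int) \<Rightarrow> nat \<Rightarrow> bool" where
  "dp_ok d nx i \<longleftrightarrow> (\<exists>y. nx i = int y \<and> i < y \<and> y \<le> n \<and> d y + E i y \<le> d i) \<and>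
     d (Suc i) \<le> d i \<and> d i \<le> d (Suc i) + \<theta> \<and> (\<forall>k<L. d i \<le> d (rk k i) + th k)"

text \<open>Needed against overflow: a step to the left adds between \<open>0\<close> and
  \<open>\<theta>\<close>.\<close>

lemma dp_ok_bounds:
  assumes "d n = 0" "\<forall>j. i \<le> j \<longrightarrow> j < n \<longrightarrow> dp_ok d nx j" "i \<le> n"
  shows "0 \<le> d i \<and> d i \<le> int n * \<theta>"
proof -
  have "0 \<le> d i \<and> d i \<le> int (n - i) * \<theta>"
    using assms(3)
  proof (induction rule: inc_induct)
    case (step j)
    then have "n - j = Suc (n - Suc j)" by simp
    then have "int (n - j) * \<theta> = int (n - Suc j) * \<theta> + \<theta>"
      by (simp only: of_nat_Suc distrib_right)
    moreover have "dp_ok d nx j" using assms(2) step by simp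
    ultimately show ?case using step.IH \<theta>_pos by (auto simp: dp_ok_def)
  qed (use assms in simp)
  moreover have "int (n - i) * \<theta> \<le> int n * \<theta>" using \<theta>_pos by (intro mult_right_mono) auto
  ultimately show ?thesis by linarith
qed

lemma dp_ok_antimono:
  assumes "\<forall>j. i \<le> j \<longrightarrow> j < n \<longrightarrow> dp_ok d nx j" "i \<le> j" "j \<le> l" "l \<le> n"
  shows "d l \<le> d j"
  using assms(3)
proof (induction rule: inc_induct)
  case (step j')
  then have "dp_ok d nx j'" using assms by simp
  then show ?case using step.IH by (auto simp: dp_ok_def)
qed simp

text \<open>This keeps the values antitone. The window of level \<open>k\<close> at
  \<open>Suc i\<close> reaches at least as far as the one at \<open>i\<close>, so for the same
  charge it leads to a value that is no larger.\<close>

lemma dp_ok_candidate: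
  assumes "d n = 0" "\<forall>j. Suc i \<le> j \<longrightarrow> j < n \<longrightarrow> dp_ok d nx j" "i < n" "k < L"
  shows "d (Suc i) \<le> d (rk k i) + th k"
proof (cases "Suc i = n")
  case True
  then have "rk k i = n" using rk_gt[OF assms(3), of k] rk_le[of i k] assms(3) by simp
  then show ?thesis using assms True th_pos[of k] by simp
next
  case False
  then have "dp_ok d nx (Suc i)" using assms by simp
  then have "d (Suc i) \<le> d (rk k (Suc i)) + th k" using assms(4) by (auto simp: dp_ok_def)
  moreover have "d (rk k (Suc i)) \<le> d (rk k i)"
    using rk_gt[OF assms(3), of k] rk_le_Suc[OF assms(3), of k] rk_le[of "Suc i" k] assms(3)
    by (intro dp_ok_antimono[OF assms(2)]) auto
  ultimately show ?thesis by linarith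
qed

text \<open>The credit that pays for the advances of the windows: levels below \<open>k\<close> have already been moved to
  position \<open>i\<close>.\<close>

definition pot :: "nat \<Rightarrow> nat \<Rightarrow> nat" where
  "pot k i = (\<Sum>k'<L. rk k' (if k' < k then i else Suc i))"

lemma pot_Suc: "k < L \<Longrightarrow> pot (Suc k) i + rk k (Suc i) = pot k i + rk k i"
proof -
  assume "k < L"
  then have *: "{..<L} = insert k ({..<L} - {k})" by auto
  have "(\<Sum>k'\<in>{..<L} - {k}. rk k' (if k' < Suc k then i else Suc i)) =
      (\<Sum>k'\<in>{..<L} - {k}. rk k' (if k' < k then i else Suc i))"
    by (intro sum.cong) auto
  then show ?thesis
    unfolding pot_def by (subst (1 2) *) (simp add: sum.insert_remove)
qed

lemma word_div_bounds: "0 \<le> word L x div 2 ^ k \<and> word L x div 2 ^ k < W"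
proof -
  have "word L x div 2 ^ k \<le> word L x div 1"
    using word_bounds[of L x] by (intro zdiv_mono2) auto
  moreover have "(2::int) ^ L \<le> 2 ^ (L + 1)" by (intro power_increasing) auto
  ultimately show ?thesis using word_bounds[of L x] pow_W by (auto simp: pos_imp_zdiv_nonneg_iff)
qed

definition dp_state :: "(nat \<Rightarrow> int) \<Rightarrow> nat \<Rightarrow> bool" where
  "dp_state M i \<longleftrightarrow> (\<forall>x<2 * n. cell n M 7 x = word L x) \<and> cell n M 8 n = 0 \<and>
     (\<forall>j. i \<le> j \<longrightarrow> j < n \<longrightarrow> dp_ok (cell n M 8) (cell n M 9) j)"

text \<open>\<open>dp_ok\<close> in progress at position \<open>i\<close>: registers
  \<open>21\<close> and \<open>22\<close> stand for the value and the choice, and only the levels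
  below \<open>k\<close> have been inspected.\<close>

definition choice :: "(nat \<Rightarrow> int) \<Rightarrow> (nat \<Rightarrow> int) \<Rightarrow> nat \<Rightarrow> nat \<Rightarrow> bool" where
  "choice R d k i \<longleftrightarrow> R 20 = int L \<and> R 3 = int i \<and>
     (\<exists>y. R 22 = int y \<and> i < y \<and> y \<le> n \<and> d y + E i y \<le> R 21) \<and>
     d (Suc i) \<le> R 21 \<and> R 21 \<le> d (Suc i) + \<theta> \<and> (\<forall>k'<k. R 21 \<le> d (rk k' i) + th k')"

lemma wp_advance:
  assumes pre: "R 2 = 2 * int n" "R 14 = 2 ^ k" "k < L" "i < n" "rk k i \<le> r" "r \<le> rk k (Suc i)" "R 15 = int r" "R 5 = int (i + r)"
      "R 4 = (if adv k (i + r) then 1 else 0)" "\<forall>x<2 * n. cell n M 7 x = word L x" "T + 10 * r + 1 \<le> t"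
    and post: "\<And>R' t. (\<And>x. x \<notin> {1, 4, 5, 15} \<Longrightarrow> R' x = R x) \<Longrightarrow> R' 15 = int (rk k i) \<Longrightarrow>
      T + 10 * rk k i \<le> t \<Longrightarrow> X (R', M) t"
  shows "wp (WhileLess (Imm 0) (Reg 4) advance_prog) X (R, M) t"
proof -
  let ?I = "\<lambda>(R', M') t. \<exists>r. rk k i \<le> r \<and> r \<le> rk k (Suc i) \<and> R' 15 = int r \<and> R' 5 = int (i + r) \<and>
      R' 4 = (if adv k (i + r) then 1 else 0) \<and> (\<forall>x. x \<notin> {1, 4, 5, 15} \<longrightarrow> R' x = R x) \<and> M' = M \<and> T + 10 * r + 1 \<le> t"
  show ?thesis
  proof (rule wp_While[where I = ?I], goal_cases)
    case 1
    show ?case using pre by auto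
  next
    case (2 R' M' t)
    then obtain r where r: "rk k i \<le> r" "r \<le> rk k (Suc i)" "R' 15 = int r" "R' 5 = int (i + r)"
      "adv k (i + r)" "\<forall>x. x \<notin> {1, 4, 5, 15} \<longrightarrow> R' x = R x" "M' = M" "T + 10 * r + 1 \<le> t" by (auto split: if_splits)
    then have "rk k i < r" using adv_iff[OF pre(4) r(1,2)] by simp
    then obtain r' where r': "r = Suc r'" "rk k i \<le> r'" by (cases r) auto
    have b: "i + r' < 2 * n" "int r' < W" "int i + int r' < W" "int i + (1 + int r') - 1 = int (i + r')"
      using r r' rk_le[of "Suc i" k] pre(4) W_ge by linarith+
    have R: "R' 2 = 2 * int n" "R' 14 = 2 ^ k" "R' 15 = 1 + int r'" "R' 5 = int i + (1 + int r')"
      using r r' pre by auto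
    have w: "cell n M 7 (i + r') = word L (i + r')" using pre(10) b by simp
    have t: "11 \<le> t" using r r' by simp
    show ?case
      unfolding \<open>M' = M\<close>
      apply (rule conjI)
      subgoal using t by simp
      unfolding advance_prog_def
      apply (insert t)
      apply (rule wp_Seq | (rule wp_basic; (simp add: nat_int_add R b b(4)[simplified] w adr_less word_div_bounds word_bit[OF pre(3)] W_1 W_1[THEN less_trans[OF zero_less_one]])?))+
      subgoal using r r' by (auto intro!: exI[of _ r'])
      done
  next
    case (3 R' M' t)
    then obtain r where r: "rk k i \<le> r" "r \<le> rk k (Suc i)" "R' 15 = int r"
      "\<not> adv k (i + r)" "\<forall>x. x \<notin> {1, 4, 5, 15} \<longrightarrow> R' x = R x" "M' = M" "T + 10 * r + 1 \<le> t" by (auto split: if_splits)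
    then have "r = rk k i" using adv_iff[OF pre(4) r(1,2)] by simp
    then show ?case using r by (auto intro!: post)
  qed
qed

lemma wp_choose:
  assumes pre: "consts_ok R k" "choice R (cell n M 8) k i" "dp_state M (Suc i)" "i < n" "k < L"
      "\<forall>k'<L. cell n M 10 k' = int (rk k' (if k' < k then i else Suc i))" "T + 30 + 10 * rk k (Suc i) \<le> t"
    and post: "\<And>R' M' t. consts_ok R' (Suc k) \<Longrightarrow> choice R' (cell n M' 8) (Suc k) i \<Longrightarrow> dp_state M' (Suc i) \<Longrightarrow>
      \<forall>k'<L. cell n M' 10 k' = int (rk k' (if k' < Suc k then i else Suc i)) \<Longrightarrow>
      T + 10 * rk k i \<le> t \<Longrightarrow> X (R', M') t"
  shows "wp (choose_prog p q) X (R, M) t"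
proof -
  let ?d = "cell n M 8" and ?r = "rk k (Suc i)" and ?r' = "rk k i"
  have R: "R 2 = 2 * int n" "R 14 = 2 ^ k" "R 12 = th k" "R 13 = int k" "R 3 = int i"
    using pre by (auto simp: consts_ok_def choice_def)
  have r: "?r \<le> n" "?r' \<le> ?r" "i < ?r'" using rk_le[of "Suc i" k] rk_le_Suc[OF pre(4)] rk_gt[OF pre(4)] pre(4) by auto
  have b: "i + ?r < 2 * n" "int i + int ?r < W" "?r' < 2 * n" "adr n 10 k < m"
    using r pre(4) W_ge mem_L_less[OF pre(5)] by (auto simp: less_le_trans)
  have M: "cell n M 10 k = int ?r" "cell n M 7 (i + ?r) = word L (i + ?r)"
    using pre b by (auto simp: dp_state_def)
  have D: "?d n = 0" "\<forall>j. Suc i \<le> j \<longrightarrow> j < n \<longrightarrow> dp_ok ?d (cell n M 9) j" using pre(3) by (auto simp: dp_state_def)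
  have dr: "0 \<le> ?d ?r'" "?d ?r' \<le> int n * \<theta>"
    using dp_ok_bounds[of ?d ?r' "cell n M 9"] D r by auto
  have cW: "?d ?r' + th k < W" "0 \<le> ?d ?r' + th k" using dr th_W(2)[of k] th_pos[of k] pre(5) by linarith+
  have cand: "?d (Suc i) \<le> ?d ?r' + th k" by (rule dp_ok_candidate[OF D pre(4,5)])
  let ?M = "M(adr n 10 k := int ?r')"
  have M': "cell n ?M l j = cell n M l j" if "l < 10" "j < 2 * n" for l j
    using that by (simp add: cell_upd)
  have dp: "dp_state ?M (Suc i)"
  proof -
    have eq: "dp_ok (cell n ?M 8) (cell n ?M 9) j = dp_ok ?d (cell n M 9) j" if "Suc i \<le> j" "j < n" for j
    proof -
      have "rk k' j < 2 * n" for k' using rk_le[of j k'] that n_pos by linarith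
      then show ?thesis using that by (auto simp: dp_ok_def M')
    qed
    show ?thesis using pre(3) eq n_pos by (auto simp: dp_state_def M')
  qed
  have RT: "\<forall>k'<L. cell n ?M 10 k' = int (rk k' (if k' < Suc k then i else Suc i))"
    using pre(6) by (auto simp: cell_upd less_Suc_eq)
  have t: "30 + 10 * ?r \<le> t" using pre by simp
  define a :: int where "a = (if adv k (i + ?r) then 1 else 0)"
  have a: "word L (i + ?r) div 2 ^ k mod 2 = a" "0 \<le> a" "a < W"
    using word_bit[OF pre(5)] W_1 by (auto simp: a_def)
  \<comment> \<open>The common continuation of both outcomes of the comparison.\<close>
  have fin: "wp (next_prog p q) X (R1, ?M) t1"
    if "\<And>x. x \<notin> {1, 4, 5, 6, 15, 21, 22} \<Longrightarrow> R1 x = R x" "T + 10 * ?r' + 5 \<le> t1"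
      "R1 21 = min (R 21) (?d ?r' + th k)" "R1 22 = (if ?d ?r' + th k < R 21 then int ?r' else R 22)" for R1 t1
  proof (rule wp_next[where k = k and T = "T + 10 * ?r'"])
    show "consts_ok R1 k" using pre(1) that(1) by (simp add: consts_ok_def)
    fix R2 t2
    assume 2: "consts_ok R2 (Suc k)" "\<And>x. x \<notin> {12, 13, 14} \<Longrightarrow> R2 x = R1 x" "T + 10 * ?r' \<le> t2"
    have E: "E i ?r' \<le> th k" by (rule E_rk_le[OF pre(4)])
    have "choice R2 ?d (Suc k) i"
      using pre(2) cand r E that 2(2) by (auto simp: choice_def less_Suc_eq min_def)
    then have "choice R2 (cell n ?M 8) (Suc k) i"
    proof -
      have "rk k' i < 2 * n" for k' using rk_le[of i k'] pre(4) by linarith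
      then show ?thesis using \<open>choice R2 ?d (Suc k) i\<close> pre(4) by (auto simp: choice_def M')
    qed
    then show "X (R2, ?M) t2" using 2 dp RT by (intro post) auto
  qed (use that pre in auto)
  show ?thesis
    unfolding choose_prog_def
    apply (insert t)
    apply (rule wp_Seq | (rule wp_basic; (simp add: nat_int_add R M b a adr_less word_div_bounds)?))+
    apply (rule wp_advance[where k = k and i = i and r = ?r and T = "T + 19"])
    subgoal by (simp add: R)
    subgoal by (simp add: R)
    subgoal by (rule pre)
    subgoal by (rule pre)
    subgoal by (rule r)
    subgoal by simp
    subgoal by simp
    subgoal by simp
    subgoal by (simp add: a_def)
    subgoal using pre(3) by (simp add: dp_state_def)
    subgoal using pre(7) by simp
    subgoal premises prems for R' t'
    proof -
      have R': "R' 2 = 2 * int n" "R' 12 = th k" "R' 13 = int k" "R' 15 = int ?r'"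
        "R' 21 = R 21" "R' 22 = R 22"
        using prems(2,3) R by simp_all
      have t': "19 \<le> t'" using prems(4) by simp
      have dW: "?d ?r' < W" "?d ?r' \<ge> 0" using cW dr th_pos[of k] by linarith+
      have nW: "int ?r' < W" using r W_ge by linarith
      show ?thesis
        apply (insert t')
        apply (rule wp_Seq | (rule wp_basic wp_If; (simp add: R' b M' adr_less cW dW nW)?))+
        apply (rule fin)
        subgoal using prems(2) by simp
        subgoal using prems(4) by simp
        subgoal by simp
        subgoal by simp
        apply (rule wp_Seq | (rule wp_basic wp_If; (simp add: R' b M' adr_less cW dW nW)?))+
        apply (rule fin)
        subgoal using prems(2) by simp
        subgoal using prems(4) by simp
        subgoal by (simp add: R')
        subgoal by (simp add: R')
        done
    qed
    done
qed

text \<open>At a later position \<open>dp_ok\<close> refers only to cells from that position on, so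
  writing at \<open>i\<close> does not disturb it.\<close>

lemma dp_state_insert:
  assumes "choice R (cell n M 8) L i" "dp_state M (Suc i)" "i < n"
  shows "dp_state (M(adr n 8 i := R 21, adr n 9 i := R 22)) i"
proof -
  let ?M = "M(adr n 8 i := R 21, adr n 9 i := R 22)"
  have c: "cell n ?M 8 j = (if j = i then R 21 else cell n M 8 j)"
    "cell n ?M 9 j = (if j = i then R 22 else cell n M 9 j)" if "j \<le> n" for j
    using that assms(3) by (simp_all add: cell_upd)
  have rk: "rk k j \<le> n" "j < rk k j" if "j < n" for k j using that rk_le rk_gt by auto
  obtain y where y: "R 22 = int y" "i < y" "y \<le> n" "cell n M 8 y + E i y \<le> R 21"
    and R: "cell n M 8 (Suc i) \<le> R 21" "R 21 \<le> cell n M 8 (Suc i) + \<theta>" "\<forall>k<L. R 21 \<le> cell n M 8 (rk k i) + th k"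
    using assms(1) by (auto simp: choice_def)
  have "cell n ?M 8 (rk k i) = cell n M 8 (rk k i)" for k using rk[OF assms(3), of k] by (simp add: c)
  moreover have "cell n ?M 8 y = cell n M 8 y" "cell n ?M 8 (Suc i) = cell n M 8 (Suc i)" "cell n ?M 8 i = R 21"
    "cell n ?M 9 i = R 22" using y(2,3) assms(3) by (simp_all add: c)
  ultimately have new: "dp_ok (cell n ?M 8) (cell n ?M 9) i"
    unfolding dp_ok_def using y R by auto
  have old: "dp_ok (cell n ?M 8) (cell n ?M 9) j" if "i < j" "j < n" for j
  proof -
    have "dp_ok (cell n M 8) (cell n M 9) j" using assms(2) that by (simp add: dp_state_def)
    moreover have "rk k j \<noteq> i" for k using rk[OF that(2)] that(1) by (metis less_trans less_irrefl)
    ultimately show ?thesis using that rk[OF that(2)]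
      by (auto simp: dp_ok_def c)
  qed
  have "cell n ?M 7 x = cell n M 7 x" if "x < 2 * n" for x using that assms(3) by (simp add: cell_upd)
  then show ?thesis
    using assms(2,3) new old c[of n] by (auto simp: dp_state_def le_less)
qed

lemma wp_dp_body:
  assumes pre: "R 0 = int n" "R 2 = 2 * int n" "R 11 = int s" "R 19 = \<theta>" "R 20 = int L" "R 3 = int (Suc i)" "i < n"
      "dp_state M (Suc i)" "\<forall>k<L. cell n M 10 k = int (rk k (Suc i))"
      "T + 31 * L + 20 + 10 * pot 0 i \<le> t"
    and post: "\<And>R' M' t. R' 0 = int n \<Longrightarrow> R' 2 = 2 * int n \<Longrightarrow> R' 11 = int s \<Longrightarrow> R' 19 = \<theta> \<Longrightarrow> R' 20 = int L \<Longrightarrow>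
      R' 3 = int i \<Longrightarrow> dp_state M' i \<Longrightarrow> \<forall>k<L. cell n M' 10 k = int (rk k i) \<Longrightarrow>
      T + 10 * pot L i \<le> t \<Longrightarrow> X (R', M') t"
  shows "wp (dp_body p q) X (R, M) t"
proof -
  let ?rest = "stv 8 3 (Reg 21) ;; stv 9 3 (Reg 22)"
  let ?RT = "\<lambda>M k. \<forall>k'<L. cell n M 10 k' = int (rk k' (if k' < k then i else Suc i))"
  let ?I = "\<lambda>(R, M) t. \<exists>k\<le>L. consts_ok R k \<and> choice R (cell n M 8) k i \<and> dp_state M (Suc i) \<and> ?RT M k \<and>
    T + 31 * (L - k) + 10 * pot k i + 7 \<le> t"
  have loop: "wp (WhileLess (Reg 13) (Reg 20) (choose_prog p q)) (wp ?rest X) (R, M) t" if "?I (R, M) t" for R M t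
  proof (rule wp_While[where I = ?I], goal_cases)
    case 1
    show ?case by fact
  next
    case (2 R M t)
    then obtain k where k: "k \<le> L" "consts_ok R k" "choice R (cell n M 8) k i" "dp_state M (Suc i)" "?RT M k"
      "T + 31 * (L - k) + 10 * pot k i + 7 \<le> t" by auto
    have kL: "k < L" using 2(2) k by (simp add: consts_ok_def choice_def)
    \<comment> \<open>Makes the truncated subtraction in \<open>?T\<close> harmless.\<close>
    have le: "rk k (Suc i) \<le> pot k i"
    proof -
      have "rk k (if k < k then i else Suc i) \<le> pot k i"
        unfolding pot_def using kL by (intro member_le_sum) auto
      then show ?thesis by simp
    qed
    let ?T = "T + 31 * (L - Suc k) + 10 * (pot k i - rk k (Suc i)) + 7"
    have "wp (choose_prog p q) ?I (R, M) (t - 1)"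
    proof (rule wp_choose[where k = k and i = i and T = ?T])
      show "?T + 30 + 10 * rk k (Suc i) \<le> t - 1" using k(6) kL le by linarith
      fix R' M' t'
      assume 1: "consts_ok R' (Suc k)" "choice R' (cell n M' 8) (Suc k) i" "dp_state M' (Suc i)" "?RT M' (Suc k)"
        "?T + 10 * rk k i \<le> t'"
      have "T + 31 * (L - Suc k) + 10 * pot (Suc k) i + 7 \<le> t'" using 1(5) pot_Suc[OF kL, of i] le by linarith
      then show "?I (R', M') t'" unfolding case_prod_conv using 1 kL by (intro exI[of _ "Suc k"]) simp
    qed (use k kL pre in auto)
    then show ?case using k by simp
  next
    case (3 R M t)
    then obtain k where k: "k \<le> L" "consts_ok R k" "choice R (cell n M 8) k i" "dp_state M (Suc i)" "?RT M k"
      "T + 31 * (L - k) + 10 * pot k i + 7 \<le> t" by auto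
    have "k = L" using 3(2) k by (simp add: consts_ok_def choice_def)
    note k = k[unfolded this]
    have R: "R 3 = int i" "R 2 = 2 * int n" "i < 2 * n" using k pre by (auto simp: consts_ok_def choice_def)
    have t: "7 \<le> t" using k by simp
    have st: "dp_state (M(adr n 8 i := R 21, adr n 9 i := R 22)) i" using dp_state_insert k pre by blast
    show ?case
      apply (rule conjI)
      subgoal using t by simp
      apply (insert t)
      apply (rule wp_Seq | (rule wp_basic; (simp add: R adr_less)?))+
      apply (rule post)
      using k st R by (auto simp: consts_ok_def choice_def cell_upd)
  qed
  have D: "cell n M 8 n = 0" "\<forall>j. Suc i \<le> j \<longrightarrow> j < n \<longrightarrow> dp_ok (cell n M 8) (cell n M 9) j"
    using pre by (auto simp: dp_state_def)
  have d: "0 \<le> cell n M 8 (Suc i)" "cell n M 8 (Suc i) \<le> int n * \<theta>" using dp_ok_bounds[OF D] pre(7) by auto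
  have dW: "0 \<le> cell n M 8 (Suc i) + \<theta>" "cell n M 8 (Suc i) + \<theta> < W" "0 \<le> \<theta>" "\<theta> < W"
    using d th_W(2)[of 0] \<theta>_pos by auto
  have b: "Suc i < 2 * n" "int i < W" "int i + 1 < W" "0 < W" "R 3 = int i + 1" using pre W_ge by auto
  have t: "10 \<le> t" using pre by simp
  show ?thesis
    unfolding dp_body_def
    apply (insert t)
    apply (rule wp_Seq, (rule wp_basic; (simp add: pre(1-5) b dW W_1 adr_less)?))+
    apply (rule wp_Seq, rule loop)
    using pre E_rk_le[OF pre(7), of 0] \<theta>_pos single[OF pre(7)]
    by (auto simp: consts_ok_def choice_def intro!: exI[of _ 0] exI[of _ "Suc i"])
qed

lemma wp_dp:
  assumes pre: "consts_ok R L" "mem_ok M L" "\<forall>x<2 * n. cell n M 7 x = word L x" "T + 50 * (L + 1) * n + 3 \<le> t"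
    and post: "\<And>R' M' t. R' 0 = int n \<Longrightarrow> R' 2 = 2 * int n \<Longrightarrow> dp_state M' 0 \<Longrightarrow> T \<le> t \<Longrightarrow> X (R', M') t"
  shows "wp (dp_prog p q) X (R, M) t"
proof -
  \<comment> \<open>The sum of the right ends prepays all moves still to come in the replay;
    initially it is \<open>L * n\<close>.\<close>
  let ?I = "\<lambda>(R, M) t. \<exists>i\<le>n. R 0 = int n \<and> R 2 = 2 * int n \<and> R 11 = int s \<and> R 19 = \<theta> \<and> R 20 = int L \<and> R 3 = int i \<and>
    dp_state M i \<and> (\<forall>k<L. cell n M 10 k = int (rk k i)) \<and> T + (31 * L + 21) * i + 10 * (\<Sum>k<L. rk k i) + 1 \<le> t"
  have loop: "wp (WhileLess (Imm 0) (Reg 3) (dp_body p q)) X (R, M) t" if "?I (R, M) t" for R M t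
  proof (rule wp_While[where I = ?I], goal_cases)
    case 1
    show ?case by fact
  next
    case (2 R M t)
    then obtain i0 where i0: "i0 \<le> n" "R 0 = int n" "R 2 = 2 * int n" "R 11 = int s" "R 19 = \<theta>" "R 20 = int L" "R 3 = int i0"
      "dp_state M i0" "\<forall>k<L. cell n M 10 k = int (rk k i0)" "T + (31 * L + 21) * i0 + 10 * (\<Sum>k<L. rk k i0) + 1 \<le> t"
      by auto
    then obtain i where i: "i0 = Suc i" using 2(2) by (cases i0) auto
    have pot: "pot 0 i = (\<Sum>k<L. rk k (Suc i))" "pot L i = (\<Sum>k<L. rk k i)" by (simp_all add: pot_def)
    have "wp (dp_body p q) ?I (R, M) (t - 1)"
      by (rule wp_dp_body[where i = i and T = "T + (31 * L + 21) * i + 1"])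
        (use i0 i in \<open>auto simp: pot intro!: exI[of _ i]\<close>)
    then show ?case using i0 by simp
  next
    case (3 R M t)
    then show ?case by (auto intro!: post)
  qed
  have "int L < W" using mem_L m_le_W n_pos by linarith
  moreover have "int n < W" using W_ge n_pos by linarith
  moreover have "3 \<le> t" using pre by simp
  ultimately show ?thesis
    unfolding dp_prog_def
    apply -
    apply (rule wp_Seq, rule wp_Add, use pre in \<open>simp add: consts_ok_def\<close>, simp)+
    apply (rule loop)
    using pre by (auto simp: consts_ok_def mem_ok_def dp_state_def algebra_simps intro!: exI[of _ n])
qed

text \<open>Following the stored choices telescopes: the estimate of a part is at most the drop of
  the value across it, and the scaled cost is at most the estimate.\<close>

lemma wp_output:
  fixes T0 :: "nat list" and cost :: "nat list \<Rightarrow> real"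
  assumes pre: "R 0 = int n" "R 2 = 2 * int n" "dp_state M 0" "length T0 = n" "10 * n + 5 \<le> t"
    and cost: "\<And>i r. i < r \<Longrightarrow> r \<le> n \<Longrightarrow> real s * cost (win T0 i r) \<le> real_of_int (E i r)"
    and post: "\<And>R' M' t Ps. R' 0 = int (length Ps) \<Longrightarrow> \<forall>j<length Ps. cell n M' 0 j = int (length (Ps ! j)) \<Longrightarrow>
      Ps \<in> partitions T0 \<Longrightarrow> real s * partition_cost cost Ps \<le> real_of_int (cell n M 8 0) \<Longrightarrow> X (R', M') t"
  shows "wp output_prog X (R, M) t"
proof -
  let ?d = "cell n M 8" and ?nx = "cell n M 9"
  let ?P = "\<lambda>i Ps. concat Ps = take i T0 \<and> [] \<notin> set Ps \<and> real s * partition_cost cost Ps + real_of_int (?d i) \<le> real_of_int (?d 0)"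
  let ?I = "\<lambda>(R :: nat \<Rightarrow> int, M') t. \<exists>i\<le>n. \<exists>Ps. R 0 = int n \<and> R 2 = 2 * int n \<and> R 3 = int i \<and> R 13 = int (length Ps) \<and>
    (\<forall>j<length Ps. cell n M' 0 j = int (length (Ps ! j))) \<and> (\<forall>j\<le>n. cell n M' 9 j = ?nx j) \<and> ?P i Ps \<and> 10 * (n - i) + 2 \<le> t"
  have loop: "wp (WhileLess (Reg 3) (Reg 0) (ld 15 9 3 ;; Bin 5 Sub (Reg 15) (Reg 3) ;; stv 0 13 (Reg 5) ;;
       Bin 13 Add (Reg 13) (Imm 1) ;; Bin 3 Add (Reg 15) (Imm 0))) (wp (Bin 0 Add (Reg 13) (Imm 0)) X) (R, M') t"
    if "?I (R, M') t" for R M' t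
  proof (rule wp_While[where I = ?I], goal_cases)
    case 1
    show ?case by fact
  next
    case (2 R M' t)
    then obtain i Ps where i: "i < n" "R 0 = int n" "R 2 = 2 * int n" "R 3 = int i" "R 13 = int (length Ps)"
      "\<forall>j<length Ps. cell n M' 0 j = int (length (Ps ! j))" "\<forall>j\<le>n. cell n M' 9 j = ?nx j" "?P i Ps" "10 * (n - i) + 2 \<le> t"
      by auto
    then obtain y where y: "?nx i = int y" "i < y" "y \<le> n" "?d y + E i y \<le> ?d i"
      using pre(3) by (auto simp: dp_state_def dp_ok_def)
    have l: "length Ps < n" using length_le_concat[of Ps] i pre(4) by simp
    have b: "i < 2 * n" "length Ps < 2 * n" "int (length Ps) + 1 < W" "int y < W" "int y - int i < W" "cell n M' 9 i = int y"
      using i y l W_ge by auto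
    have t: "12 \<le> t" using i by simp
    have len: "int y - int i = int (length (win T0 i y))" using y pre(4) by (simp add: length_win)
    have P: "?P y (Ps @ [win T0 i y])"
    proof (intro conjI)
      show "concat (Ps @ [win T0 i y]) = take y T0" using i y take_win[of i y T0] by simp
      show "[] \<notin> set (Ps @ [win T0 i y])" using i y len by auto
      have "real s * cost (win T0 i y) \<le> real_of_int (E i y)" by (rule cost[OF y(2,3)])
      moreover have "real_of_int (?d y + E i y) \<le> real_of_int (?d i)" using y(4) of_int_le_iff by blast
      moreover have "real s * partition_cost cost Ps + real_of_int (?d i) \<le> real_of_int (?d 0)" using i by blast
      ultimately show "real s * partition_cost cost (Ps @ [win T0 i y]) + real_of_int (?d y) \<le> real_of_int (?d 0)"
        by (simp add: partition_cost_def distrib_left)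
    qed
    have "\<forall>j<Suc (length Ps). cell n (M'(adr n 0 (length Ps) := int y - int i)) 0 j = int (length ((Ps @ [win T0 i y]) ! j))"
      using i(6) len b by (auto simp: cell_upd less_Suc_eq nth_append)
    moreover have "\<forall>j\<le>n. cell n (M'(adr n 0 (length Ps) := int y - int i)) 9 j = ?nx j"
      using i(7) b n_pos by (simp add: cell_upd)
    ultimately have I: "?I (R', M'(adr n 0 (length Ps) := int y - int i)) (t - 10)"
      if "R' 0 = int n" "R' 2 = 2 * int n" "R' 3 = int y" "R' 13 = int (length Ps) + 1" for R'
      unfolding case_prod_conv using P i(9) y that by (intro exI[of _ y] conjI exI[of _ "Ps @ [win T0 i y]"]) auto
    show ?case
      apply (rule conjI)
      subgoal using t by simp
      apply (insert t)
      apply (rule wp_Seq, (rule wp_basic; (simp add: i(2-5) b y(2)[THEN less_imp_le] adr_less)?))+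
      apply (rule wp_Add)
      subgoal using b by simp
      subgoal by simp
      subgoal
        using I[of "R(15 := int y, 5 := int y - int i, Suc 0 := int (adr n 0 (length Ps)), 13 := int (length Ps) + 1,
          3 := int y)"] i(2-5) by simp
      done
  next
    case (3 R M' t)
    then obtain Ps where i: "R 13 = int (length Ps)" "\<forall>j<length Ps. cell n M' 0 j = int (length (Ps ! j))" "?P n Ps" "2 \<le> t"
      by auto
    have "length Ps \<le> n" using length_le_concat[of Ps] i pre(4) by simp
    then have W: "int (length Ps) < W" using W_ge n_pos by linarith
    have "Ps \<in> partitions T0" using i(3) pre(4) by (simp add: partitions_def)
    moreover have "?d n = 0" using pre(3) by (simp add: dp_state_def)
    ultimately show ?case using i W by (auto intro!: wp_Add post)
  qed
  have t: "5 \<le> t" using pre by simp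
  show ?thesis
    unfolding output_prog_def
    apply (insert t)
    apply (rule wp_Seq, rule wp_Add, simp add: W_1[THEN less_trans[OF zero_less_one]], simp)+
    apply (rule wp_Seq)
    apply (rule loop)
    using pre by (auto simp: partition_cost_def intro!: exI[of _ "[]"])
qed

text \<open>Each part of an arbitrary partition is charged to a level whose window covers it. That
  window may end beyond the part, but then the remaining value is only smaller.\<close>

lemma dp_le_partition:
  fixes T0 :: "nat list" and cost :: "nat list \<Rightarrow> real"
  assumes st: "dp_state M 0" and len: "length T0 = n"
    and charge: "\<And>i r. i < r \<Longrightarrow> r \<le> n \<Longrightarrow> \<exists>k<L. r \<le> rk k i \<and> real_of_int (th k) \<le> \<beta> * cost (win T0 i r)"
    and Ps: "i \<le> n" "concat Ps = drop i T0" "[] \<notin> set Ps"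
  shows "real_of_int (cell n M 8 i) \<le> \<beta> * partition_cost cost Ps"
  using Ps
proof (induction Ps arbitrary: i)
  case Nil
  then have "i = n" using len by simp
  then show ?case using st by (simp add: dp_state_def partition_cost_def)
next
  case (Cons P Ps)
  let ?d = "cell n M 8"
  define r where "r = i + length P"
  have "length (P @ concat Ps) = n - i" using Cons.prems len by (metis concat.simps(2) length_drop)
  then have r: "i < r" "r \<le> n" using Cons.prems by (auto simp: r_def)
  have P: "P = win T0 i r" using Cons.prems(2) by (simp add: win_def r_def append_eq_conv_conj)
  have "concat Ps = drop r T0"
    using Cons.prems(2) by (simp add: r_def append_eq_conv_conj drop_drop add.commute)
  then have IH: "real_of_int (?d r) \<le> \<beta> * partition_cost cost Ps"
    using Cons.IH[of r] r Cons.prems by simp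
  obtain k where k: "k < L" "r \<le> rk k i" "real_of_int (th k) \<le> \<beta> * cost P" using charge[OF r] P by blast
  have D: "\<forall>j. 0 \<le> j \<longrightarrow> j < n \<longrightarrow> dp_ok ?d (cell n M 9) j" using st by (simp add: dp_state_def)
  have "?d (rk k i) \<le> ?d r" using r rk_le[of i k] by (intro dp_ok_antimono[OF D]) (auto simp: k)
  moreover have "?d i \<le> ?d (rk k i) + th k" using D r k by (auto simp: dp_ok_def)
  ultimately have "?d i \<le> ?d r + th k" by linarith
  then have "real_of_int (?d i) \<le> real_of_int (?d r) + real_of_int (th k)" by (simp flip: of_int_add)
  then show ?case using IH k(3) by (simp add: partition_cost_def distrib_left)
qed

end


section \<open>Approximation ratio and resources\<close>

text \<open>The parameters are constants independent of the text; its length enters only through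
  registers. Register \<open>19\<close> receives the first threshold.\<close>

definition partition_prog :: "nat \<Rightarrow> int \<Rightarrow> int \<Rightarrow> nat \<Rightarrow> prog" where
  "partition_prog K p q k = Bin 2 Add (Reg 0) (Reg 0) ;; Bin 10 Add (Reg 0) (Imm 1) ;; rename_prog k ;;
     Bin 11 Mul (Reg 10) (Imm (int K)) ;; Fun 19 (Imm 1) (Imm 1) (Reg 11) ;;
     Bin 19 Add (Reg 19) (Reg 0) ;; Bin 19 Add (Reg 19) (Imm 3) ;;
     levels_prog p q ;; dp_prog p q ;; output_prog"

lemma cost_singleton: "cost_nonadaptive f [x] = f 1 1"
  by (simp add: cost_nonadaptive_def H0_def)

lemma (in ram) wp_exec:
  assumes "wp P Q st t" "bounded W st"
  shows "\<exists>t' st' u. exec f W m P st t' st' \<and> t' \<le> t \<and> Q st' u"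
  using assms unfolding wp_def by (metis le_add1)

lemma win_map: "win (map \<phi> T) i r = map \<phi> (win T i r)"
  by (simp add: win_def take_map drop_map)

lemma relabelling:
  assumes "\<forall>i<n. \<forall>j<n. ids i = ids j \<longleftrightarrow> T ! i = T ! j" "length T = n"
  obtains \<phi> where "map ids [0..<n] = map \<phi> T" "inj_on \<phi> (set T)"
proof -
  define j where "j x = (SOME j. j < n \<and> T ! j = x)" for x
  have j: "j x < n \<and> T ! j x = x" if "x \<in> set T" for x
    unfolding j_def by (rule someI_ex) (use that assms(2) in \<open>auto simp: in_set_conv_nth\<close>)
  show thesis
  proof
    show "map ids [0..<n] = map (\<lambda>x. ids (j x)) T"
    proof (rule nth_equalityI)
      fix i assume "i < length (map ids [0..<n])"
      then have i: "i < n" "T ! i \<in> set T" using assms(2) by auto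
      then have "ids i = ids (j (T ! i))" using assms(1) j[OF i(2)] by simp
      then show "map ids [0..<n] ! i = map (\<lambda>x. ids (j x)) T ! i" using i assms(2) by simp
    qed (use assms in simp)
    show "inj_on (\<lambda>x. ids (j x)) (set T)"
    proof (rule inj_onI)
      fix x y assume "x \<in> set T" "y \<in> set T" "ids (j x) = ids (j y)"
      then show "x = y" using j[of x] j[of y] assms(1) by metis
    qed
  qed
qed

text \<open>What a single text needs. \<open>\<theta>\<close> is the scaled cost of a symbol plus
  the rounding allowance \<open>n + 2\<close>, rounded up. \<open>K\<close> makes the rounding of
  one window small against the slack \<open>b - p / q\<close> times the scaled minimum cost.
  \<open>Lm\<close> thresholds span the range of costs, and the remaining inequalities exclude
  overflow.\<close>

locale run =
  fixes f :: "nat \<Rightarrow> nat \<Rightarrow> real" and T :: "nat list" and n rounds K s Lm :: nat and p q \<theta> W Z :: int and b \<delta> :: real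
  assumes len: "length T = n" and n_pos: "0 < n" and rounds: "set T \<subseteq> {..<(n + 1) ^ rounds}"
    and mono: "positive_monotone_on (cost_nonadaptive f) T" and \<delta>: "\<delta> = f 1 1"
    and pq: "0 < q" "q < p" and K_pos: "0 < K"
    and s: "s = K * (n + 1)" and \<theta>: "\<theta> = \<lfloor>real s * f 1 1\<rfloor> + int n + 3"
    and K: "3 * (p / q) \<le> (b - p / q) * (K * \<delta>)"
    and Lm: "cost_nonadaptive f T \<le> \<delta> * (p / q) ^ Lm"
    and Z_lg: "int (s * n * n) \<le> Z"
    and Z_fun: "\<And>j l. 1 \<le> j \<Longrightarrow> j \<le> l \<Longrightarrow> l \<le> n \<Longrightarrow> \<bar>\<lfloor>real s * f l j\<rfloor>\<bar> \<le> Z"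
    and Z_W: "(int n + 3) * Z + 3 < W"
    and th_W: "(p / q)\<^sup>2 * (real s * cost_nonadaptive f T + n + 5) * p + 1 < W"
      "real n * (real s * cost_nonadaptive f T + n + 3) +
         (p / q)\<^sup>2 * (real s * cost_nonadaptive f T + n + 5) + 1 < W"
    and pow_W: "2 ^ (Lm + 2) < W"
    and mem_W: "int (20 * n + Lm + 1) \<le> W"
    and rounds_W: "int ((n + 1) ^ rounds) \<le> W"
begin

abbreviation "cost \<equiv> cost_nonadaptive f"
abbreviation "m \<equiv> 20 * n + Lm + 1"

sublocale machine f W m n
  using n_pos mem_W by unfold_locales auto

lemma cost_mono:
  assumes "i \<le> i'" "i' < r'" "r' \<le> r" "r \<le> n"
  shows "cost (win T i' r') \<le> cost (win T i r)"
proof -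
  have "length (win T i' r') \<noteq> 0" using assms len by (simp add: length_win)
  then have "win T i' r' \<noteq> []" by auto
  then show ?thesis
    using mono sublist_win_win[OF assms(1,3)] sublist_win unfolding positive_monotone_on_def by blast
qed

text \<open>Every nonempty window contains a single symbol, and all single symbols cost
  \<open>f 1 1\<close>.\<close>

lemma cost_ge: "i < r \<Longrightarrow> r \<le> n \<Longrightarrow> \<delta> \<le> cost (win T i r)"
  using cost_mono[of i i "Suc i" r] win_Cons[of i "Suc i" T] len by (simp add: cost_singleton \<delta>)

lemma cost_le: "i < r \<Longrightarrow> r \<le> n \<Longrightarrow> cost (win T i r) \<le> cost T"
  using cost_mono[of 0 i r n] len by (simp add: win_def)

lemma \<delta>_pos: "0 < \<delta>"
proof -
  have "win T 0 1 = [T ! 0]" using win_Cons[of 0 1 T] len n_pos by simp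
  then have "sublist [T ! 0] T" using sublist_win[of T 0 1] by simp
  then have "0 < cost [T ! 0]" using mono unfolding positive_monotone_on_def by blast
  then show ?thesis by (simp add: cost_singleton \<delta>)
qed

end

locale relabelled = run +
  fixes U :: "nat list" and \<phi>
  assumes U: "U = map \<phi> T" and inj: "inj_on \<phi> (set T)" and U_less: "set U \<subseteq> {..<n}"
begin

abbreviation "ecost i r \<equiv> est f s n (win U i r)"

lemma ecost_bounds:
  "real s * cost (win T i r) < real_of_int (ecost i r)"
  "real_of_int (ecost i r) \<le> real s * cost (win T i r) + real n + 2"
proof -
  have "cost (win U i r) = cost (win T i r)"
    unfolding U win_map using inj set_win by (intro cost_map_inj inj_on_subset[OF inj])
  moreover have "set (win U i r) \<subseteq> {..<n}" by (rule order_trans[OF set_win U_less])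
  ultimately show "real s * cost (win T i r) < real_of_int (ecost i r)"
    "real_of_int (ecost i r) \<le> real s * cost (win T i r) + real n + 2"
    using est_bounds[where w = "win U i r" and s = s and f = f] by auto
qed

lemma len_U: "length U = n"
  using len U by simp

lemma \<theta>_bounds: "real s * \<delta> + n + 2 < real_of_int \<theta>" "real_of_int \<theta> \<le> real s * \<delta> + n + 3"
  unfolding \<theta> \<delta> by linarith+

sublocale levels ecost n \<theta> p q
proof
  fix i assume "i < n"
  then have "win U i (Suc i) = [U ! i]" "U ! i < n" using win_Cons[of i "Suc i" U] len_U U_less nth_mem by fastforce+
  then have "ecost i (Suc i) = lg s 1 - tally s n [U ! i] + \<lfloor>real s * f 1 1\<rfloor> + 2" by (simp add: est_def)
  moreover have "lg s 1 = 0" by (simp add: lg_def)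
  ultimately show "ecost i (Suc i) \<le> \<theta>" unfolding \<theta> using tally_nonneg[of s n "[U ! i]"] by linarith
next
  have "0 \<le> real s * \<delta>" using \<delta>_pos by simp
  then have "0 < real_of_int \<theta>" using \<theta>_bounds(1) by linarith
  then show "0 < \<theta>" by linarith
qed (use pq in auto)

text \<open>Monotonicity of the true cost bounds all suffixes of the window at once; the allowance
  \<open>n + 2\<close> then transfers this to their estimates.\<close>

lemma covers: 
  assumes "i < r" "r \<le> n" "real s * cost (win T i r) + n + 2 \<le> real_of_int (th k)"
  shows "r \<le> rk k i"
proof (rule rk_cover[OF assms(1,2)])
  fix i' assume i': "i \<le> i'" "i' < r"
  have "real s * cost (win T i' r) \<le> real s * cost (win T i r)"
    using i' assms by (intro mult_left_mono cost_mono) auto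
  then show "ecost i' r \<le> th k" using ecost_bounds(2)[of i' r] assms(3) by linarith
qed

lemma covers_all: "real s * cost T + n + 2 \<le> real_of_int (th k) \<Longrightarrow> rk k 0 = n"
  using covers[of 0 n k] len n_pos rk_le[of 0 k] by (simp add: win_def)

text \<open>\<open>\<theta>\<close> already includes the allowance \<open>n + 2\<close>, and scaling
  it by \<open>(p / q) ^ Lm\<close> only enlarges the allowance while lifting
  \<open>\<delta>\<close> to the cost of the whole text.\<close>

lemma rk_Lm: "rk Lm 0 = n"
proof (rule covers_all)
  have 1: "1 \<le> (p / q) ^ Lm" using ratio by (intro one_le_power) simp
  have "real s * cost T + (real n + 2) * 1 \<le> real s * (\<delta> * (p / q) ^ Lm) + (real n + 2) * (p / q) ^ Lm"
    using Lm 1 by (intro add_mono mult_left_mono) auto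
  then have "real s * cost T + n + 2 \<le> real s * (\<delta> * (p / q) ^ Lm) + (real n + 2) * (p / q) ^ Lm"
    by simp
  also have "\<dots> = (real s * \<delta> + n + 2) * (p / q) ^ Lm" by (simp add: algebra_simps)
  also have "\<dots> \<le> real_of_int \<theta> * (p / q) ^ Lm"
    using \<theta>_bounds(1) 1 by (intro mult_right_mono) auto
  also have "\<dots> \<le> real_of_int (th Lm)" by (rule th_ge_power)
  finally show "real s * cost T + n + 2 \<le> real_of_int (th Lm)" .
qed

definition L :: nat where "L = Suc (LEAST k. rk k 0 = n)"

lemma L_props: "rk (L - 1) 0 = n" "Suc k < L \<Longrightarrow> rk k 0 \<noteq> n" "L \<le> Lm + 1" "0 < L"
  using LeastI[of "\<lambda>k. rk k 0 = n", OF rk_Lm] not_less_Least[of k "\<lambda>k. rk k 0 = n"]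
    Least_le[of "\<lambda>k. rk k 0 = n", OF rk_Lm] by (auto simp: L_def)

abbreviation "Y \<equiv> real s * cost T + n + 2"

text \<open>A threshold before the last level is below \<open>Y\<close>, since otherwise the whole
  text would have been affordable and the program would have stopped. At most two more steps follow,
  whence the square.\<close>

lemma th_le: "k \<le> L \<Longrightarrow> real_of_int (th k) \<le> (p / q)\<^sup>2 * (Y + 3)"
proof -
  assume k: "k \<le> L"
  let ?\<rho> = "real_of_int p / real_of_int q"
  have Y0: "0 \<le> Y" using cost_le[of 0 n] cost_ge[of 0 n] n_pos \<delta>_pos len by (simp add: win_def)
  have small: "real_of_int (th k) < Y" if "Suc k < L" for k
    using covers_all[of k] L_props(2)[OF that] by linarith
  have "\<delta> \<le> cost T" using cost_ge[of 0 n] n_pos len by (simp add: win_def)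
  then have "real s * \<delta> \<le> real s * cost T" by (intro mult_left_mono) auto
  then have th0: "real_of_int (th 0) \<le> Y + 1" using \<theta>_bounds(2) by simp
  have r: "1 \<le> ?\<rho>" "?\<rho> \<le> ?\<rho>\<^sup>2" using ratio power_increasing[of 1 2 ?\<rho>] by auto
  have th1: "real_of_int (th (L - 1)) \<le> ?\<rho> * (Y + 2)"
  proof (cases "L - 1")
    case 0
    have "1 * (Y + 2) \<le> ?\<rho> * (Y + 2)" using r Y0 by (intro mult_right_mono) auto
    then show ?thesis using 0 th0 by simp
  next
    case (Suc k')
    then have "real_of_int (th k') < Y" by (intro small) simp
    then have "real_of_int (th k') * ?\<rho> \<le> Y * ?\<rho>" using r by (intro mult_right_mono) auto
    moreover have "real_of_int (th (L - 1)) \<le> real_of_int (th k') * ?\<rho> + 1"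
      using th_Suc_bounds(2)[of k'] Suc by (simp del: th.simps)
    moreover have "?\<rho> * (Y + 2) = Y * ?\<rho> + 2 * ?\<rho>" by (simp add: algebra_simps)
    ultimately show ?thesis using r by linarith
  qed
  have mono: "?\<rho> * (Y + 2) \<le> ?\<rho>\<^sup>2 * (Y + 3)" using r Y0 by (intro mult_mono) auto
  have thL: "real_of_int (th L) \<le> ?\<rho>\<^sup>2 * (Y + 3)"
  proof -
    have "real_of_int (th L) \<le> real_of_int (th (L - 1)) * ?\<rho> + 1"
      using th_Suc_bounds(2)[of "L - 1"] L_props(4) by simp
    also have "\<dots> \<le> (?\<rho> * (Y + 2)) * ?\<rho> + ?\<rho>\<^sup>2"
      using th1 r by (intro add_mono mult_right_mono) auto
    also have "(x * (y + 2)) * x + x\<^sup>2 = x\<^sup>2 * (y + 3)" for x y :: real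
      by (simp add: power2_eq_square algebra_simps)
    finally show ?thesis .
  qed
  consider "Suc k < L" | "k = L - 1" | "k = L" using k by linarith
  then show ?thesis
  proof cases
    case 1
    have "1 * (Y + 2) \<le> ?\<rho> * (Y + 2)" using r Y0 by (intro mult_right_mono) auto
    then have "Y + 2 \<le> ?\<rho> * (Y + 2)" by (simp only: mult_1)
    then show ?thesis using small[OF 1] mono by linarith
  qed (use th1 thL mono in auto)
qed

text \<open>Take the least threshold that accommodates the window with its rounding allowance. Its
  predecessor does not, so it overshoots by little more than the factor \<open>p / q\<close>; the
  rest is absorbed by the choice of \<open>K\<close>.\<close>

lemma charge:
  assumes "i < r" "r \<le> n"
  shows "\<exists>k<L. r \<le> rk k i \<and> real_of_int (th k) \<le> (b * real s) * cost (win T i r)"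
proof -
  let ?c = "cost (win T i r)" and ?\<rho> = "real_of_int p / real_of_int q"
  let ?P = "\<lambda>k. k = L - 1 \<or> real s * ?c + n + 2 \<le> real_of_int (th k)"
  define k where "k = (LEAST k. ?P k)"
  have P: "?P k" unfolding k_def by (rule LeastI[of ?P "L - 1"]) simp
  have kL: "k < L" using Least_le[of ?P "L - 1"] L_props(4) by (simp add: k_def)
  have r: "1 \<le> ?\<rho>" using ratio by simp
  have c: "\<delta> \<le> ?c" using cost_ge assms by blast
  have sc: "real s * \<delta> \<le> real s * ?c" using c by (intro mult_left_mono) auto
  have "0 \<le> real s * \<delta>" using \<delta>_pos by simp
  then have sc0: "0 \<le> real s * ?c" using sc by linarith
  have "real_of_int (th k) \<le> ?\<rho> * (real s * ?c + n + 2) + 1"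
  proof (cases k)
    case 0
    have "1 * (real s * ?c + n + 2) \<le> ?\<rho> * (real s * ?c + n + 2)"
      using r sc0 by (intro mult_right_mono) auto
    then show ?thesis using \<theta>_bounds(2) sc 0 by simp
  next
    case (Suc k')
    then have "\<not> ?P k'" unfolding k_def by (intro not_less_Least) simp
    then have "real_of_int (th k') * ?\<rho> \<le> (real s * ?c + n + 2) * ?\<rho>"
      using r by (intro mult_right_mono) auto
    then show ?thesis using th_Suc_bounds(2)[of k'] Suc by (simp only: mult.commute)
  qed
  also have "\<dots> \<le> ?\<rho> * (real s * ?c) + 3 * ?\<rho> * (n + 1)"
  proof -
    have "x * (y + z + 2) + 1 \<le> x * y + 3 * x * (z + 1)" if "1 \<le> x" "0 \<le> z" for x y z :: real
    proof -
      have "0 \<le> x * z" using that by simp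
      moreover have "x * (y + z + 2) + 1 = x * y + x * z + 2 * x + 1" "3 * x * (z + 1) = 3 * (x * z) + 3 * x"
        by (simp_all add: algebra_simps)
      ultimately show ?thesis using that by linarith
    qed
    from this[of ?\<rho> "real n" "real s * ?c"] show ?thesis using r by (simp only: of_nat_add of_nat_1 of_nat_0_le_iff)
  qed
  \<comment> \<open>Here the scale matters: \<open>s\<close> is \<open>K * (n + 1)\<close>, so the
    error \<open>3 * (p / q) * (n + 1)\<close> is at most \<open>(b - p / q) * s * \<delta>\<close>,
    and no window costs less than \<open>\<delta>\<close>.\<close>
  also have "\<dots> \<le> ?\<rho> * (real s * ?c) + (b - ?\<rho>) * (real s * ?c)"
  proof -
    have "0 < (b - ?\<rho>) * (K * \<delta>)" using K r by linarith
    moreover have "0 \<le> K * \<delta>" using \<delta>_pos by simp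
    ultimately have "0 < b - ?\<rho>" by (metis zero_less_mult_iff not_less)
    have "3 * ?\<rho> * (n + 1) \<le> (b - ?\<rho>) * (K * \<delta>) * (n + 1)" using K by (intro mult_right_mono) auto
    also have "\<dots> = (b - ?\<rho>) * (real s * \<delta>)" by (simp only: s of_nat_mult of_nat_add of_nat_1 ac_simps)
    also have "\<dots> \<le> (b - ?\<rho>) * (real s * ?c)" by (rule mult_left_mono[OF sc less_imp_le]) fact
    finally show ?thesis by simp
  qed
  also have "\<dots> = (b * real s) * ?c" by (simp add: algebra_simps)
  finally have th: "real_of_int (th k) \<le> (b * real s) * ?c" .
  have "r \<le> rk k i"
  proof (cases "k = L - 1")
    case True
    then have "n \<le> rk k i" using rk_mono[of 0 i k] L_props(1) assms by simp
    then show ?thesis using assms by simp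
  next
    case False
    then show ?thesis using covers[OF assms] P by blast
  qed
  with th kL show ?thesis by blast
qed

sublocale windows f W m n s U \<theta> p q Z L
proof
  show "length U = n" by (rule len_U)
  show "set U \<subseteq> {..<n}" by (rule U_less)
  show "0 < s" using K_pos s by simp
  show "int (s * n * n) \<le> Z" by (rule Z_lg)
  show "\<bar>\<lfloor>real s * f (r - i) (card (set (win U i r)))\<rfloor>\<bar> \<le> Z" if "i < r" "r \<le> n" for i r
  proof (rule Z_fun)
    have "length (win U i r) = r - i" using that len_U by (simp add: length_win)
    then show "card (set (win U i r)) \<le> r - i" by (metis card_length)
    have "win U i r \<noteq> []" using \<open>length (win U i r) = r - i\<close> that by auto
    then show "1 \<le> card (set (win U i r))" by (simp add: Suc_le_eq card_gt_0_iff)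
  qed (use that in simp)
  show "(int n + 3) * Z + 3 < W" by (rule Z_W)
  show "0 < L" "rk (L - 1) 0 = n" by (rule L_props)+
  show "rk k 0 \<noteq> n" if "Suc k < L" for k by (rule L_props(2)[OF that])
  let ?H = "(p / q)\<^sup>2 * (Y + 3)"
  show "th k * p + 1 < W" if "k \<le> L" for k
  proof -
    have "real_of_int (th k) * p \<le> ?H * p" using th_le[OF that] pq by (intro mult_right_mono) auto
    then have "real_of_int (th k) * p + 1 < W" using th_W(1) by (simp add: add.assoc)
    then have "real_of_int (th k * p + 1) < real_of_int W" by simp
    then show ?thesis by (simp only: of_int_less_iff)
  qed
  show "int n * \<theta> + th k + 1 < W" if "k \<le> L" for k
  proof -
    have "\<delta> \<le> cost T" using cost_ge[of 0 n] n_pos len by (simp add: win_def)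
    then have "real s * \<delta> \<le> real s * cost T" by (intro mult_left_mono) auto
    then have "real_of_int \<theta> \<le> real s * cost T + n + 3" using \<theta>_bounds(2) by linarith
    then have "real n * real_of_int \<theta> \<le> real n * (real s * cost T + n + 3)" by (intro mult_left_mono) auto
    then have "real n * real_of_int \<theta> + real_of_int (th k) + 1 < W" using th_le[OF that] th_W(2) by (simp add: add.assoc)
    then have "real_of_int (int n * \<theta> + th k + 1) < real_of_int W" by simp
    then show ?thesis by (simp only: of_int_less_iff)
  qed
  have "(2::int) ^ (L + 1) \<le> 2 ^ (Lm + 2)" using L_props(3) by (intro power_increasing) auto
  then show "2 ^ (L + 1) < W" using pow_W by linarith
  show "20 * n + L \<le> m" using L_props(3) by simp
qed

lemma wp_optimise:
  assumes pre: "base R" "fresh M" "holds M 1 (\<lambda>i. U ! i)" "(200 * (Lm + 2) + 30) * n \<le> t"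
    and post: "\<And>R' M' t Ps. R' 0 = int (length Ps) \<Longrightarrow> \<forall>j<length Ps. cell n M' 0 j = int (length (Ps ! j)) \<Longrightarrow>
      Ps \<in> partitions T \<Longrightarrow> partition_cost cost Ps \<le> b * optimal_cost cost T \<Longrightarrow> X (R', M') t"
  shows "wp (Bin 11 Mul (Reg 10) (Imm (int K)) ;; Fun 19 (Imm 1) (Imm 1) (Reg 11) ;;
     Bin 19 Add (Reg 19) (Reg 0) ;; Bin 19 Add (Reg 19) (Imm 3) ;;
     levels_prog p q ;; dp_prog p q ;; output_prog) X (R, M) t"
proof -
  \<comment> \<open>Credits counted from the end: output, then dynamic program, then levels.\<close>
  define t0 where "t0 = 10 * n + 5"
  define t1 where "t1 = t0 + 50 * (L + 1) * n + 3"
  define t2 where "t2 = t1 + 100 * n * L + 5"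
  have "t2 + 4 \<le> t"
  proof -
    have "L * n \<le> (Lm + 1) * n" using L_props(3) by (intro mult_le_mono) auto
    then have "50 * (L + 1) * n \<le> 50 * Lm * n + 100 * n" "100 * n * L \<le> 100 * Lm * n + 100 * n"
      by (auto simp: algebra_simps)
    moreover have "(200 * (Lm + 2) + 30) * n = 200 * Lm * n + 430 * n" by (simp add: algebra_simps)
    moreover have "150 * Lm * n \<le> 200 * Lm * n" by (intro mult_le_mono) auto
    ultimately show ?thesis using pre(4) n_pos unfolding t0_def t1_def t2_def by linarith
  qed
  have tail: "wp (levels_prog p q ;; dp_prog p q ;; output_prog) X (R, M) t"
    if "R 0 = int n" "R 2 = 2 * int n" "R 11 = int s" "R 19 = \<theta>" "t2 \<le> t" for R t
  proof (rule wp_Seq, rule wp_levels[where T = t1])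
    show "mem_ok M 0" using pre n_pos by (auto simp: mem_ok_def fresh_def)
    show "\<forall>x<2 * n. cell n M 7 x = 0" using pre by (auto simp: fresh_def)
    show "t1 + 100 * n * L + 5 \<le> t" using that by (simp add: t2_def)
    fix R1 M1 t'
    assume 1: "consts_ok R1 L" "mem_ok M1 L" "\<forall>x<2 * n. cell n M1 7 x = word L x" "t1 \<le> t'"
    show "wp (dp_prog p q ;; output_prog) X (R1, M1) t'"
    proof (rule wp_Seq, rule wp_dp[OF 1(1-3), where T = t0])
      show "t0 + 50 * (L + 1) * n + 3 \<le> t'" using 1(4) by (simp add: t1_def)
      fix R2 :: "nat \<Rightarrow> int" and M2 t''
      assume 2: "R2 0 = int n" "R2 2 = 2 * int n" "dp_state M2 0" "t0 \<le> t''"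
      show "wp output_prog X (R2, M2) t''"
      proof (rule wp_output[OF 2(1-3) len, where cost = cost])
        show "10 * n + 5 \<le> t''" using 2(4) by (simp add: t0_def)
        show "real s * cost (win T i r) \<le> real_of_int (ecost i r)" if "i < r" "r \<le> n" for i r
          using ecost_bounds(1) by (rule less_imp_le)
        fix R' :: "nat \<Rightarrow> int" and M' t Ps
        assume 3: "R' 0 = int (length Ps)" "\<forall>j<length Ps. cell n M' 0 j = int (length (Ps ! j))" "Ps \<in> partitions T"
          "real s * partition_cost cost Ps \<le> real_of_int (cell n M2 8 0)"
        have "optimal_cost cost T \<in> partition_cost cost ` partitions T"
          unfolding optimal_cost_def using finite_partitions partitions_nonempty by (intro Min_in) auto
        then obtain Qs where Q: "optimal_cost cost T = partition_cost cost Qs" "Qs \<in> partitions T" by auto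
        have "real_of_int (cell n M2 8 0) \<le> (b * real s) * partition_cost cost Qs"
          using Q(2) by (intro dp_le_partition[OF 2(3) len charge]) (auto simp: partitions_def)
        then have "real s * partition_cost cost Ps \<le> real s * (b * optimal_cost cost T)"
          using 3(4) Q(1) by (simp add: ac_simps)
        then have "partition_cost cost Ps \<le> b * optimal_cost cost T"
          using s_pos by (simp add: mult_le_cancel_left_pos)
        then show "X (R', M') t" using 3 by (intro post)
      qed
    qed
  qed (use that in auto)
  have sW: "int s < W" using sn_bounds(1)[of 1] n_pos by simp
  have s': "(int n + 1) * int K = int s" by (simp add: s algebra_simps)
  have F: "\<bar>\<lfloor>real s * f 1 1\<rfloor>\<bar> \<le> Z" by (rule Z_fun) (use n_pos in auto)
  have "int n * 1 \<le> int n * Z" using Z_lg s_pos n_pos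
    by (intro mult_left_mono) (auto intro!: order_trans[OF _ Z_lg] simp: Suc_le_eq simp flip: of_nat_mult)
  then have FW: "\<bar>\<lfloor>real s * f 1 1\<rfloor>\<bar> < W" "\<bar>\<lfloor>real s * f 1 1\<rfloor> + int n\<bar> < W" "\<bar>\<theta>\<bar> < W"
    using F Z_nonneg unfolding \<theta> by linarith+
  have t: "t2 + 4 \<le> t" by fact
  show ?thesis
    apply (rule wp_Seq, rule wp_Mul)
    subgoal using pre sW s' by simp
    subgoal using t by simp
    apply (rule wp_Seq, rule wp_Fun)
    subgoal by simp
    subgoal by simp
    subgoal using pre s' FW by simp
    subgoal using t by simp
    apply (rule wp_Seq, rule wp_Add)
    subgoal using pre s' FW by simp
    subgoal using t by simp
    apply (rule wp_Seq, rule wp_Add)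
    subgoal using pre s' FW \<theta> by simp
    subgoal using t by simp
    apply (rule tail)
    using pre s' \<theta> t by simp_all
qed

end

context run
begin

lemma exec_partition:
  "\<exists>t st Ps. exec f W m (partition_prog K p q rounds) (input T) t st \<and> outputs st Ps \<and> Ps \<in> partitions T \<and>
     partition_cost cost Ps \<le> b * optimal_cost cost T \<and> t \<le> (100 * rounds + 200 * (Lm + 2) + 40) * n"
proof -
  let ?t = "(100 * rounds + 200 * (Lm + 2) + 40) * n"
  let ?M = "\<lambda>i. if i < length T then int (T ! i) else 0" and ?R = "(\<lambda>_. 0 :: int)(0 := int (length T))"
  let ?Q = "\<lambda>(R, M) (t :: nat). \<exists>Ps. outputs (R, M) Ps \<and> Ps \<in> partitions T \<and> partition_cost cost Ps \<le> b * optimal_cost cost T"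
  have T_less: "T ! i < (n + 1) ^ rounds" if "i < n" for i using rounds len that nth_mem by fastforce
  have T_W: "int (T ! i) < W" if "i < n" for i
  proof -
    have "int (T ! i) < int ((n + 1) ^ rounds)" using T_less[OF that] by (simp only: of_nat_less_iff)
    then show ?thesis using rounds_W by linarith
  qed
  have bnd: "bounded W (?R, ?M)"
    using T_W W_ge n_pos len by (auto simp: bounded_def)
  have fresh: "fresh ?M"
  proof -
    have "\<not> adr n k i < n" if "6 \<le> k" for k i
    proof -
      have "1 * n \<le> k * (2 * n)" using that by (intro mult_le_mono) auto
      then show ?thesis unfolding adr_def not_less by (simp only: mult_1 trans_le_add1)
    qed
    then show ?thesis unfolding fresh_def cell_def len by (intro allI impI) (simp only: if_False)
  qed
  have holds: "holds ?M 0 (\<lambda>i. T ! i)" "holds ?M 1 (\<lambda>_. 0)"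
    by (auto simp: holds_def cell_def adr_def len)
  have "wp (partition_prog K p q rounds) ?Q (?R, ?M) ?t"
    unfolding partition_prog_def
  proof (rule wp_Seq, rule wp_Add, goal_cases)
    case 3
    let ?R1 = "?R(2 := val ?R (Reg 0) + val ?R (Reg 0))"
    let ?R2 = "?R1(10 := val ?R1 (Reg 0) + val ?R1 (Imm 1))"
    let ?opt = "Bin 11 Mul (Reg 10) (Imm (int K)) ;; Fun 19 (Imm 1) (Imm 1) (Reg 11) ;;
     Bin 19 Add (Reg 19) (Reg 0) ;; Bin 19 Add (Reg 19) (Imm 3) ;; levels_prog p q ;; dp_prog p q ;; output_prog"
    have "wp (rename_prog rounds ;; ?opt) ?Q (?R2, ?M) (?t - 1 - 1)"
    \<comment> \<open>Array \<open>1\<close> lies beyond the text and is still zero, so the initial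
      names are all \<open>0\<close>; after \<open>rounds\<close> digits the names separate exactly
      the distinct symbols, which are below \<open>(n + 1) ^ rounds\<close>.\<close>
    proof (rule wp_Seq, rule wp_rename[where v = "\<lambda>i. T ! i" and ids = "\<lambda>_. 0" and T = "(200 * (Lm + 2) + 30) * n"])
      show "(200 * (Lm + 2) + 30) * n + rounds * (100 * n) + 1 \<le> ?t - 1 - 1"
        using n_pos by (simp add: algebra_simps)
      show "\<forall>i<n. int (T ! i) < W" using T_W by blast
      fix R M t ids
      assume 1: "base R" "fresh M" "holds M 1 ids" "\<forall>i<n. ids i < n"
        "\<forall>i<n. \<forall>j<n. ids i = ids j \<longleftrightarrow> (0::nat) = 0 \<and> T ! i mod (n + 1) ^ rounds = T ! j mod (n + 1) ^ rounds"
        "(200 * (Lm + 2) + 30) * n \<le> t"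
      have "\<forall>i<n. \<forall>j<n. ids i = ids j \<longleftrightarrow> T ! i = T ! j"
      proof (intro allI impI)
        fix i j assume "i < n" "j < n"
        then show "ids i = ids j \<longleftrightarrow> T ! i = T ! j" using 1(5) T_less[of i] T_less[of j] by (metis mod_less)
      qed
      then obtain \<phi> where \<phi>: "map ids [0..<n] = map \<phi> T" "inj_on \<phi> (set T)"
        by (rule relabelling[OF _ len])
      have "set (map ids [0..<n]) \<subseteq> {..<n}" using 1(4) by auto
      then interpret relabelled f T n rounds K s Lm p q \<theta> W Z b \<delta> "map ids [0..<n]" \<phi>
        using \<phi> by unfold_locales assumption+
      show "wp ?opt ?Q (R, M) t"
      proof (rule wp_optimise[OF 1(1,2) _ 1(6)])
        show "holds M 1 (\<lambda>i. map ids [0..<n] ! i)" using 1(3) by (simp add: holds_def)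
        fix R' :: "nat \<Rightarrow> int" and M' t' Ps
        assume "R' 0 = int (length Ps)" "\<forall>j<length Ps. cell n M' 0 j = int (length (Ps ! j))"
           "Ps \<in> partitions T" "partition_cost cost Ps \<le> b * optimal_cost cost T"
        then show "?Q (R', M') t'" by (auto simp: outputs_def cell_def adr_def)
      qed
    qed (use fresh holds n_pos len in auto)
    moreover have "2 * 1 \<le> ?t" using n_pos by (intro mult_le_mono) auto
    ultimately show ?case
      apply -
      apply (rule wp_Seq, rule wp_Add)
      subgoal using len W_ge n_pos by simp
      subgoal by simp
      apply assumption
      done
  qed (use n_pos len W_ge in auto)
  then have "\<exists>t' st' u. exec f W m (partition_prog K p q rounds) (?R, ?M) t' st' \<and> t' \<le> ?t \<and> ?Q st' u"
    using bnd by (rule wp_exec)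
  then show ?thesis by (auto simp: input_def)
qed

end

section \<open>One word length for all overflow conditions\<close>

definition poly_growth :: "(nat \<Rightarrow> real) \<Rightarrow> bool" where
  "poly_growth g \<longleftrightarrow> (\<exists>c. \<forall>n\<ge>1. \<bar>g n\<bar> \<le> (real n + 1) ^ c)"

lemma poly_growth_const [intro!]: "poly_growth (\<lambda>_. x)"
proof -
  obtain c where c: "\<bar>x\<bar> < 2 ^ c" using real_arch_pow[of 2 "\<bar>x\<bar>"] by auto
  have "\<bar>x\<bar> \<le> (real n + 1) ^ c" if "1 \<le> n" for n
    using power_mono[of 2 "real n + 1" c] that c by simp
  then show ?thesis unfolding poly_growth_def by blast
qed

lemma poly_growth_id [intro!]: "poly_growth real"
  unfolding poly_growth_def by (rule exI[of _ 1]) simp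

text \<open>The factor \<open>2\<close> of the sum is at most \<open>n + 1\<close> and costs one
  more power.\<close>

lemma poly_growth_add [intro!]:
  assumes "poly_growth g" "poly_growth h"
  shows "poly_growth (\<lambda>n. g n + h n)"
proof -
  obtain c c' where c: "\<forall>n\<ge>1. \<bar>g n\<bar> \<le> (real n + 1) ^ c" "\<forall>n\<ge>1. \<bar>h n\<bar> \<le> (real n + 1) ^ c'"
    using assms unfolding poly_growth_def by blast
  have "\<bar>g n + h n\<bar> \<le> (real n + 1) ^ Suc (max c c')" if n: "1 \<le> n" for n
  proof -
    have "(real n + 1) ^ c \<le> (real n + 1) ^ max c c'" "(real n + 1) ^ c' \<le> (real n + 1) ^ max c c'"
      by (intro power_increasing; simp)+
    then have "\<bar>g n\<bar> + \<bar>h n\<bar> \<le> 2 * (real n + 1) ^ max c c'"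
      using c(1)[rule_format, OF n] c(2)[rule_format, OF n] by linarith
    also have "\<dots> \<le> (real n + 1) * (real n + 1) ^ max c c'" using n by (intro mult_right_mono) auto
    finally show ?thesis using abs_triangle_ineq[of "g n" "h n"] by simp
  qed
  then show ?thesis unfolding poly_growth_def by blast
qed

lemma poly_growth_mult [intro!]:
  assumes "poly_growth g" "poly_growth h"
  shows "poly_growth (\<lambda>n. g n * h n)"
proof -
  obtain c c' where c: "\<forall>n\<ge>1. \<bar>g n\<bar> \<le> (real n + 1) ^ c" "\<forall>n\<ge>1. \<bar>h n\<bar> \<le> (real n + 1) ^ c'"
    using assms unfolding poly_growth_def by blast
  have "\<bar>g n * h n\<bar> \<le> (real n + 1) ^ (c + c')" if n: "1 \<le> n" for n
    unfolding abs_mult power_add using c n by (intro mult_mono) auto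
  then show ?thesis unfolding poly_growth_def by blast
qed

lemma poly_growth_power [intro!]: "poly_growth g \<Longrightarrow> poly_growth (\<lambda>n. g n ^ k)"
  by (induction k) auto

lemma poly_growth_less_power:
  assumes "poly_growth g"
  shows "\<exists>c. \<forall>n\<ge>1. g n < real_of_int ((int n + 1) ^ c)"
proof -
  obtain c where c: "\<forall>n\<ge>1. \<bar>g n\<bar> \<le> (real n + 1) ^ c" using assms unfolding poly_growth_def by blast
  have "g n < real_of_int ((int n + 1) ^ Suc c)" if n: "1 \<le> n" for n
  proof -
    have "(real n + 1) ^ c < (real n + 1) ^ Suc c" using n by (intro power_strict_increasing) auto
    moreover have "g n \<le> (real n + 1) ^ c" using c[rule_format, OF n] by linarith
    moreover have "real_of_int ((int n + 1) ^ Suc c) = (real n + 1) ^ Suc c" by simp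
    ultimately show ?thesis by linarith
  qed
  then show ?thesis by blast
qed

text \<open>The subtracted terms of \<open>length_H0\<close> are nonnegative, which leaves
  \<open>n * log 2 n\<close>, at most the square of \<open>n\<close>.\<close>

lemma cost_le_poly:
  assumes f: "\<forall>m k. 1 \<le> k \<and> k \<le> m \<longrightarrow> \<bar>f m k\<bar> \<le> A * real m ^ B" and T: "T \<noteq> []"
  shows "cost_nonadaptive f T \<le> (A + 1) * real (length T) ^ (B + 2)"
proof -
  let ?n = "length T"
  have n: "1 \<le> ?n" using T by (simp add: Suc_le_eq)
  have A: "0 \<le> A" using f[rule_format, of 1 1] by simp
  have "0 \<le> (\<Sum>c\<in>set T. real (count_list T c) * log 2 (real (count_list T c)))"
  proof (rule sum_nonneg)
    fix c assume "c \<in> set T"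
    then have "1 \<le> count_list T c" by (metis One_nat_def Suc_leI count_list_0_iff neq0_conv)
    then show "0 \<le> real (count_list T c) * log 2 (real (count_list T c))" by simp
  qed
  then have "real ?n * H0 T \<le> real ?n * log 2 (real ?n)" unfolding length_H0 by simp
  also have "log 2 (real ?n) \<le> real ?n" using log2_of_power_le[of ?n ?n] less_exp[of ?n] T by simp
  then have "real ?n * log 2 (real ?n) \<le> real ?n ^ 2" unfolding power2_eq_square by (intro mult_left_mono) auto
  also have "real ?n ^ 2 \<le> real ?n ^ (B + 2)" using n by (intro power_increasing) auto
  finally have 1: "real ?n * H0 T \<le> real ?n ^ (B + 2)" .
  have "1 \<le> card (set T)" "card (set T) \<le> ?n" using T by (auto simp: Suc_le_eq card_gt_0_iff card_length)
  then have "f ?n (card (set T)) \<le> A * real ?n ^ B" using f by (metis abs_le_D1)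
  also have "\<dots> \<le> A * real ?n ^ (B + 2)" using n A by (intro mult_left_mono power_increasing) auto
  finally show ?thesis using 1 unfolding cost_nonadaptive_def by (simp add: distrib_right)
qed

lemma ceil_log_bounds:
  fixes \<rho> x :: real
  assumes "1 < \<rho>" "1 \<le> x"
  defines "l \<equiv> nat \<lceil>log \<rho> x\<rceil>"
  shows "x \<le> \<rho> ^ l" "\<rho> ^ l \<le> \<rho> * x" "real l \<le> log \<rho> x + 1"
proof -
  have "0 \<le> log \<rho> x" using assms by simp
  then have l: "real l \<le> log \<rho> x + 1" "log \<rho> x \<le> real l" unfolding l_def by linarith+
  show "real l \<le> log \<rho> x + 1" by (rule l)
  have e: "\<rho> ^ l = \<rho> powr real l" using assms(1) by (simp only: powr_realpow)
  have x: "\<rho> powr log \<rho> x = x" using assms by simp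
  have "\<rho> powr log \<rho> x \<le> \<rho> powr real l" using assms(1) l by (intro powr_mono) auto
  then show "x \<le> \<rho> ^ l" unfolding e x .
  have "\<rho> powr real l \<le> \<rho> powr (log \<rho> x + 1)" using assms(1) l by (intro powr_mono) auto
  also have "\<dots> = \<rho> * x" using assms by (simp add: powr_add)
  finally show "\<rho> ^ l \<le> \<rho> * x" unfolding e .
qed

lemma rational_between:
  fixes x y :: real
  assumes "x < y"
  obtains p q :: int where "0 < q" "x < p / q" "p / q < y"
proof -
  obtain r where r: "r \<in> \<rat>" "x < r" "r < y" using Rats_dense_in_real[OF assms] by blast
  then obtain p q where "0 < q" "r = of_int p / of_int q" by (elim Rats_cases') auto
  then show thesis using r that by blast
qed

text \<open>The factor \<open>a\<close> is at most \<open>2 ^ a\<close> and so is covered by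
  \<open>a\<close> further digits to base \<open>n + 1\<close>. The number of renaming rounds is
  thus independent of the text.\<close>

lemma texts_bound: "T \<in> texts a d \<Longrightarrow> x \<in> set T \<Longrightarrow> x < (length T + 1) ^ (a + d)"
proof -
  assume T: "T \<in> texts a d" and x: "x \<in> set T"
  have "a \<le> 2 ^ a" using less_exp[of a] by simp
  also have "\<dots> \<le> (length T + 1) ^ a" using T by (intro power_mono) (auto simp: texts_def Suc_le_eq)
  finally have "a * length T ^ d \<le> (length T + 1) ^ (a + d)"
    unfolding power_add by (intro mult_le_mono power_mono) auto
  then show ?thesis using T x by (fastforce simp: texts_def)
qed

text \<open>\<open>C\<close> depends on the alphabet parameters and the degree \<open>B\<close> but
  not on \<open>\<epsilon>\<close>; the terms containing \<open>\<epsilon>\<close>, \<open>A\<close>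
  and \<open>f 1 1\<close> are swallowed by taking \<open>n\<close> large.\<close>

lemma nonadaptive_algorithm:
  fixes f :: "nat \<Rightarrow> nat \<Rightarrow> real" and a d B :: nat
  assumes f: "\<forall>m k. 1 \<le> k \<and> k \<le> m \<longrightarrow> \<bar>f m k\<bar> \<le> A * real m ^ B" and f11: "0 < f 1 1" and \<epsilon>: "0 < \<epsilon>"
  defines "C \<equiv> real (100 * (a + d) + 200 * (2 * B + 9) + 100)"
  shows "\<exists>P. approx_partition_algorithm f (cost_nonadaptive f)
      {T \<in> texts a d. positive_monotone_on (cost_nonadaptive f) T} \<epsilon> P
      (\<lambda>n. C * (real n * log (1 + \<epsilon>) (real n))) (\<lambda>n. C * real n)"
proof -
  define b where "b = 1 + \<epsilon>"
  define \<delta> where "\<delta> = f 1 1"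
  have b: "1 < b" using \<epsilon> by (simp add: b_def)
  have "sqrt b < b"
  proof -
    have "1 < sqrt b" using b by simp
    then have "sqrt b * 1 < sqrt b * sqrt b" by (intro mult_strict_left_mono) auto
    then show ?thesis using b by simp
  qed
  \<comment> \<open>Above \<open>sqrt b\<close>, so that the number of levels is at most doubled
    against logarithms to base \<open>b\<close>; below \<open>b\<close>, to leave slack for
    rounding.\<close>
  then obtain p q :: int where q: "0 < q" and pq: "sqrt b < p / q" "p / q < b" by (rule rational_between)
  define \<rho> :: real where "\<rho> = p / q"
  have \<rho>: "1 < \<rho>" "sqrt b < \<rho>" "\<rho> < b" using pq b less_trans[of 1 "sqrt b" \<rho>] by (auto simp: \<rho>_def)
  have qp: "q < p" using \<rho>(1) q by (simp add: \<rho>_def)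
  have \<delta>: "0 < \<delta>" using f11 by (simp add: \<delta>_def)
  have A: "\<delta> \<le> A" using f[rule_format, of 1 1] by (simp add: \<delta>_def)
  obtain K :: nat where K: "3 * \<rho> / ((b - \<rho>) * \<delta>) < K" using reals_Archimedean2 by blast
  have "0 < 3 * \<rho> / ((b - \<rho>) * \<delta>)" using \<rho> \<delta> by simp
  then have K_pos: "0 < K" using K by (cases K) auto
  have K': "3 * \<rho> \<le> (b - \<rho>) * (K * \<delta>)" using K \<rho> \<delta> by (simp add: divide_less_eq ac_simps)
  \<comment> \<open>\<open>x n\<close>, the multiple of \<open>G\<close> below, bounds the ratio of
    the largest to the smallest cost and hence determines the number of levels.\<close>
  define G where "G = (A + 1) / \<delta>"
  have G: "1 \<le> G" using A \<delta> by (simp add: G_def)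
  \<comment> \<open>Trades base \<open>2\<close> for base \<open>\<rho>\<close>:
    \<open>2 ^ Lm n\<close> is at most the \<open>e\<close>-th power of \<open>\<rho> ^ Lm n\<close>
    and therefore polynomial in \<open>n\<close>.\<close>
  obtain e where e: "2 < \<rho> ^ e" using real_arch_pow[OF \<rho>(1)] by blast
  define x where "x n = G * real n ^ (B + 2)" for n
  define Lm where "Lm n = nat \<lceil>log \<rho> (x n)\<rceil>" for n
  have x: "1 \<le> x n" if "1 \<le> n" for n
  proof -
    have "1 \<le> real n ^ (B + 2)" using that by (intro one_le_power) simp
    then have "1 * 1 \<le> G * real n ^ (B + 2)" using G by (intro mult_mono) auto
    then show ?thesis by (simp only: x_def mult_1)
  qed
  have Lm: "x n \<le> \<rho> ^ Lm n" "\<rho> ^ Lm n \<le> \<rho> * x n" "real (Lm n) \<le> log \<rho> (x n) + 1" if "1 \<le> n" for n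
    unfolding Lm_def by (rule ceil_log_bounds[OF \<rho>(1) x[OF that]])+
  have pow_Lm: "2 ^ Lm n \<le> (\<rho> * x n) ^ e" if "1 \<le> n" for n
  proof -
    have "(2::real) ^ Lm n \<le> (\<rho> ^ e) ^ Lm n" using e by (intro power_mono) auto
    also have "\<dots> = (\<rho> ^ Lm n) ^ e" by (simp flip: power_mult add: mult.commute)
    also have "\<dots> \<le> (\<rho> * x n) ^ e" using Lm(2)[OF that] \<rho> by (intro power_mono) auto
    finally show ?thesis .
  qed
  define s where "s n = real K * (real n + 1)" for n
  define X where "X n = (A + 1) * real n ^ (B + 2)" for n
  define z where "z n = s n * real n * real n + s n * (A * real n ^ B) + 2" for n
  \<comment> \<open>One majorant for each word-size condition of \<open>run\<close>. All are
    nonnegative, so a bound on their sum \<open>g\<close> serves every one of them.\<close>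
  define g1 where "g1 n = (real n + 3) * z n + 3" for n
  define g2 where "g2 n = \<rho>\<^sup>2 * (s n * X n + real n + 5) * p + 1" for n
  define g3 where "g3 n = real n * (s n * X n + real n + 3) + \<rho>\<^sup>2 * (s n * X n + real n + 5) + 1" for n
  define g4 where "g4 n = 4 * (\<rho> * x n) ^ e" for n
  define g5 where "g5 n = 20 * real n + (\<rho> * x n) ^ e + 1" for n
  define g6 where "g6 n = (real n + 1) ^ (a + d)" for n
  define g where "g n = g1 n + g2 n + g3 n + g4 n + g5 n + g6 n" for n
  have sn: "poly_growth s" unfolding s_def by auto
  have Xn: "poly_growth X" unfolding X_def by auto
  have xn: "poly_growth x" unfolding x_def by auto
  have zn: "poly_growth z" unfolding z_def using sn by auto
  have gn: "poly_growth g1" "poly_growth g2" "poly_growth g3" "poly_growth g4" "poly_growth g5" "poly_growth g6"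
    unfolding g1_def g2_def g3_def g4_def g5_def g6_def using sn Xn xn zn by auto
  have "poly_growth g" unfolding g_def using gn by auto
  then obtain c where c: "\<forall>n\<ge>1. g n < real_of_int ((int n + 1) ^ c)" using poly_growth_less_power by blast
  have run: "\<exists>t st Ps. exec f ((int (length T) + 1) ^ c) (20 * length T + Lm (length T) + 1) (partition_prog K p q (a + d)) (input T) t st \<and>
      outputs st Ps \<and> Ps \<in> partitions T \<and>
      partition_cost (cost_nonadaptive f) Ps \<le> b * optimal_cost (cost_nonadaptive f) T \<and>
      t \<le> (100 * (a + d) + 200 * (Lm (length T) + 2) + 40) * length T"
    if T: "T \<in> texts a d" and mono: "positive_monotone_on (cost_nonadaptive f) T" for T
  proof -
    define n where "n = length T"
    define W where "W = (int n + 1) ^ c"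
    define S where "S = K * (n + 1)"
    have n: "1 \<le> n" using T by (simp add: texts_def n_def Suc_le_eq)
    have S: "real S = s n" by (simp add: S_def s_def algebra_simps)
    have s0: "0 \<le> s n" by (simp add: s_def)
    have A0: "0 \<le> A" using A \<delta> by simp
    have X0: "0 \<le> X n" using A0 by (simp add: X_def)
    have x0: "0 \<le> (\<rho> * x n) ^ e" using x[OF n] \<rho> by simp
    have cX: "cost_nonadaptive f T \<le> X n" unfolding X_def n_def using T by (intro cost_le_poly[OF f]) (simp add: texts_def)
    have z0: "0 \<le> z n" using s0 A0 by (simp add: z_def)
    have p0: "0 < p" using q qp by simp
    have sX0: "0 \<le> s n * X n" using s0 X0 by simp
    have g0: "0 \<le> g1 n" "0 \<le> g2 n" "0 \<le> g3 n" "0 \<le> g4 n" "0 \<le> g5 n" "0 \<le> g6 n"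
      using z0 p0 sX0 x0 by (simp_all add: g1_def g2_def g3_def g4_def g5_def g6_def)
    have gW: "g n < real_of_int W" using c n by (simp add: W_def)
    have sc: "s n * cost_nonadaptive f T \<le> s n * X n" using cX s0 by (intro mult_left_mono) auto
    \<comment> \<open>The extra \<open>1\<close> covers the floor of a negative value, which may
      increase the absolute value.\<close>
    define Z where "Z = \<lceil>s n * real n * real n + s n * (A * real n ^ B)\<rceil> + 1"
    have Z: "s n * real n * real n + s n * (A * real n ^ B) + 1 \<le> real_of_int Z" "real_of_int Z \<le> z n"
      unfolding Z_def z_def by (simp_all, linarith+)
    interpret run f T n "a + d" K S "Lm n" p q "\<lfloor>real S * f 1 1\<rfloor> + int n + 3" W Z b \<delta>
    proof
      show "length T = n" "0 < n" using n unfolding n_def by linarith+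
      show "set T \<subseteq> {..<(n + 1) ^ (a + d)}" using texts_bound[OF T] by (auto simp: n_def)
      show "positive_monotone_on (cost_nonadaptive f) T" by fact
      show "3 * (real_of_int p / real_of_int q) \<le> (b - real_of_int p / real_of_int q) * (real K * \<delta>)"
        using K' by (simp add: \<rho>_def)
      have "X n = \<delta> * x n" using \<delta> by (simp add: X_def x_def G_def)
      also have "\<dots> \<le> \<delta> * \<rho> ^ Lm n" using \<delta> Lm(1)[OF n] by (intro mult_left_mono) auto
      finally show "cost_nonadaptive f T \<le> \<delta> * (real_of_int p / real_of_int q) ^ Lm n"
        using cX by (simp add: \<rho>_def)
      have "0 \<le> s n * (A * real n ^ B)" using s0 A0 by simp
      then have "real_of_int (int (S * n * n)) \<le> real_of_int Z" using Z(1) by (simp add: S)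
      then show "int (S * n * n) \<le> Z" by (simp only: of_int_le_iff)
      show "\<bar>\<lfloor>real S * f l j\<rfloor>\<bar> \<le> Z" if "1 \<le> j" "j \<le> l" "l \<le> n" for j l
      proof -
        have "\<bar>f l j\<bar> \<le> A * real l ^ B" using f that by blast
        also have "\<dots> \<le> A * real n ^ B" using A0 that by (intro mult_left_mono power_mono) auto
        finally have "s n * \<bar>f l j\<bar> \<le> s n * (A * real n ^ B)" using s0 by (intro mult_left_mono)
        then have "\<bar>s n * f l j\<bar> \<le> s n * (A * real n ^ B)" using s0 by (simp add: abs_mult)
        moreover have "0 \<le> s n * real n * real n" using s0 by simp
        ultimately have "\<bar>s n * f l j\<bar> + 1 \<le> real_of_int Z" using Z(1) by linarith
        then show ?thesis unfolding S by linarith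
      qed
      have "(real n + 3) * real_of_int Z + 3 \<le> g1 n" using Z(2) by (simp add: g1_def mult_left_mono)
      then have "(real n + 3) * real_of_int Z + 3 < real_of_int W" using gW g0 unfolding g_def by linarith
      then have "real_of_int ((int n + 3) * Z + 3) < real_of_int W" by simp
      then show "(int n + 3) * Z + 3 < W" by (simp only: of_int_less_iff)
      have H: "\<rho>\<^sup>2 * (s n * cost_nonadaptive f T + n + 5) \<le> \<rho>\<^sup>2 * (s n * X n + n + 5)"
        using sc by (intro mult_left_mono) auto
      then have "\<rho>\<^sup>2 * (s n * cost_nonadaptive f T + n + 5) * p + 1 \<le> g2 n"
        unfolding g2_def using p0 by (intro add_right_mono mult_right_mono) auto
      then show "(real_of_int p / real_of_int q)\<^sup>2 * (real S * cost_nonadaptive f T + real n + 5) * real_of_int p + 1 < real_of_int W"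
        using gW g0 unfolding g_def S \<rho>_def by linarith
      have "real n * (s n * cost_nonadaptive f T + n + 3) \<le> real n * (s n * X n + n + 3)"
        using sc by (intro mult_left_mono) auto
      then show "real n * (real S * cost_nonadaptive f T + real n + 3) +
          (real_of_int p / real_of_int q)\<^sup>2 * (real S * cost_nonadaptive f T + real n + 5) + 1 < real_of_int W"
        using H gW g0 unfolding g_def S g3_def \<rho>_def by linarith
      have "real_of_int (2 ^ (Lm n + 2)) \<le> g4 n" using pow_Lm[OF n] by (simp add: g4_def)
      then have "real_of_int (2 ^ (Lm n + 2)) < real_of_int W" using gW g0 unfolding g_def by linarith
      then show "2 ^ (Lm n + 2) < W" by (simp only: of_int_less_iff)
      have "real (Lm n) \<le> 2 ^ Lm n" using less_exp[of "Lm n"] by (metis less_imp_le of_nat_le_iff of_nat_numeral of_nat_power)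
      then have "real (Lm n) \<le> (\<rho> * x n) ^ e" using pow_Lm[OF n] by (rule order_trans)
      then have "real_of_int (int (20 * n + Lm n + 1)) \<le> g5 n" by (simp add: g5_def)
      then have "real_of_int (int (20 * n + Lm n + 1)) \<le> real_of_int W" using gW g0 unfolding g_def by linarith
      then show "int (20 * n + Lm n + 1) \<le> W" by (simp only: of_int_le_iff)
      have "real_of_int (int ((n + 1) ^ (a + d))) = g6 n" by (simp add: g6_def add.commute)
      then have "real_of_int (int ((n + 1) ^ (a + d))) \<le> real_of_int W" using gW g0 unfolding g_def by linarith
      then show "int ((n + 1) ^ (a + d)) \<le> W" by (simp only: of_int_le_iff)
    qed (use q qp K_pos in \<open>auto simp: S_def \<delta>_def\<close>)
    show ?thesis using exec_partition by (simp only: W_def n_def)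
  qed
  \<comment> \<open>For linear space: the number of levels, a multiple of the logarithm, must not
    exceed a multiple of \<open>n\<close> independent of the base \<open>b\<close>.\<close>
  obtain N0 where N0: "\<And>n. N0 \<le> n \<Longrightarrow> log b (real n) \<le> real n"
  proof -
    have "((\<lambda>x::real. ln x / x) \<longlongrightarrow> 0) at_top" by (rule ln_x_over_x_tendsto_0)
    then have "eventually (\<lambda>x::real. ln x / x < ln b) at_top" using b by (intro order_tendstoD) auto
    then obtain M where M: "\<And>x::real. M \<le> x \<Longrightarrow> ln x / x < ln b" unfolding eventually_at_top_linorder by blast
    have "log b (real n) \<le> real n" if "nat \<lceil>M\<rceil> + 1 \<le> n" for n
    proof -
      have "M \<le> real n" "0 < real n" using that by linarith+
      then have "ln (real n) < ln b * real n" using M by (simp add: divide_less_eq)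
      then show ?thesis using b by (simp add: log_def divide_le_eq mult.commute)
    qed
    then show thesis by (rule that)
  qed
  \<comment> \<open>From here on \<open>b\<close> and \<open>G\<close> are at most \<open>n\<close>,
    so that \<open>log b n\<close> is at least \<open>1\<close> and at least
    \<open>log b G\<close>.\<close>
  define N where "N = N0 + nat \<lceil>G\<rceil> + nat \<lceil>b\<rceil> + 1"
  \<comment> \<open>The exponent \<open>B + 2\<close> and the factor \<open>G\<close> give
    \<open>B + 3\<close> logarithms to base \<open>b\<close>, doubled for base
    \<open>\<rho>\<close>; rounding up and the summand \<open>2\<close> add three more, in total
    \<open>2 * B + 9\<close>.\<close>
  have levels: "real (Lm n) + 2 \<le> real (2 * B + 9) * log b (real n)" "1 \<le> log b (real n)" "log b (real n) \<le> real n"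
    if "N \<le> n" for n
  proof -
    have n: "1 \<le> n" "G \<le> real n" "b \<le> real n" "N0 \<le> n" using that unfolding N_def by linarith+
    show "log b (real n) \<le> real n" by (rule N0[OF n(4)])
    show l1: "1 \<le> log b (real n)" using b n by (simp add: one_le_log_cancel_iff)
    have lG: "log b G \<le> log b (real n)" using b G n by simp
    have lx: "log b (x n) = log b G + real (B + 2) * log b (real n)"
      using b G n by (simp add: x_def log_mult log_nat_power distrib_right)
    have "ln b \<le> 2 * ln \<rho>"
    proof -
      have "ln (sqrt b) \<le> ln \<rho>" using \<rho> b by simp
      then show ?thesis using b by (simp add: ln_sqrt)
    qed
    then have "log \<rho> (x n) \<le> 2 * log b (x n)"
    proof -
      have "ln (x n) * ln b \<le> ln (x n) * (2 * ln \<rho>)"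
        using \<open>ln b \<le> 2 * ln \<rho>\<close> x[OF n(1)] by (intro mult_left_mono) auto
      then show ?thesis using \<rho> b by (simp add: log_def divide_le_eq le_divide_eq ac_simps)
    qed
    then have "log \<rho> (x n) \<le> 2 * (real (B + 3) * log b (real n))"
      using lx lG by (simp add: algebra_simps)
    then have "real (Lm n) + 2 \<le> 2 * (real (B + 3) * log b (real n)) + 3 * log b (real n)"
      using Lm(3)[OF n(1)] l1 by linarith
    then show "real (Lm n) + 2 \<le> real (2 * B + 9) * log b (real n)" by (simp add: algebra_simps)
  qed
  have "approx_partition_algorithm f (cost_nonadaptive f)
      {T \<in> texts a d. positive_monotone_on (cost_nonadaptive f) T} \<epsilon> (partition_prog K p q (a + d))
      (\<lambda>n. C * (real n * log (1 + \<epsilon>) (real n))) (\<lambda>n. C * real n)"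
    unfolding approx_partition_algorithm_def b_def[symmetric]
  proof (rule exI[of _ c], rule exI[of _ N], rule ballI)
    fix T assume "T \<in> {T \<in> texts a d. positive_monotone_on (cost_nonadaptive f) T}"
    then obtain t st Ps where r: "exec f ((int (length T) + 1) ^ c) (20 * length T + Lm (length T) + 1) (partition_prog K p q (a + d)) (input T) t st"
      "outputs st Ps" "Ps \<in> partitions T"
      "partition_cost (cost_nonadaptive f) Ps \<le> b * optimal_cost (cost_nonadaptive f) T"
      "t \<le> (100 * (a + d) + 200 * (Lm (length T) + 2) + 40) * length T" using run[of T] by blast
    let ?n = "length T" and ?l = "log b (real (length T))"
    have "real t \<le> C * (real ?n * ?l) \<and> real (20 * ?n + Lm ?n + 1) \<le> C * real ?n" if N: "N \<le> ?n"
    proof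
      note l = levels[OF N]
      have "real t \<le> real ((100 * (a + d) + 200 * (Lm ?n + 2) + 40) * ?n)" using r(5) by (simp only: of_nat_le_iff)
      also have "\<dots> = (real (100 * (a + d) + 40) + 200 * (real (Lm ?n) + 2)) * real ?n" by simp
      also have "\<dots> \<le> (C * ?l) * real ?n"
      proof (rule mult_right_mono)
        have "real (100 * (a + d) + 40) * 1 \<le> real (100 * (a + d) + 40) * ?l" using l by (intro mult_left_mono) auto
        then show "real (100 * (a + d) + 40) + 200 * (real (Lm ?n) + 2) \<le> C * ?l"
          using l by (simp add: C_def algebra_simps)
      qed simp
      finally show "real t \<le> C * (real ?n * ?l)" by (simp add: ac_simps)
      have "real (2 * B + 9) * ?l \<le> real (2 * B + 9) * real ?n" using l by (intro mult_left_mono) auto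
      then have "real (20 * ?n + Lm ?n + 1) \<le> (20 + real (2 * B + 9)) * real ?n" using l by (simp add: algebra_simps)
      also have "\<dots> \<le> C * real ?n" unfolding C_def by (intro mult_right_mono) auto
      finally show "real (20 * ?n + Lm ?n + 1) \<le> C * real ?n" .
    qed
    then show "\<exists>m t st Ps. exec f ((int ?n + 1) ^ c) m (partition_prog K p q (a + d)) (input T) t st \<and>
       outputs st Ps \<and> Ps \<in> partitions T \<and>
       partition_cost (cost_nonadaptive f) Ps \<le> b * optimal_cost (cost_nonadaptive f) T \<and>
       (N \<le> ?n \<longrightarrow> real t \<le> C * (real ?n * ?l) \<and> real m \<le> C * real ?n)"
      using r by blast
  qed
  then show ?thesis by blast
qed

section \<open>The adaptive estimate\<close>

definition singletons_prog :: prog where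
  "singletons_prog = WhileLess (Reg 3) (Reg 0) (Store (Reg 3) (Imm 1) ;; Bin 3 Add (Reg 3) (Imm 1))"

text \<open>Multinomial coefficients are at least one. The index set is kept fixed, so that
  appending a symbol changes just one factor.\<close>

lemma prod_fact_count_le:
  assumes "finite A"
  shows "(\<Prod>c\<in>A. fact (count_list w c) :: real) \<le> fact (length w)"
proof (induction w)
  case (Cons x w)
  let ?P = "\<lambda>B w. \<Prod>c\<in>B. fact (count_list w c) :: real"
  have nonneg: "0 \<le> ?P B w" for B by (intro prod_nonneg) simp
  show ?case
  proof (cases "x \<in> A")
    case True
    have eq: "?P (A - {x}) (x # w) = ?P (A - {x}) w" by (intro prod.cong) auto
    have "?P A (x # w) = real (Suc (count_list w x)) * ?P A w"
      using prod.remove[OF assms True, of "\<lambda>c. fact (count_list (x # w) c) :: real"]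
        prod.remove[OF assms True, of "\<lambda>c. fact (count_list w c) :: real"] eq by simp
    also have "\<dots> \<le> real (Suc (length w)) * fact (length w)"
      using Cons nonneg count_le_length[of w x] by (intro mult_mono) auto
    finally show ?thesis by simp
  next
    case False
    then have "?P A (x # w) = ?P A w" by (intro prod.cong) auto
    also have "\<dots> \<le> 1 * fact (length w)" using Cons by simp
    also have "\<dots> \<le> real (Suc (length w)) * fact (length w)" by (intro mult_right_mono) auto
    finally show ?thesis by simp
  qed
qed simp

lemma cost_adaptive_nonneg: "0 \<le> cost_adaptive w"
proof (cases "w = []")
  case False
  have "(\<Sum>c\<in>set w. log 2 (fact (count_list w c))) = log 2 (\<Prod>c\<in>set w. fact (count_list w c))"
    by (simp add: log_def ln_prod flip: sum_divide_distrib)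
  also have "\<dots> \<le> log 2 (fact (length w))"
    using prod_fact_count_le[of "set w" w] by (subst log_le_cancel_iff) (auto intro: prod_pos)
  finally show ?thesis using False by (simp add: cost_adaptive_def H0a_def)
qed (simp add: cost_adaptive_def)

lemma exec_singletons:
  assumes T: "T \<noteq> []" "\<forall>x\<in>set T. int x < W" and W: "int (length T) < W"
  shows "\<exists>t st. exec f W (length T) singletons_prog (input T) t st \<and>
    outputs st (map (\<lambda>x. [x]) T) \<and> t \<le> 3 * length T + 1"
proof -
  let ?n = "length T"
  let ?M = "\<lambda>i. if i < length T then int (T ! i) else 0" and ?R = "(\<lambda>_. 0 :: int)(0 := int (length T))"
  interpret ram f W ?n using W by unfold_locales simp
  have bnd: "bounded W (?R, ?M)" using T W by (auto simp: bounded_def)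
  let ?Q = "\<lambda>(R :: nat \<Rightarrow> int, M :: nat \<Rightarrow> int) (t :: nat). R 0 = int ?n \<and> (\<forall>j<?n. M j = 1)"
  let ?I = "\<lambda>(R :: nat \<Rightarrow> int, M :: nat \<Rightarrow> int) t. \<exists>i\<le>?n. R 0 = int ?n \<and> R 3 = int i \<and> (\<forall>j<i. M j = 1) \<and> 3 * (?n - i) + 1 \<le> t"
  have W1: "1 < W" using W T by (cases T) auto
  have "wp singletons_prog ?Q (?R, ?M) (3 * ?n + 1)"
    unfolding singletons_prog_def
  proof (rule wp_While[where I = ?I], goal_cases)
    case (2 R M t)
    then obtain i where i: "i < ?n" "R 0 = int ?n" "R 3 = int i" "\<forall>j<i. M j = 1" "3 * (?n - i) + 1 \<le> t" by auto
    have "3 * (?n - Suc i) + 1 \<le> t - Suc (Suc (Suc 0))" using i by linarith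
    then show ?case
      using i W W1 by (intro conjI wp_Seq wp_Add wp_Store[where a = i])
        (auto simp: less_Suc_eq intro!: exI[of _ "Suc i"])
  qed auto
  then have "\<exists>t' st' u. exec f W ?n singletons_prog (?R, ?M) t' st' \<and> t' \<le> 3 * ?n + 1 \<and> ?Q st' u"
    using bnd by (rule wp_exec)
  then show ?thesis by (auto simp: input_def outputs_def)
qed

lemma adaptive_algorithm:
  assumes \<epsilon>: "0 < \<epsilon>"
  shows "\<exists>P. approx_partition_algorithm (\<lambda>_ _. 0) cost_adaptive (texts a d) \<epsilon> P
          (\<lambda>n. 4 * (real n * log (1 + \<epsilon>) (real n))) (\<lambda>n. 4 * real n)"
proof -
  have "approx_partition_algorithm (\<lambda>_ _. 0) cost_adaptive (texts a d) \<epsilon> singletons_prog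
          (\<lambda>n. 4 * (real n * log (1 + \<epsilon>) (real n))) (\<lambda>n. 4 * real n)"
    unfolding approx_partition_algorithm_def
  \<comment> \<open>The extra exponent makes the length itself a word. From
    \<open>1 + \<epsilon>\<close> on the logarithm is at least one, so linear time is within the
    bound.\<close>
  proof (rule exI[of _ "a + d + 1"], rule exI[of _ "nat \<lceil>1 + \<epsilon>\<rceil>"], rule ballI)
    fix T assume T: "T \<in> texts a d"
    let ?n = "length T" and ?W = "(int (length T) + 1) ^ (a + d + 1)" and ?Ps = "map (\<lambda>x. [x]) T"
    have "T \<noteq> []" using T by (simp add: texts_def)
    then have n: "1 \<le> ?n" by (simp add: Suc_le_eq)
    have "int x < ?W" if "x \<in> set T" for x
    proof -
      have "int x < int ((?n + 1) ^ (a + d))" using texts_bound[OF T that] by (simp only: of_nat_less_iff)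
      also have "\<dots> = (int ?n + 1) ^ (a + d)" by (simp add: add.commute)
      also have "\<dots> \<le> ?W" by (intro power_increasing) auto
      finally show ?thesis .
    qed
    moreover have "(int ?n + 1) ^ 1 \<le> ?W" by (intro power_increasing) auto
    then have "int ?n < ?W" unfolding power_one_right by linarith
    ultimately obtain t st where e: "exec (\<lambda>_ _. 0) ?W ?n singletons_prog (input T) t st" "outputs st ?Ps" "t \<le> 3 * ?n + 1"
      using exec_singletons[of T ?W "\<lambda>_ _. 0"] \<open>T \<noteq> []\<close> by blast
    have part: "?Ps \<in> partitions T" by (auto simp: partitions_def)
    have "partition_cost cost_adaptive ?Ps = 0"
      by (simp add: partition_cost_def cost_adaptive_singleton comp_def)
    moreover have "0 \<le> optimal_cost cost_adaptive T"
      unfolding optimal_cost_def using finite_partitions partitions_nonempty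
      by (auto simp: partition_cost_def intro!: Min.boundedI sum_list_nonneg cost_adaptive_nonneg)
    ultimately have opt: "partition_cost cost_adaptive ?Ps \<le> (1 + \<epsilon>) * optimal_cost cost_adaptive T" using \<epsilon> by simp
    have "real t \<le> 4 * (real ?n * log (1 + \<epsilon>) (real ?n))" if N: "nat \<lceil>1 + \<epsilon>\<rceil> \<le> ?n"
    proof -
      have "1 + \<epsilon> \<le> real ?n" using N by linarith
      then have "1 \<le> log (1 + \<epsilon>) (real ?n)" using \<epsilon> \<open>T \<noteq> []\<close> by simp
      then have "real ?n * 1 \<le> real ?n * log (1 + \<epsilon>) (real ?n)" by (intro mult_left_mono) auto
      moreover have "real t \<le> 4 * real ?n" using e(3) n by linarith
      ultimately show ?thesis by linarith
    qed
    then show "\<exists>m t st Ps. exec (\<lambda>_ _. 0) ?W m singletons_prog (input T) t st \<and> outputs st Ps \<and> Ps \<in> partitions T \<and>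
        partition_cost cost_adaptive Ps \<le> (1 + \<epsilon>) * optimal_cost cost_adaptive T \<and>
        (nat \<lceil>1 + \<epsilon>\<rceil> \<le> ?n \<longrightarrow> real t \<le> 4 * (real ?n * log (1 + \<epsilon>) (real ?n)) \<and> real m \<le> 4 * real ?n)"
      using e part opt by (intro exI[of _ ?n] exI[of _ t] exI[of _ st] exI[of _ ?Ps]) simp
  qed
  then show ?thesis by blast
qed

theorem theorem3:
  fixes a d :: nat
  shows
    "(\<forall>f0. polynomially_bounded f0 \<longrightarrow>
        (\<exists>C. \<forall>\<epsilon>>0. \<exists>P.
           approx_partition_algorithm f0 (cost_nonadaptive f0)
             {T \<in> texts a d. positive_monotone_on (cost_nonadaptive f0) T} \<epsilon> P
             (\<lambda>n. C * (real n * log (1 + \<epsilon>) (real n))) (\<lambda>n. C * real n))) \<and>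
     (\<exists>C. \<forall>\<epsilon>>0. \<exists>P.
        approx_partition_algorithm (\<lambda>_ _. 0) cost_adaptive (texts a d) \<epsilon> P
          (\<lambda>n. C * (real n * log (1 + \<epsilon>) (real n))) (\<lambda>n. C * real n))"
proof (intro conjI allI impI)
  show "\<exists>C. \<forall>\<epsilon>>0. \<exists>P. approx_partition_algorithm (\<lambda>_ _. 0) cost_adaptive (texts a d) \<epsilon> P
          (\<lambda>n. C * (real n * log (1 + \<epsilon>) (real n))) (\<lambda>n. C * real n)"
    using adaptive_algorithm by blast
  fix f0 :: "nat \<Rightarrow> nat \<Rightarrow> real"
  assume "polynomially_bounded f0"
  then obtain A B where AB: "\<forall>m k. 1 \<le> k \<and> k \<le> m \<longrightarrow> \<bar>f0 m k\<bar> \<le> A * real m ^ B"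
    unfolding polynomially_bounded_def by blast
  show "\<exists>C. \<forall>\<epsilon>>0. \<exists>P. approx_partition_algorithm f0 (cost_nonadaptive f0)
             {T \<in> texts a d. positive_monotone_on (cost_nonadaptive f0) T} \<epsilon> P
             (\<lambda>n. C * (real n * log (1 + \<epsilon>) (real n))) (\<lambda>n. C * real n)"
  proof (cases "0 < f0 1 1")
    case True
    show ?thesis using nonadaptive_algorithm[OF AB True] by blast
  next
    case False
    \<comment> \<open>Single symbols cost \<open>f0 1 1\<close>, so here no nonempty text has
      positive costs and there is nothing to solve.\<close>
    have "{T \<in> texts a d. positive_monotone_on (cost_nonadaptive f0) T} = {}"
    proof (rule equals0I)
      fix T assume "T \<in> {T \<in> texts a d. positive_monotone_on (cost_nonadaptive f0) T}"
      then have T: "T \<noteq> []" "positive_monotone_on (cost_nonadaptive f0) T" by (auto simp: texts_def)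
      then have "sublist [hd T] T" using sublist_take[of 1 T] by (cases T) auto
      then have "0 < cost_nonadaptive f0 [hd T]" using T(2) unfolding positive_monotone_on_def by blast
      then show False using False by (simp add: cost_singleton)
    qed
    then show ?thesis unfolding approx_partition_algorithm_def by (simp only: ball_empty) blast
  qed
qed

end
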